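(* Let $(p(n))_{n\ge 1}$ and $(q(n))_{n\ge 1}$ be sequences of integers such that $$p(n+1)-p(n)\to+\infty \quad\text{and}\quad q(n+1)-q(n)\to+\infty \qquad (n\to\infty).$$ Then there exist a probability space $(X,\mu)$, automorphisms $S,T$ of $(X,\mu)$ each having simple singular spectrum, and a measurable set $C\subset X$ such that the sequence $$\frac1N\sum_{n=1}^{N}\mu\bigl(S^{p(n)}C\cap T^{q(n)}C\bigr),\qquad N=1,2,3,\dots,$$ diverges (i.e. has no limit as $N\to\infty$).
   Context: A probability space here is a standard (Lebesgue) probability space, and an automorphism of it is an invertible measure-preserving transformation (bimeasurable, defined modulo null sets). The spectrum of an automorphism $T$ is that of the unitary operator $f\mapsto f\circ T$ on $L_2(X,\mu)$. The spectrum is simple if this operator has a cyclic vector, and singular if the maximal spectral type of this operator is singular with respect to Lebesgue measure on the unit circle. *)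

theory Defs
  imports "HOL-Probability.Probability"
begin

definition iso_mod_null :: "'a measure \<Rightarrow> 'b measure \<Rightarrow> bool" where
  "iso_mod_null M N \<longleftrightarrow>
     (\<exists>A \<in> null_sets M. \<exists>B \<in> null_sets N. \<exists>f g.
        f \<in> measurable (restrict_space M (space M - A)) (restrict_space N (space N - B)) \<and>
        g \<in> measurable (restrict_space N (space N - B)) (restrict_space M (space M - A)) \<and>
        (\<forall>x \<in> space M - A. g (f x) = x) \<and>
        (\<forall>y \<in> space N - B. f (g y) = y) \<and>
        distr (restrict_space M (space M - A)) (restrict_space N (space N - B)) f
          = restrict_space N (space N - B))"

text \<open>
  The completion makes the notion independent of whether a standard probability space is
  presented with its Borel sets or with all Lebesgue measurable sets. The spaces are non-atomic.
\<close>

definition standard_prob_space :: "'a measure \<Rightarrow> bool" where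
  "standard_prob_space M \<longleftrightarrow>
     prob_space M \<and> iso_mod_null (completion M) (lebesgue_on {0..1::real})"

text \<open>
  Automorphisms are considered modulo null sets. On a standard probability space, every class
  has a representative that is a bijection of the whole space, up to completing the measure;
  the predicate describes such representatives.
\<close>

definition automorphism :: "'a measure \<Rightarrow> ('a \<Rightarrow> 'a) \<Rightarrow> bool" where
  "automorphism M T \<longleftrightarrow>
     bij_betw T (space M) (space M) \<and>
     T \<in> measurable M M \<and>
     inv_into (space M) T \<in> measurable M M \<and>
     distr M M T = M"

definition aut_power :: "'a measure \<Rightarrow> ('a \<Rightarrow> 'a) \<Rightarrow> int \<Rightarrow> 'a \<Rightarrow> 'a" where
  "aut_power M T k =
     (if k \<ge> 0 then T ^^ nat k else inv_into (space M) T ^^ nat (- k))"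

text \<open>
  Elements of \<open>L\<^sub>2\<close> are represented by functions; equality almost everywhere is
  distance zero for the seminorm below.
\<close>

definition L2_funs :: "'a measure \<Rightarrow> ('a \<Rightarrow> complex) set" where
  "L2_funs M = {f \<in> borel_measurable M. integrable M (\<lambda>x. (cmod (f x))\<^sup>2)}"

definition L2_seminorm :: "'a measure \<Rightarrow> ('a \<Rightarrow> complex) \<Rightarrow> real" where
  "L2_seminorm M f = sqrt (\<integral>x. (cmod (f x))\<^sup>2 \<partial>M)"

definition L2_inner :: "'a measure \<Rightarrow> ('a \<Rightarrow> complex) \<Rightarrow> ('a \<Rightarrow> complex) \<Rightarrow> complex" where
  "L2_inner M f g = (\<integral>x. f x * cnj (g x) \<partial>M)"

definition koopman :: "('a \<Rightarrow> 'a) \<Rightarrow> ('a \<Rightarrow> complex) \<Rightarrow> 'a \<Rightarrow> complex" where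
  "koopman T f = f \<circ> T"

text \<open>
  The \<open>k\<close>-th power of the Koopman operator of \<open>T\<close> is the Koopman operator of
  the \<open>k\<close>-th power of \<open>T\<close>, for every integer \<open>k\<close>. A vector is cyclic for a unitary
  operator if its two-sided orbit spans a dense subspace.
\<close>

definition cyclic_vector :: "'a measure \<Rightarrow> ('a \<Rightarrow> 'a) \<Rightarrow> ('a \<Rightarrow> complex) \<Rightarrow> bool" where
  "cyclic_vector M T f \<longleftrightarrow>
     f \<in> L2_funs M \<and>
     (\<forall>g \<in> L2_funs M. \<forall>\<epsilon>>0. \<exists>(F :: int set) c. finite F \<and>
        L2_seminorm M (\<lambda>x. g x - (\<Sum>k\<in>F. c k * koopman (aut_power M T k) f x)) < \<epsilon>)"

definition simple_spectrum :: "'a measure \<Rightarrow> ('a \<Rightarrow> 'a) \<Rightarrow> bool" where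
  "simple_spectrum M T \<longleftrightarrow> (\<exists>f. cyclic_vector M T f)"

definition circle_borel :: "complex measure" where
  "circle_borel = restrict_space borel (sphere 0 1)"

definition circle_lebesgue :: "complex measure" where
  "circle_lebesgue = distr (restrict_space lborel {0..<2 * pi}) circle_borel cis"

text \<open>
  The spectral measure of \<open>f\<close> is the finite Borel measure on the circle whose Fourier
  coefficients are the numbers \<open>\<langle>U\<^sup>k f, f\<rangle>\<close>.
\<close>

definition spectral_measure ::
    "'a measure \<Rightarrow> ('a \<Rightarrow> 'a) \<Rightarrow> ('a \<Rightarrow> complex) \<Rightarrow> complex measure \<Rightarrow> bool" where
  "spectral_measure M T f \<sigma> \<longleftrightarrow>
     finite_measure \<sigma> \<and> sets \<sigma> = sets circle_borel \<and>
     (\<forall>k::int. (\<integral>z. z powi k \<partial>\<sigma>) = L2_inner M (koopman (aut_power M T k) f) f)"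

text \<open>
  The maximal spectral type is a measure class; \<open>\<sigma>\<close> is a representative of it that
  is itself a spectral measure and dominates all the others.
\<close>

definition maximal_spectral_type ::
    "'a measure \<Rightarrow> ('a \<Rightarrow> 'a) \<Rightarrow> complex measure \<Rightarrow> bool" where
  "maximal_spectral_type M T \<sigma> \<longleftrightarrow>
     (\<exists>f \<in> L2_funs M. spectral_measure M T f \<sigma>) \<and>
     (\<forall>g \<in> L2_funs M. \<forall>\<nu>. spectral_measure M T g \<nu> \<longrightarrow> absolutely_continuous \<sigma> \<nu>)"

definition mutually_singular :: "'a measure \<Rightarrow> 'a measure \<Rightarrow> bool" where
  "mutually_singular \<mu> \<nu> \<longleftrightarrow>
     (\<exists>A. A \<in> null_sets \<mu> \<and> space \<nu> - A \<in> null_sets \<nu>)"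

definition singular_spectrum :: "'a measure \<Rightarrow> ('a \<Rightarrow> 'a) \<Rightarrow> bool" where
  "singular_spectrum M T \<longleftrightarrow>
     (\<exists>\<sigma>. maximal_spectral_type M T \<sigma> \<and> mutually_singular \<sigma> circle_lebesgue)"

end

(*
  Both automorphisms are conjugate to one two-point skew product S(y, g) = (y + 1, g + phi(y)) over an
  odometer, the second by a map acting on the odometer only, and C is the set g = 0. On the tower of
  height h_j the cocycle phi is a coboundary of a sign pattern u_j, and u_(j+1) is a concatenation of
  blocks u_j with chosen signs. Hence mu(S^p C /\ T^q C) is half the probability that
  u_j(y) u_j(y - p) agrees with the same expression for q at the image of y under the conjugation.

  Most consecutive signs alternate. This makes S of rank one up to small sets, and S^(2 h_j) close to the
  identity, so the spectrum is simple and singular. The remaining freedom in the signs lets the words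
  of length M run through all words. Once consecutive times p(n) differ by more than a block, they read
  distinct letters of the word, so a permutation of the letters (with sign changes) as conjugation
  forces agreement, or disagreement, for all n in a long range of times. Alternating between
  the two makes the averages oscillate.

  Simple spectrum is obtained by a Baire type argument in L_2, using that b lies in the cyclic space
  of Q(U) b if the polynomial Q has no zero on the unit circle. The spectral measure of a
  cyclic vector comes from Herglotz' theorem, and rigidity makes it singular.
*)
theory Submission
  imports Defs "HOL-Computational_Algebra.Fundamental_Theorem_Algebra"
begin

text \<open>Conjugate automorphisms have the same spectrum, so the spectral conditions concern one
  map only and the freedom of the second map lies in the conjugation. The obstacle is that one
  conjugation has to prescribe the correlations at all times n of a range l < n \<le> 8 l. Words
  solve this: for a point at a fixed offset inside a word, the letters read at these times are
  distinct coordinates of the cube of all words, and permuting coordinates with sign changes is a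
  bijection of the cube, hence part of a measure-preserving map. Gaps tending to infinity keep the
  coordinates distinct. Rank one behaviour pulls the other way, as it asks for alternating signs;
  therefore each letter is spread over a long alternating run, and only the ends of runs are
  irregular, in a proportion that tends to 0. A word has eight times as many letters as the largest
  value of p and q on the range, so positions from which an orbit might leave the word fill one
  eighth. The range contains 7/8 of the times up to 8 l. Agreement then gives averages of at least
  49/128, disagreement at most 15/64.\<close>

section \<open>Calculus with square-integrable functions\<close>

lemma L2_funsD:
  assumes "f \<in> L2_funs M"
  shows "f \<in> borel_measurable M" "integrable M (\<lambda>x. (cmod (f x))\<^sup>2)"
  using assms by (auto simp: L2_funs_def)

lemma L2_seminorm_nonneg [simp]: "0 \<le> L2_seminorm M f"
  by (simp add: L2_seminorm_def)

lemma L2_seminorm_square: "(L2_seminorm M f)\<^sup>2 = (\<integral>x. (cmod (f x))\<^sup>2 \<partial>M)"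
  by (simp add: L2_seminorm_def)

lemma L2_seminorm_cong:
  assumes "\<And>x. x \<in> space M \<Longrightarrow> f x = g x"
  shows "L2_seminorm M f = L2_seminorm M g"
  unfolding L2_seminorm_def by (intro arg_cong[where f=sqrt] Bochner_Integration.integral_cong) (auto simp: assms)

lemma L2_mult_integrable:
  assumes f: "f \<in> L2_funs M" and g: "g \<in> L2_funs M"
  shows "integrable M (\<lambda>x. cmod (f x) * cmod (g x))"
proof (rule Bochner_Integration.integrable_bound)
  show "integrable M (\<lambda>x. (cmod (f x))\<^sup>2 + (cmod (g x))\<^sup>2)"
    using L2_funsD[OF f] L2_funsD[OF g] by auto
  show "(\<lambda>x. cmod (f x) * cmod (g x)) \<in> borel_measurable M"
    using L2_funsD[OF f] L2_funsD[OF g] by measurable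
  have "cmod (f x) * cmod (g x) \<le> (cmod (f x))\<^sup>2 + (cmod (g x))\<^sup>2" for x
    using sum_squares_bound[of "cmod (f x)" "cmod (g x)"] mult_nonneg_nonneg[OF norm_ge_zero norm_ge_zero, of "f x" "g x"] by linarith
  then show "AE x in M. norm (cmod (f x) * cmod (g x)) \<le> norm ((cmod (f x))\<^sup>2 + (cmod (g x))\<^sup>2)"
    by (auto simp: abs_mult)
qed

lemma L2_inner_integrable:
  assumes f: "f \<in> L2_funs M" and g: "g \<in> L2_funs M"
  shows "integrable M (\<lambda>x. f x * cnj (g x))"
proof -
  have "(\<lambda>x. f x * cnj (g x)) \<in> borel_measurable M"
    using L2_funsD(1)[OF f] L2_funsD(1)[OF g] borel_measurable_continuous_onI[OF continuous_on_cnj[OF continuous_on_id]]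
    by (intro borel_measurable_times) (auto intro!: measurable_compose[OF _ borel_measurable_continuous_onI] continuous_intros)
  then show ?thesis
    using L2_mult_integrable[OF f g] by (subst integrable_norm_iff[symmetric]) (auto simp: norm_mult)
qed

lemma L2_Cauchy_Schwarz:
  assumes f: "f \<in> L2_funs M" and g: "g \<in> L2_funs M"
  shows "(\<integral>x. cmod (f x) * cmod (g x) \<partial>M) \<le> L2_seminorm M f * L2_seminorm M g"
proof -
  define a b I where "a = L2_seminorm M f" and "b = L2_seminorm M g"
    and "I = (\<integral>x. cmod (f x) * cmod (g x) \<partial>M)"
  note i = L2_mult_integrable[OF f g] L2_funsD(2)[OF f] L2_funsD(2)[OF g]
  have quad: "2 * s * t * I \<le> s\<^sup>2 * a\<^sup>2 + t\<^sup>2 * b\<^sup>2" for s t :: real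
  proof -
    have "2 * s * t * I = (\<integral>x. 2 * s * t * (cmod (f x) * cmod (g x)) \<partial>M)"
      by (simp add: I_def)
    also have "\<dots> \<le> (\<integral>x. s\<^sup>2 * (cmod (f x))\<^sup>2 + t\<^sup>2 * (cmod (g x))\<^sup>2 \<partial>M)"
    proof (intro integral_mono)
      show "2 * s * t * (cmod (f x) * cmod (g x)) \<le> s\<^sup>2 * (cmod (f x))\<^sup>2 + t\<^sup>2 * (cmod (g x))\<^sup>2" for x
        using sum_squares_bound[of "s * cmod (f x)" "t * cmod (g x)"] by (simp add: power_mult_distrib ac_simps)
    qed (use i in auto)
    also have "\<dots> = s\<^sup>2 * a\<^sup>2 + t\<^sup>2 * b\<^sup>2"
      using i by (simp add: a_def b_def L2_seminorm_square)
    finally show ?thesis .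
  qed
  have nn: "a \<ge> 0" "b \<ge> 0" by (auto simp: a_def b_def)
  \<comment> \<open>The choice s = b, t = a says nothing if a seminorm vanishes. Both are enlarged
    by \<open>e\<close>, so that the positive factor (a + e) (b + e) can be cancelled;
    \<open>e\<close> tends to 0 afterwards.\<close>
  have bound: "I \<le> (a + e) * (b + e)" if e: "e > 0" for e
  proof -
    define a' b' where "a' = a + e" and "b' = b + e"
    have "a\<^sup>2 \<le> a'\<^sup>2" "b\<^sup>2 \<le> b'\<^sup>2"
      using nn e by (auto simp: a'_def b'_def intro!: power_mono)
    then have "b'\<^sup>2 * a\<^sup>2 + a'\<^sup>2 * b\<^sup>2 \<le> b'\<^sup>2 * a'\<^sup>2 + a'\<^sup>2 * b'\<^sup>2"
      by (intro add_mono mult_left_mono) auto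
    then have *: "2 * b' * a' * I \<le> b'\<^sup>2 * a'\<^sup>2 + a'\<^sup>2 * b'\<^sup>2"
      using quad[of b' a'] by simp
    have pos: "a' * b' > 0" using nn e by (simp add: a'_def b'_def)
    have "(a' * b') * I \<le> (a' * b') * (a' * b')" using * by (simp add: power2_eq_square algebra_simps)
    then have "I \<le> a' * b'" using pos by (simp add: mult_le_cancel_left)
    then show ?thesis by (simp add: a'_def b'_def)
  qed
  have "((\<lambda>e. (a + e) * (b + e)) \<longlongrightarrow> (a + 0) * (b + 0)) (at_right 0)"
    by (intro tendsto_intros)
  then have "I \<le> (a + 0) * (b + 0)"
    by (rule tendsto_lowerbound) (auto simp: eventually_at_filter bound)
  then show ?thesis by (simp add: a_def b_def I_def)
qed

lemma L2_zero [simp]: "(\<lambda>x. 0) \<in> L2_funs M"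
  by (simp add: L2_funs_def)

lemma L2_cmult:
  assumes f: "f \<in> L2_funs M"
  shows "(\<lambda>x. c * f x) \<in> L2_funs M"
  using L2_funsD[OF f] by (auto simp: L2_funs_def norm_mult power_mult_distrib)

lemma L2_seminorm_cmult: "L2_seminorm M (\<lambda>x. c * f x) = cmod c * L2_seminorm M f"
  by (simp add: L2_seminorm_def norm_mult power_mult_distrib real_sqrt_mult)

lemma L2_add_and_triangle:
  assumes f: "f \<in> L2_funs M" and g: "g \<in> L2_funs M"
  shows L2_add: "(\<lambda>x. f x + g x) \<in> L2_funs M"
    and L2_triangle: "L2_seminorm M (\<lambda>x. f x + g x) \<le> L2_seminorm M f + L2_seminorm M g"
proof -
  have i: "integrable M (\<lambda>x. (cmod (f x))\<^sup>2 + 2 * (cmod (f x) * cmod (g x)) + (cmod (g x))\<^sup>2)"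
    using L2_mult_integrable[OF f g] L2_funsD(2)[OF f] L2_funsD(2)[OF g] by auto
  have le: "(cmod (f x + g x))\<^sup>2 \<le> (cmod (f x))\<^sup>2 + 2 * (cmod (f x) * cmod (g x)) + (cmod (g x))\<^sup>2" for x
    using power_mono[OF norm_triangle_ineq[of "f x" "g x"], of 2] by (simp add: power2_sum)
  have m: "(\<lambda>x. f x + g x) \<in> borel_measurable M"
    using L2_funsD(1)[OF f] L2_funsD(1)[OF g] by measurable
  have j: "integrable M (\<lambda>x. (cmod (f x + g x))\<^sup>2)"
    by (rule Bochner_Integration.integrable_bound[OF i]) (use m le in \<open>auto intro!: AE_I2 order_trans[OF le]\<close>)
  show "(\<lambda>x. f x + g x) \<in> L2_funs M"
    using m j by (simp add: L2_funs_def)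
  have "(L2_seminorm M (\<lambda>x. f x + g x))\<^sup>2 \<le> (\<integral>x. (cmod (f x))\<^sup>2 + 2 * (cmod (f x) * cmod (g x)) + (cmod (g x))\<^sup>2 \<partial>M)"
    unfolding L2_seminorm_square by (rule integral_mono[OF j i le])
  also have "\<dots> = (L2_seminorm M f)\<^sup>2 + 2 * (\<integral>x. cmod (f x) * cmod (g x) \<partial>M) + (L2_seminorm M g)\<^sup>2"
    using L2_mult_integrable[OF f g] L2_funsD(2)[OF f] L2_funsD(2)[OF g] by (simp add: L2_seminorm_square)
  also have "\<dots> \<le> (L2_seminorm M f)\<^sup>2 + 2 * (L2_seminorm M f * L2_seminorm M g) + (L2_seminorm M g)\<^sup>2"
    using L2_Cauchy_Schwarz[OF f g] by simp
  also have "\<dots> = (L2_seminorm M f + L2_seminorm M g)\<^sup>2"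
    by (simp add: power2_sum)
  finally show "L2_seminorm M (\<lambda>x. f x + g x) \<le> L2_seminorm M f + L2_seminorm M g"
    by (rule power2_le_imp_le) simp
qed

lemma L2_diff:
  assumes "f \<in> L2_funs M" "g \<in> L2_funs M"
  shows "(\<lambda>x. f x - g x) \<in> L2_funs M"
  using L2_add[OF assms(1) L2_cmult[OF assms(2), of "-1"]] by simp

lemma L2_seminorm_minus_commute: "L2_seminorm M (\<lambda>x. f x - g x) = L2_seminorm M (\<lambda>x. g x - f x)"
  by (simp add: L2_seminorm_def norm_minus_commute)

lemma L2_triangle_diff:
  assumes "f \<in> L2_funs M" "g \<in> L2_funs M" "h \<in> L2_funs M"
  shows "L2_seminorm M (\<lambda>x. f x - h x) \<le> L2_seminorm M (\<lambda>x. f x - g x) + L2_seminorm M (\<lambda>x. g x - h x)"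
  using L2_triangle[OF L2_diff[OF assms(1,2)] L2_diff[OF assms(2,3)]] by simp

lemma L2_seminorm_le_add_diff:
  assumes "f \<in> L2_funs M" "g \<in> L2_funs M"
  shows "L2_seminorm M f \<le> L2_seminorm M (\<lambda>x. f x - g x) + L2_seminorm M g"
  using L2_triangle[OF L2_diff[OF assms] assms(2)] by simp

lemma L2_sum:
  assumes "\<And>i. i \<in> I \<Longrightarrow> f i \<in> L2_funs M"
  shows "(\<lambda>x. \<Sum>i\<in>I. f i x) \<in> L2_funs M"
    and "L2_seminorm M (\<lambda>x. \<Sum>i\<in>I. f i x) \<le> (\<Sum>i\<in>I. L2_seminorm M (f i))"
proof -
  have "(\<lambda>x. \<Sum>i\<in>I. f i x) \<in> L2_funs M \<and> L2_seminorm M (\<lambda>x. \<Sum>i\<in>I. f i x) \<le> (\<Sum>i\<in>I. L2_seminorm M (f i))"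
    using assms
  proof (induction I rule: infinite_finite_induct)
    case (insert a I)
    then have "f a \<in> L2_funs M" "(\<lambda>x. \<Sum>i\<in>I. f i x) \<in> L2_funs M" by auto
    from L2_add[OF this] L2_triangle[OF this] insert show ?case by auto
  qed (auto simp: L2_seminorm_def)
  then show "(\<lambda>x. \<Sum>i\<in>I. f i x) \<in> L2_funs M"
    and "L2_seminorm M (\<lambda>x. \<Sum>i\<in>I. f i x) \<le> (\<Sum>i\<in>I. L2_seminorm M (f i))" by auto
qed

lemma (in finite_measure) L2_bounded:
  assumes "f \<in> borel_measurable M" "\<And>x. x \<in> space M \<Longrightarrow> cmod (f x) \<le> B"
  shows "f \<in> L2_funs M"
proof -
  have "integrable M (\<lambda>x. (cmod (f x))\<^sup>2)"
    by (rule integrable_const_bound[where B="B\<^sup>2"]) (use assms in \<open>auto intro!: AE_I2 power_mono\<close>)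
  then show ?thesis using assms by (simp add: L2_funs_def)
qed

lemma (in prob_space) L2_integrable:
  assumes "f \<in> L2_funs M"
  shows "integrable M f" "(\<integral>x. cmod (f x) \<partial>M) \<le> L2_seminorm M f"
proof -
  have one: "(\<lambda>x. 1) \<in> L2_funs M" by (auto simp: L2_funs_def)
  show "integrable M f" using L2_inner_integrable[OF assms one] by simp
  show "(\<integral>x. cmod (f x) \<partial>M) \<le> L2_seminorm M f"
    using L2_Cauchy_Schwarz[OF assms one] prob_space by (simp add: L2_seminorm_def[of M "\<lambda>x. 1"])
qed

text \<open>Riesz-Fischer for a geometrically fast sequence. On a probability space the L1 norms of
  the increments are bounded by their L2 norms, so the increments are summable almost everywhere.
  Fatou's lemma turns the pointwise limit into an L2 limit with an explicit rate.\<close>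

lemma (in prob_space) L2_complete:
  assumes f: "\<And>n. f n \<in> L2_funs M"
    and d: "\<And>n. L2_seminorm M (\<lambda>x. f (Suc n) x - f n x) \<le> (1/2) ^ n"
  shows "\<exists>g \<in> L2_funs M. \<forall>n. L2_seminorm M (\<lambda>x. g x - f n x) \<le> 2 * (1/2) ^ n"
proof -
  note [measurable] = L2_funsD(1)[OF f]
  have df: "(\<lambda>x. f (Suc n) x - f n x) \<in> L2_funs M" for n using L2_diff f by blast
  have tel: "L2_seminorm M (\<lambda>x. f (n + k) x - f n x) \<le> 2 * (1/2) ^ n - 2 * (1/2) ^ (n + k)" for n k
  proof (induction k)
    case (Suc k)
    have "L2_seminorm M (\<lambda>x. f (n + Suc k) x - f n x) \<le> L2_seminorm M (\<lambda>x. f (Suc (n + k)) x - f (n + k) x) + L2_seminorm M (\<lambda>x. f (n + k) x - f n x)"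
      using L2_triangle_diff[OF f[of "Suc (n + k)"] f[of "n + k"] f[of n]] by simp
    also have "\<dots> \<le> (1/2) ^ (n + k) + (2 * (1/2) ^ n - 2 * (1/2) ^ (n + k))"
      using Suc d[of "n + k"] by linarith
    finally show ?case by simp
  qed (simp add: L2_seminorm_def)
  have "AE x in M. summable (\<lambda>n. cmod (f (Suc n) x - f n x))"
  proof -
    have "(\<integral>\<^sup>+x. (\<Sum>n. ennreal (cmod (f (Suc n) x - f n x))) \<partial>M) = (\<Sum>n. \<integral>\<^sup>+x. ennreal (cmod (f (Suc n) x - f n x)) \<partial>M)"
      by (intro nn_integral_suminf) measurable
    also have "\<dots> \<le> (\<Sum>n. ennreal ((1/2) ^ n))"
    proof (intro suminf_le summableI)
      fix n
      have "(\<integral>\<^sup>+x. ennreal (cmod (f (Suc n) x - f n x)) \<partial>M) = ennreal (\<integral>x. cmod (f (Suc n) x - f n x) \<partial>M)"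
        using L2_integrable(1)[OF df] by (intro nn_integral_eq_integral) auto
      also have "\<dots> \<le> ennreal ((1/2) ^ n)"
        using L2_integrable(2)[OF df[of n]] d[of n] by (intro ennreal_leI) linarith
      finally show "(\<integral>\<^sup>+x. ennreal (cmod (f (Suc n) x - f n x)) \<partial>M) \<le> ennreal ((1/2) ^ n)" .
    qed
    also have "\<dots> = ennreal (\<Sum>n. (1/2) ^ n)"
      by (intro suminf_ennreal2) (auto intro: summable_geometric)
    finally have "(\<integral>\<^sup>+x. (\<Sum>n. ennreal (cmod (f (Suc n) x - f n x))) \<partial>M) \<noteq> \<infinity>"
      by (auto simp: top_unique)
    then have "AE x in M. (\<Sum>n. ennreal (cmod (f (Suc n) x - f n x))) \<noteq> \<infinity>"
      by (intro nn_integral_noteq_infinite) measurable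
    then show ?thesis
      by eventually_elim (auto intro!: summable_suminf_not_top)
  qed
  then have conv: "AE x in M. convergent (\<lambda>n. f n x)"
  proof eventually_elim
    case (elim x)
    then have "summable (\<lambda>n. f (Suc n) x - f n x)" by (rule summable_norm_cancel)
    then obtain l where "(\<lambda>n. \<Sum>i<n. f (Suc i) x - f i x) \<longlonglongrightarrow> l"
      by (auto simp: summable_def sums_def)
    then have "(\<lambda>n. (\<Sum>i<n. f (Suc i) x - f i x) + f 0 x) \<longlonglongrightarrow> l + f 0 x"
      by (intro tendsto_intros)
    then show ?case using sum_lessThan_telescope[of "\<lambda>i. f i x"] by (auto simp: convergent_def)
  qed
  define g where "g x = lim (\<lambda>n. f n x)" for x
  have g[measurable]: "g \<in> borel_measurable M"
    unfolding g_def by (rule borel_measurable_lim_metric) simp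
  have bound: "(\<integral>\<^sup>+x. ennreal ((cmod (g x - f n x))\<^sup>2) \<partial>M) \<le> ennreal ((2 * (1/2) ^ n)\<^sup>2)" for n
  proof -
    have "(\<integral>\<^sup>+x. ennreal ((cmod (g x - f n x))\<^sup>2) \<partial>M) = (\<integral>\<^sup>+x. liminf (\<lambda>k. ennreal ((cmod (f (n + k) x - f n x))\<^sup>2)) \<partial>M)"
    proof (rule nn_integral_cong_AE)
      show "AE x in M. ennreal ((cmod (g x - f n x))\<^sup>2) = liminf (\<lambda>k. ennreal ((cmod (f (n + k) x - f n x))\<^sup>2))"
        using conv
      proof eventually_elim
        case (elim x)
        then have "(\<lambda>k. f k x) \<longlonglongrightarrow> g x" by (simp add: g_def convergent_LIMSEQ_iff)
        then have "(\<lambda>k. f (n + k) x) \<longlonglongrightarrow> g x"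
          using LIMSEQ_ignore_initial_segment[of "\<lambda>k. f k x" "g x" n] by (simp add: add.commute)
        then have "(\<lambda>k. ennreal ((cmod (f (n + k) x - f n x))\<^sup>2)) \<longlonglongrightarrow> ennreal ((cmod (g x - f n x))\<^sup>2)"
          by (intro tendsto_intros)
        from lim_imp_Liminf[OF sequentially_bot this] show ?case by (rule sym)
      qed
    qed
    also have "\<dots> \<le> liminf (\<lambda>k. \<integral>\<^sup>+x. ennreal ((cmod (f (n + k) x - f n x))\<^sup>2) \<partial>M)"
      by (rule nn_integral_liminf) measurable
    also have "\<dots> \<le> liminf (\<lambda>k::nat. ennreal ((2 * (1/2) ^ n)\<^sup>2))"
    proof (intro Liminf_mono always_eventually allI)
      fix k
      have "(\<integral>\<^sup>+x. ennreal ((cmod (f (n + k) x - f n x))\<^sup>2) \<partial>M) = ennreal ((L2_seminorm M (\<lambda>x. f (n + k) x - f n x))\<^sup>2)"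
        unfolding L2_seminorm_square using L2_funsD(2)[OF L2_diff[OF f f]] by (intro nn_integral_eq_integral) auto
      also have "\<dots> \<le> ennreal ((2 * (1/2) ^ n)\<^sup>2)"
      proof (intro ennreal_leI power_mono)
        have "(0::real) \<le> 2 * (1/2) ^ (n + k)" by simp
        then show "L2_seminorm M (\<lambda>x. f (n + k) x - f n x) \<le> 2 * (1/2) ^ n" using tel[of n k] by linarith
      qed simp
      finally show "(\<integral>\<^sup>+x. ennreal ((cmod (f (n + k) x - f n x))\<^sup>2) \<partial>M) \<le> ennreal ((2 * (1/2) ^ n)\<^sup>2)" .
    qed
    also have "\<dots> = ennreal ((2 * (1/2) ^ n)\<^sup>2)" by (simp add: Liminf_const)
    finally show ?thesis .
  qed
  have i: "integrable M (\<lambda>x. (cmod (g x - f n x))\<^sup>2)" for n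
    by (rule integrableI_bounded) (use bound[of n] in \<open>auto simp: less_top[symmetric] top_unique\<close>)
  have gd: "(\<lambda>x. g x - f n x) \<in> L2_funs M" for n using i by (simp add: L2_funs_def)
  have "g \<in> L2_funs M" using L2_add[OF gd[of 0] f[of 0]] by simp
  moreover have "L2_seminorm M (\<lambda>x. g x - f n x) \<le> 2 * (1/2) ^ n" for n
  proof -
    have "ennreal (\<integral>x. (cmod (g x - f n x))\<^sup>2 \<partial>M) \<le> ennreal ((2 * (1/2) ^ n)\<^sup>2)"
      using bound[of n] nn_integral_eq_integral[OF i[of n]] by simp
    then have "(L2_seminorm M (\<lambda>x. g x - f n x))\<^sup>2 \<le> (2 * (1/2) ^ n)\<^sup>2"
      unfolding L2_seminorm_square by (subst (asm) ennreal_le_iff) auto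
    then show ?thesis by (rule power2_le_imp_le) simp
  qed
  ultimately show ?thesis by blast
qed

section \<open>The Koopman operators of an automorphism\<close>

locale automorphism_space = prob_space +
  fixes S :: "'a \<Rightarrow> 'a"
  assumes automorphism: "automorphism M S"
begin

abbreviation Si :: "'a \<Rightarrow> 'a" where "Si \<equiv> inv_into (space M) S"
abbreviation pw :: "int \<Rightarrow> 'a \<Rightarrow> 'a" where "pw \<equiv> aut_power M S"
abbreviation U :: "int \<Rightarrow> ('a \<Rightarrow> complex) \<Rightarrow> 'a \<Rightarrow> complex" where "U k f \<equiv> koopman (pw k) f"
abbreviation N :: "('a \<Rightarrow> complex) \<Rightarrow> real" where "N \<equiv> L2_seminorm M"
abbreviation L2 :: "('a \<Rightarrow> complex) set" where "L2 \<equiv> L2_funs M"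

lemma S_bij: "bij_betw S (space M) (space M)"
  and S_measurable: "S \<in> measurable M M" and Si_measurable: "Si \<in> measurable M M"
  and distr_S: "distr M M S = M"
  using automorphism by (auto simp: automorphism_def)

lemma S_space: "x \<in> space M \<Longrightarrow> S x \<in> space M"
  using S_bij bij_betwE by blast

lemma Si_space: "x \<in> space M \<Longrightarrow> Si x \<in> space M"
  using S_bij by (metis bij_betw_imp_surj_on inv_into_into)

lemma S_Si: "x \<in> space M \<Longrightarrow> S (Si x) = x"
  using S_bij by (metis bij_betw_imp_surj_on f_inv_into_f)

lemma Si_S: "x \<in> space M \<Longrightarrow> Si (S x) = x"
  using S_bij by (metis bij_betw_imp_inj_on inv_into_f_f)

lemma distr_Si: "distr M M Si = M"
proof -
  have "M = distr M M (\<lambda>x. x)" by (simp add: distr_id2)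
  also have "\<dots> = distr M M (Si \<circ> S)"
    by (intro distr_cong) (auto simp: Si_S)
  also have "\<dots> = distr (distr M M S) M Si"
    by (rule distr_distr[symmetric, OF Si_measurable S_measurable])
  finally show ?thesis by (simp add: distr_S)
qed

lemma pw_space: "x \<in> space M \<Longrightarrow> pw k x \<in> space M"
proof -
  assume x: "x \<in> space M"
  have "(S ^^ n) x \<in> space M" "(Si ^^ n) x \<in> space M" for n
    by (induction n) (auto simp: x S_space Si_space)
  then show ?thesis by (auto simp: aut_power_def)
qed

lemma pw_0 [simp]: "pw 0 x = x" by (simp add: aut_power_def)

lemma pw_nat: "pw (int n) x = (S ^^ n) x" by (simp add: aut_power_def)

lemma pw_plus1:
  assumes x: "x \<in> space M"
  shows "pw (k + 1) x = S (pw k x)"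
proof (cases "k \<ge> 0")
  case True
  then show ?thesis by (simp add: aut_power_def nat_add_distrib)
next
  case False
  then have "nat (- k) \<noteq> 0" by simp
  then obtain n where n: "nat (- k) = Suc n" using not0_implies_Suc by blast
  then have k: "k = - int n - 1" by linarith
  have sp: "(Si ^^ n) x \<in> space M" by (induction n) (auto simp: x Si_space)
  have "pw k x = (Si ^^ nat (- k)) x" using False by (simp add: aut_power_def)
  then have "pw k x = Si ((Si ^^ n) x)" by (simp add: n)
  then have "S (pw k x) = (Si ^^ n) x" using S_Si[OF sp] by simp
  then show ?thesis using k by (cases "n = 0") (auto simp: aut_power_def)
qed

lemma pw_minus1:
  assumes x: "x \<in> space M"
  shows "pw (k - 1) x = Si (pw k x)"
  using pw_plus1[OF x, of "k - 1"] Si_S[OF pw_space[OF x]] by simp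

lemma pw_add:
  assumes x: "x \<in> space M"
  shows "pw (k + l) x = pw k (pw l x)"
proof (induction k rule: int_induct[where k=0])
  case (step1 i)
  then show ?case using pw_plus1[OF x, of "i + l"] pw_plus1[OF pw_space[OF x], of i l] by (simp add: ac_simps)
next
  case (step2 i)
  then show ?case using pw_minus1[OF x, of "i + l"] pw_minus1[OF pw_space[OF x], of i l] by (simp add: algebra_simps)
qed simp

lemma pw_measurable [measurable]: "pw k \<in> measurable M M"
  unfolding aut_power_def using S_measurable Si_measurable
  by (auto intro: measurable_compose_n)

lemma distr_pw: "distr M M (pw k) = M"
proof -
  have *: "distr M M (T ^^ n) = M" if T: "T \<in> measurable M M" "distr M M T = M" for T n
  proof (induction n)
    case (Suc n)
    have *: "distr M M (T ^^ Suc n) = distr (distr M M (T ^^ n)) M T"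
      by (subst distr_distr) (auto intro: measurable_compose_n T)
    show ?case unfolding * using Suc T by simp
  qed (simp add: distr_id[unfolded id_def] id_def)
  show ?thesis
    unfolding aut_power_def using *[OF S_measurable distr_S] *[OF Si_measurable distr_Si] by auto
qed

lemma U_apply [simp]: "U k f x = f (pw k x)" by (simp add: koopman_def)

lemma U_L2:
  assumes f: "f \<in> L2"
  shows "U k f \<in> L2"
proof -
  have i: "integrable (distr M M (pw k)) (\<lambda>x. (cmod (f x))\<^sup>2)"
    using L2_funsD(2)[OF f] by (simp add: distr_pw)
  have "integrable M (\<lambda>x. (cmod (f (pw k x)))\<^sup>2)"
    by (rule integrable_distr[OF pw_measurable i])
  moreover have "U k f \<in> borel_measurable M"
    unfolding koopman_def comp_def using L2_funsD(1)[OF f] by measurable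
  ultimately show ?thesis by (simp add: L2_funs_def)
qed

lemma integral_pw:
  fixes f :: "'a \<Rightarrow> 'b::{banach, second_countable_topology}"
  assumes "f \<in> borel_measurable M"
  shows "(\<integral>x. f (pw k x) \<partial>M) = (\<integral>x. f x \<partial>M)"
  using integral_distr[OF pw_measurable assms, of k] by (simp add: distr_pw)

lemma N_U:
  assumes f: "f \<in> L2"
  shows "N (U k f) = N f"
  unfolding L2_seminorm_def using integral_pw[of "\<lambda>x. (cmod (f x))\<^sup>2" k] L2_funsD(1)[OF f] by simp

text \<open>Unitarity: inner products of translates depend on the difference of the exponents only,
  so the Gram matrix of an orbit is a Toeplitz matrix.\<close>

lemma inner_U:
  assumes f: "f \<in> L2"
  shows "L2_inner M (U k f) (U l f) = L2_inner M (U (k - l) f) f"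
proof -
  have "(\<lambda>x. U (k - l) f x * cnj (f x)) \<in> borel_measurable M"
    by (rule borel_measurable_integrable[OF L2_inner_integrable[OF U_L2[OF f] f]])
  from integral_pw[OF this, of l]
  have "(\<integral>x. f (pw (k - l) (pw l x)) * cnj (f (pw l x)) \<partial>M) = L2_inner M (U (k - l) f) f"
    by (simp add: L2_inner_def)
  also have "(\<integral>x. f (pw (k - l) (pw l x)) * cnj (f (pw l x)) \<partial>M) = L2_inner M (U k f) (U l f)"
    unfolding L2_inner_def by (intro Bochner_Integration.integral_cong) (auto simp: pw_add[symmetric])
  finally show ?thesis by (simp add: koopman_def comp_def)
qed

section \<open>Cyclic subspaces and polynomials in the unitary operator\<close>

definition comb :: "int set \<Rightarrow> (int \<Rightarrow> complex) \<Rightarrow> ('a \<Rightarrow> complex) \<Rightarrow> 'a \<Rightarrow> complex" where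
  "comb F c f x = (\<Sum>k\<in>F. c k * U k f x)"

lemma comb_L2: "f \<in> L2 \<Longrightarrow> comb F c f \<in> L2"
  unfolding comb_def by (intro L2_sum L2_cmult U_L2)

lemma N_comb_le: "f \<in> L2 \<Longrightarrow> N (comb F c f) \<le> (\<Sum>k\<in>F. cmod (c k)) * N f"
  using L2_sum(2)[of F "\<lambda>k x. c k * U k f x" M] L2_cmult[OF U_L2]
  by (simp add: comb_def[abs_def] L2_seminorm_cmult N_U sum_distrib_right del: U_apply)

text \<open>The closed linear span of the two-sided orbit of \<open>f\<close>, as a set of functions
  instead of classes. Membership is tested by the seminorm, so a square-integrable function equal to
  a member almost everywhere is a member too.\<close>

definition cyclic_space :: "('a \<Rightarrow> complex) \<Rightarrow> ('a \<Rightarrow> complex) set" where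
  "cyclic_space f = {g \<in> L2. \<forall>\<epsilon>>0. \<exists>F c. finite F \<and> N (\<lambda>x. g x - comb F c f x) < \<epsilon>}"

lemma cyclic_vector_iff: "cyclic_vector M S f \<longleftrightarrow> f \<in> L2 \<and> L2 \<subseteq> cyclic_space f"
  by (auto simp: cyclic_vector_def cyclic_space_def comb_def)

lemma cyclic_space_L2: "g \<in> cyclic_space f \<Longrightarrow> g \<in> L2"
  by (simp add: cyclic_space_def)

lemma cyclic_spaceD:
  assumes "g \<in> cyclic_space f" "\<epsilon> > 0"
  obtains F c where "finite F" "N (\<lambda>x. g x - comb F c f x) < \<epsilon>"
  using assms by (auto simp: cyclic_space_def)

lemma comb_in_cyclic_space:
  assumes "f \<in> L2" "finite F"
  shows "comb F c f \<in> cyclic_space f"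
  unfolding cyclic_space_def using comb_L2[OF assms(1)] assms(2)
  by (auto intro!: exI[of _ F] exI[of _ c] simp: L2_seminorm_def)

lemma self_in_cyclic_space: "f \<in> L2 \<Longrightarrow> f \<in> cyclic_space f"
  using comb_in_cyclic_space[of f "{0}" "\<lambda>_. 1"] by (simp add: comb_def[abs_def])

lemma cyclic_space_cmult:
  assumes f: "f \<in> L2" and g: "g \<in> cyclic_space f"
  shows "(\<lambda>x. a * g x) \<in> cyclic_space f"
  unfolding cyclic_space_def
proof (safe)
  show "(\<lambda>x. a * g x) \<in> L2" using L2_cmult cyclic_space_L2[OF g] by blast
  fix e :: real assume e: "e > 0"
  obtain F c where F: "finite F" "N (\<lambda>x. g x - comb F c f x) < e / (cmod a + 1)"
    using cyclic_spaceD[OF g, of "e / (cmod a + 1)"] e by (auto simp: add_nonneg_pos)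
  have "N (\<lambda>x. a * g x - comb F (\<lambda>k. a * c k) f x) = N (\<lambda>x. a * (g x - comb F c f x))"
    by (intro arg_cong[where f=N] ext) (simp add: comb_def sum_distrib_left algebra_simps)
  also have "\<dots> \<le> (cmod a + 1) * N (\<lambda>x. g x - comb F c f x)"
    unfolding L2_seminorm_cmult by (intro mult_right_mono) auto
  also have "\<dots> < e" using F(2) by (simp add: pos_less_divide_eq add_nonneg_pos mult.commute)
  finally show "\<exists>F c. finite F \<and> N (\<lambda>x. a * g x - comb F c f x) < e" using F(1) by blast
qed

lemma cyclic_space_add:
  assumes f: "f \<in> L2" and g: "g \<in> cyclic_space f" "h \<in> cyclic_space f"
  shows "(\<lambda>x. g x + h x) \<in> cyclic_space f"
  unfolding cyclic_space_def
proof (safe)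
  show "(\<lambda>x. g x + h x) \<in> L2" using L2_add cyclic_space_L2 g by blast
  fix e :: real assume e: "e > 0"
  obtain F c where F: "finite F" "N (\<lambda>x. g x - comb F c f x) < e / 2"
    using cyclic_spaceD[OF g(1), of "e/2"] e by auto
  obtain F' c' where F': "finite F'" "N (\<lambda>x. h x - comb F' c' f x) < e / 2"
    using cyclic_spaceD[OF g(2), of "e/2"] e by auto
  define c2 where "c2 k = (if k \<in> F then c k else 0) + (if k \<in> F' then c' k else 0)" for k
  have c2: "comb (F \<union> F') c2 f x = comb F c f x + comb F' c' f x" for x
  proof -
    have "(\<Sum>k\<in>F \<union> F'. c2 k * U k f x) = (\<Sum>k\<in>F \<union> F'. if k \<in> F then c k * U k f x else 0) + (\<Sum>k\<in>F \<union> F'. if k \<in> F' then c' k * U k f x else 0)"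
      unfolding sum.distrib[symmetric] by (intro sum.cong) (auto simp: c2_def algebra_simps)
    also have "(\<Sum>k\<in>F \<union> F'. if k \<in> F then c k * U k f x else 0) = (\<Sum>k\<in>F. c k * U k f x)"
      using F F' by (intro sum.mono_neutral_cong_right) auto
    also have "(\<Sum>k\<in>F \<union> F'. if k \<in> F' then c' k * U k f x else 0) = (\<Sum>k\<in>F'. c' k * U k f x)"
      using F F' by (intro sum.mono_neutral_cong_right) auto
    finally show ?thesis unfolding comb_def .
  qed
  have "N (\<lambda>x. (g x + h x) - comb (F \<union> F') c2 f x) = N (\<lambda>x. (g x - comb F c f x) + (h x - comb F' c' f x))"
    by (simp add: c2 algebra_simps)
  also have "\<dots> \<le> N (\<lambda>x. g x - comb F c f x) + N (\<lambda>x. h x - comb F' c' f x)"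
    by (intro L2_triangle L2_diff comb_L2 f cyclic_space_L2[OF g(1)] cyclic_space_L2[OF g(2)])
  finally have "N (\<lambda>x. g x + h x - comb (F \<union> F') c2 f x) < e" using F(2) F'(2) by linarith
  then show "\<exists>F c. finite F \<and> N (\<lambda>x. g x + h x - comb F c f x) < e" using F(1) F'(1) by blast
qed

lemma U_comb:
  assumes x: "x \<in> space M"
  shows "U l (comb F c f) x = comb ((+) l ` F) (\<lambda>k. c (k - l)) f x"
  unfolding comb_def by (simp add: sum.reindex comp_def pw_add[OF x, symmetric] add.commute)

lemma cyclic_space_U:
  assumes f: "f \<in> L2" and g: "g \<in> cyclic_space f"
  shows "U l g \<in> cyclic_space f"
  unfolding cyclic_space_def
proof (safe)
  show "U l g \<in> L2" using U_L2 cyclic_space_L2[OF g] by blast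
  fix e :: real assume e: "e > 0"
  obtain F c where F: "finite F" "N (\<lambda>x. g x - comb F c f x) < e"
    using cyclic_spaceD[OF g e] by auto
  have "N (\<lambda>x. U l g x - comb ((+) l ` F) (\<lambda>k. c (k - l)) f x) = N (U l (\<lambda>x. g x - comb F c f x))"
  proof (rule L2_seminorm_cong)
    fix x assume "x \<in> space M"
    from U_comb[OF this, of l F c f]
    show "U l g x - comb ((+) l ` F) (\<lambda>k. c (k - l)) f x = U l (\<lambda>x. g x - comb F c f x) x" by simp
  qed
  also have "\<dots> = N (\<lambda>x. g x - comb F c f x)"
    by (intro N_U L2_diff comb_L2 f cyclic_space_L2[OF g])
  finally have "N (\<lambda>x. U l g x - comb ((+) l ` F) (\<lambda>k. c (k - l)) f x) < e" using F(2) by linarith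
  then show "\<exists>F c. finite F \<and> N (\<lambda>x. U l g x - comb F c f x) < e"
    using F(1) by (intro exI[of _ "(+) l ` F"] exI[of _ "\<lambda>k. c (k - l)"]) auto
qed

lemma cyclic_space_closed:
  assumes f: "f \<in> L2" and g: "g \<in> L2"
    and a: "\<And>e. e > 0 \<Longrightarrow> \<exists>h\<in>cyclic_space f. N (\<lambda>x. g x - h x) < e"
  shows "g \<in> cyclic_space f"
  unfolding cyclic_space_def
proof (safe)
  fix e :: real assume e: "e > 0"
  obtain h where h: "h \<in> cyclic_space f" "N (\<lambda>x. g x - h x) < e / 2" using a[of "e/2"] e by auto
  obtain F c where F: "finite F" "N (\<lambda>x. h x - comb F c f x) < e / 2"
    using cyclic_spaceD[OF h(1), of "e/2"] e by auto
  have "N (\<lambda>x. g x - comb F c f x) < e"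
    using L2_triangle_diff[OF g cyclic_space_L2[OF h(1)] comb_L2[OF f, of F c]] h F by simp
  then show "\<exists>F c. finite F \<and> N (\<lambda>x. g x - comb F c f x) < e" using F(1) by blast
qed (fact g)

lemma cyclic_space_sum:
  assumes f: "f \<in> L2" and g: "\<And>i. i \<in> I \<Longrightarrow> g i \<in> cyclic_space f"
  shows "(\<lambda>x. \<Sum>i\<in>I. g i x) \<in> cyclic_space f"
  using g
proof (induction I rule: infinite_finite_induct)
  case (insert a I)
  then show ?case using cyclic_space_add[OF f, of "g a" "\<lambda>x. \<Sum>i\<in>I. g i x"] by simp
qed (use comb_in_cyclic_space[OF f, of "{}"] in \<open>simp_all add: comb_def[abs_def]\<close>)

lemma cyclic_space_comb:
  assumes "f \<in> L2" "g \<in> cyclic_space f"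
  shows "comb F c g \<in> cyclic_space f"
  unfolding comb_def[abs_def] by (intro cyclic_space_sum cyclic_space_cmult cyclic_space_U assms)

text \<open>Combinations of translates of \<open>f\<close> already lie in the closed invariant space
  generated by \<open>e\<close>, and they approximate \<open>g\<close>. Membership can thus be
  passed along a chain of vectors.\<close>

lemma cyclic_space_trans:
  assumes e: "e \<in> L2" and g: "g \<in> cyclic_space f" and f: "f \<in> cyclic_space e"
  shows "g \<in> cyclic_space e"
proof (rule cyclic_space_closed[OF e cyclic_space_L2[OF g]])
  fix r :: real assume "r > 0"
  then show "\<exists>h\<in>cyclic_space e. N (\<lambda>x. g x - h x) < r"
    using cyclic_space_comb[OF e f] cyclic_spaceD[OF g, of r] by metis
qed

text \<open>Outside the unit circle the resolvent of the unitary operator is a Neumann series; here the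
  series is replaced by iterated improvement of an approximation of \<open>b\<close>.\<close>

lemma in_cyclic_space_resolvent:
  assumes b: "b \<in> L2" and z: "cmod z \<noteq> 1"
  shows "b \<in> cyclic_space (\<lambda>x. U 1 b x - z * b x)"
proof -
  define e where "e = (\<lambda>x. U 1 b x - z * b x)"
  have e: "e \<in> L2" unfolding e_def by (intro L2_diff L2_cmult U_L2 b)
  obtain r where r: "0 \<le> r" "r < 1" and step: "\<And>a. a \<in> cyclic_space e \<Longrightarrow>
      \<exists>a'\<in>cyclic_space e. N (\<lambda>x. b x - a' x) = r * N (\<lambda>x. b x - a x)"
  proof (cases "cmod z < 1")
    case True
    \<comment> \<open>From e = U b - z b follows b = U^-1 e + z U^-1 b. Putting the current
      approximation for \<open>b\<close> on the right multiplies the error by |z|.\<close>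
    have "\<exists>a'\<in>cyclic_space e. N (\<lambda>x. b x - a' x) = cmod z * N (\<lambda>x. b x - a x)" if a: "a \<in> cyclic_space e" for a
    proof (intro bexI)
      show "(\<lambda>x. U (-1) e x + z * U (-1) a x) \<in> cyclic_space e"
        by (intro cyclic_space_add cyclic_space_cmult cyclic_space_U self_in_cyclic_space e a)
      have "N (\<lambda>x. b x - (U (-1) e x + z * U (-1) a x)) = N (\<lambda>x. z * U (-1) (\<lambda>x. b x - a x) x)"
      proof (rule L2_seminorm_cong)
        fix x assume x: "x \<in> space M"
        show "b x - (U (-1) e x + z * U (-1) a x) = z * U (-1) (\<lambda>x. b x - a x) x"
          using pw_add[OF x, of 1 "-1"] by (simp add: e_def algebra_simps)
      qed
      also have "\<dots> = cmod z * N (\<lambda>x. b x - a x)"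
        unfolding L2_seminorm_cmult by (subst N_U) (auto intro: L2_diff b cyclic_space_L2[OF a])
      finally show "N (\<lambda>x. b x - (U (-1) e x + z * U (-1) a x)) = cmod z * N (\<lambda>x. b x - a x)" .
    qed
    with True show ?thesis by (intro that[of "cmod z"]) auto
  next
    case False
    then have z1: "cmod z > 1" using z by simp
    then have z0: "z \<noteq> 0" by auto
    \<comment> \<open>For |z| > 1 the same equation is solved for the other occurrence of
      \<open>b\<close>, namely b = z^-1 (U b - e), and the error is divided by |z|.\<close>
    have "\<exists>a'\<in>cyclic_space e. N (\<lambda>x. b x - a' x) = inverse (cmod z) * N (\<lambda>x. b x - a x)" if a: "a \<in> cyclic_space e" for a
    proof (intro bexI)
      show "(\<lambda>x. inverse z * U 1 a x + (- inverse z) * e x) \<in> cyclic_space e"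
        by (intro cyclic_space_add cyclic_space_cmult cyclic_space_U self_in_cyclic_space e a)
      have "N (\<lambda>x. b x - (inverse z * U 1 a x + (- inverse z) * e x)) = N (\<lambda>x. inverse z * U 1 (\<lambda>x. b x - a x) x)"
        using z0 by (intro L2_seminorm_cong) (simp add: e_def field_simps)
      also have "\<dots> = inverse (cmod z) * N (\<lambda>x. b x - a x)"
        unfolding L2_seminorm_cmult by (subst N_U) (auto intro: L2_diff b cyclic_space_L2[OF a] simp: norm_inverse)
      finally show "N (\<lambda>x. b x - (inverse z * U 1 a x + (- inverse z) * e x)) = inverse (cmod z) * N (\<lambda>x. b x - a x)" .
    qed
    with z1 show ?thesis by (intro that[of "inverse (cmod z)"]) (auto simp: inverse_less_1_iff)
  qed
  have iter: "\<exists>a\<in>cyclic_space e. N (\<lambda>x. b x - a x) = r ^ n * N b" for n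
  proof (induction n)
    case 0
    show ?case using comb_in_cyclic_space[OF e, of "{}"] by (intro bexI[of _ "\<lambda>x. 0"]) (auto simp: comb_def[abs_def])
  next
    case (Suc n)
    then show ?case using step by (metis mult.assoc power_Suc)
  qed
  have "(\<lambda>n. r ^ n * N b) \<longlonglongrightarrow> 0 * N b"
    using r by (intro tendsto_intros LIMSEQ_realpow_zero) auto
  then have lim: "(\<lambda>n. r ^ n * N b) \<longlonglongrightarrow> 0" by simp
  show ?thesis unfolding e_def[symmetric]
  proof (rule cyclic_space_closed[OF e b])
    fix d :: real assume "d > 0"
    then obtain n where "r ^ n * N b < d"
      using order_tendstoD(2)[OF lim, of d] by (auto simp: eventually_sequentially)
    with iter[of n] show "\<exists>h\<in>cyclic_space e. N (\<lambda>x. b x - h x) < d" by metis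
  qed
qed

text \<open>Only non-negative powers occur, so that the factorisation of complex polynomials into
  linear factors is available.\<close>

definition poly_op :: "complex poly \<Rightarrow> ('a \<Rightarrow> complex) \<Rightarrow> 'a \<Rightarrow> complex" where
  "poly_op P b x = (\<Sum>k\<le>degree P. coeff P k * U (int k) b x)"

lemma poly_op_eq_comb: "poly_op P b = comb (int ` {..degree P}) (\<lambda>k. coeff P (nat k)) b"
  by (auto simp: poly_op_def comb_def sum.reindex fun_eq_iff)

lemma poly_op_L2: "b \<in> L2 \<Longrightarrow> poly_op P b \<in> L2"
  by (simp add: poly_op_eq_comb comb_L2)

lemma poly_op_linear_factor:
  assumes x: "x \<in> space M" and Q: "Q \<noteq> 0"
  shows "poly_op ([:- z, 1:] * Q) b x = U 1 (poly_op Q b) x - z * poly_op Q b x"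
proof -
  define n where "n = degree Q"
  have deg: "degree ([:- z, 1:] * Q) = Suc n"
    using Q by (subst degree_mult_eq) (auto simp: n_def)
  have co: "coeff ([:- z, 1:] * Q) k = - z * coeff Q k + coeff (pCons 0 Q) k" for k
    by (simp add: mult_pCons_left)
  have "poly_op ([:- z, 1:] * Q) b x = - z * (\<Sum>k\<le>Suc n. coeff Q k * U (int k) b x) + (\<Sum>k\<le>Suc n. coeff (pCons 0 Q) k * U (int k) b x)"
    unfolding poly_op_def deg co by (simp add: sum.distrib sum_distrib_left sum_negf sum_subtractf algebra_simps)
  also have "(\<Sum>k\<le>Suc n. coeff Q k * U (int k) b x) = poly_op Q b x"
    by (simp add: poly_op_def n_def coeff_eq_0)
  also have "(\<Sum>k\<le>Suc n. coeff (pCons 0 Q) k * U (int k) b x) = U 1 (poly_op Q b) x"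
    unfolding sum.atMost_Suc_shift using pw_add[OF x, of "int k" 1 for k]
    by (simp add: poly_op_def n_def add.commute)
  finally show ?thesis by simp
qed

text \<open>Each root z is peeled off as a factor U - z, which can be undone within the cyclic space
  because z is not on the unit circle. By transitivity \<open>b\<close> is recovered from P(U) b
  factor by factor.\<close>

lemma in_cyclic_space_poly_op:
  assumes "b \<in> L2" "P \<noteq> 0" "\<And>z. poly P z = 0 \<Longrightarrow> cmod z \<noteq> 1"
  shows "b \<in> cyclic_space (poly_op P b)"
  using assms(2,3)
proof (induction "degree P" arbitrary: P)
  case 0
  then obtain c where P: "P = [:c:]" by (metis degree_eq_zeroE)
  with 0 have c: "c \<noteq> 0" by auto
  have e: "poly_op P b = (\<lambda>x. c * b x)" by (auto simp: P poly_op_def)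
  have "(\<lambda>x. c * b x) \<in> L2" by (intro L2_cmult assms)
  from cyclic_space_cmult[OF this self_in_cyclic_space[OF this], of "inverse c"]
  show ?case unfolding e using c by (simp add: mult.assoc[symmetric])
next
  case (Suc n)
  obtain z where z: "poly P z = 0"
    using Suc by (metis constant_degree fundamental_theorem_of_algebra nat.distinct(1))
  then obtain Q where P: "P = [:- z, 1:] * Q" by (metis dvdE poly_eq_0_iff_dvd)
  have Q: "Q \<noteq> 0" using Suc P by auto
  have "degree P = Suc (degree Q)" unfolding P using Q by (subst degree_mult_eq) auto
  then have "b \<in> cyclic_space (poly_op Q b)"
    using Suc(2,4) Q by (intro Suc(1)) (auto simp: P)
  moreover have "poly_op Q b \<in> cyclic_space (poly_op P b)"
  proof -
    have q: "poly_op Q b \<in> L2" using poly_op_L2 assms by blast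
    have zz: "cmod z \<noteq> 1" using Suc(4) z by blast
    define e where "e = (\<lambda>x. U 1 (poly_op Q b) x - z * poly_op Q b x)"
    have e: "poly_op Q b \<in> cyclic_space e" unfolding e_def by (rule in_cyclic_space_resolvent[OF q zz])
    have eL: "e \<in> L2" unfolding e_def by (intro L2_diff L2_cmult U_L2 q)
    have "e \<in> cyclic_space (poly_op P b)"
    proof (rule cyclic_space_closed[OF poly_op_L2[OF assms(1)] eL])
      fix r :: real assume r: "r > 0"
      have "N (\<lambda>x. e x - poly_op P b x) = N (\<lambda>x. 0)"
        by (intro L2_seminorm_cong) (use poly_op_linear_factor[OF _ Q, of _ z b] in \<open>simp add: e_def P del: U_apply\<close>)
      then show "\<exists>h\<in>cyclic_space (poly_op P b). N (\<lambda>x. e x - h x) < r"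
        using r by (intro bexI[OF _ self_in_cyclic_space[OF poly_op_L2[OF assms(1)]]]) (simp add: L2_seminorm_def)
    qed
    then show ?thesis using cyclic_space_trans[OF poly_op_L2[OF assms(1)] e] by blast
  qed
  ultimately show ?case using cyclic_space_trans[OF poly_op_L2[OF assms(1)]] by blast
qed

text \<open>Replacing P(z) by P(r z) with r slightly above 1 divides every root by r. Only finitely
  many r bring a root to the unit circle, and the coefficients change little.\<close>

lemma poly_op_perturb:
  assumes b: "b \<in> L2" and P: "P \<noteq> 0" and d: "d > 0"
  shows "\<exists>Q. Q \<noteq> 0 \<and> (\<forall>z. poly Q z = 0 \<longrightarrow> cmod z \<noteq> 1) \<and> N (\<lambda>x. poly_op Q b x - poly_op P b x) < d"
proof -
  define W where "W = (\<lambda>r::real. (\<Sum>k\<le>degree P. cmod (complex_of_real r ^ k - 1) * cmod (coeff P k)) * N b)"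
  have "(W \<longlongrightarrow> (\<Sum>k\<le>degree P. cmod (complex_of_real 1 ^ k - 1) * cmod (coeff P k)) * N b) (at_right 1)"
    unfolding W_def by (intro tendsto_intros)
  then have "(W \<longlongrightarrow> 0) (at_right 1)" by simp
  then have "\<forall>\<^sub>F r in at_right 1. W r < d" using d by (rule order_tendstoD)
  \<comment> \<open>Roots of modulus exactly 1 are harmless because r > 1; all other moduli keep a
    positive distance from 1.\<close>
  moreover have "\<forall>\<^sub>F r in at_right 1. r \<notin> cmod ` {z. poly P z = 0}"
  proof -
    have "finite (cmod ` {z. poly P z = 0} - {1})" using poly_roots_finite[OF P] by auto
    then have "open (- (cmod ` {z. poly P z = 0} - {1}))" by (intro open_Compl finite_imp_closed)
    then have "\<forall>\<^sub>F r in nhds 1. r \<in> - (cmod ` {z. poly P z = 0} - {1})"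
      by (intro eventually_nhds_in_open) auto
    then show ?thesis unfolding eventually_at_filter by eventually_elim auto
  qed
  moreover have "\<forall>\<^sub>F r in at_right (1::real). r > 1" by (simp add: eventually_at_filter)
  ultimately have "\<forall>\<^sub>F r in at_right 1. W r < d \<and> r \<notin> cmod ` {z. poly P z = 0} \<and> r > 1"
    by eventually_elim auto
  then obtain r where r: "W r < d" "r \<notin> cmod ` {z. poly P z = 0}" "r > 1"
    using eventually_happens'[OF trivial_limit_at_right_real] by blast
  define Q where "Q = pcompose P [:0, complex_of_real r:]"
  have deg: "degree Q = degree P" using r by (simp add: Q_def degree_pcompose)
  have Q0: "Q \<noteq> 0" using P r by (simp add: Q_def pcompose_eq_0_iff)
  have roots: "cmod z \<noteq> 1" if "poly Q z = 0" for z
  proof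
    assume "cmod z = 1"
    then have "cmod (of_real r * z) = r" using r by (simp add: norm_mult)
    moreover have "poly P (of_real r * z) = 0" using that by (simp add: Q_def poly_pcompose mult.commute)
    ultimately show False using r(2) by force
  qed
  have co: "coeff Q k = of_real r ^ k * coeff P k" for k
    by (simp add: Q_def coeff_pcompose_linear)
  have "(\<lambda>x. poly_op Q b x - poly_op P b x) = comb (int ` {..degree P}) (\<lambda>k. (of_real r ^ nat k - 1) * coeff P (nat k)) b"
    by (auto simp: fun_eq_iff poly_op_def comb_def sum.reindex deg co sum_subtractf[symmetric] algebra_simps)
  then have "N (\<lambda>x. poly_op Q b x - poly_op P b x) \<le> W r"
    using N_comb_le[OF b, of "int ` {..degree P}" "\<lambda>k. (of_real r ^ nat k - 1) * coeff P (nat k)"]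
    by (simp add: W_def sum.reindex norm_mult)
  then show ?thesis using r(1) Q0 roots by (intro exI[of _ Q]) auto
qed

text \<open>The vectors that are nearly cyclic for finitely many targets contain a dense open set: a dense
  supply is given by the \<open>poly_op Q (b j)\<close> with \<open>Q\<close> free of zeros on the unit circle.\<close>

lemma nearly_cyclic_perturbation:
  fixes b g :: "nat \<Rightarrow> 'a \<Rightarrow> complex" and n :: nat
  assumes b: "\<And>j. b j \<in> L2" and g: "\<And>i. g i \<in> L2"
    and approx: "\<And>h e. h \<in> L2 \<Longrightarrow> e > 0 \<Longrightarrow> \<exists>J. \<forall>j\<ge>J. \<exists>P. N (\<lambda>x. h x - poly_op P (b j) x) < e"
    and f: "f \<in> L2" and d: "d > 0" and eta: "eta > 0"
  shows "\<exists>f'\<in>L2. N (\<lambda>x. f' x - f x) < d \<and> (\<exists>d'>0. \<forall>f''\<in>L2. N (\<lambda>x. f'' x - f' x) \<le> d' \<longrightarrow>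
           (\<forall>i\<le>n. \<exists>F c. finite F \<and> N (\<lambda>x. g i x - comb F c f'' x) < eta))"
proof -
  have "\<exists>J. \<forall>i. \<forall>j\<ge>J i. \<exists>P. N (\<lambda>x. g i x - poly_op P (b j) x) < eta / 2"
    using approx[OF g, of "eta / 2"] eta by (intro choice) auto
  then obtain J where J: "\<And>i j. j \<ge> J i \<Longrightarrow> \<exists>P. N (\<lambda>x. g i x - poly_op P (b j) x) < eta / 2" by blast
  obtain J0 where J0: "\<And>j. j \<ge> J0 \<Longrightarrow> \<exists>P. N (\<lambda>x. f x - poly_op P (b j) x) < d / 3"
    using approx[OF f, of "d/3"] d by auto
  \<comment> \<open>One index beyond the thresholds of \<open>f\<close> and of all targets, so that
    the single vector \<open>b j\<close> serves every one of them.\<close>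
  define j where "j = Max (insert J0 (J ` {..n}))"
  have j: "j \<ge> J0" "\<And>i. i \<le> n \<Longrightarrow> j \<ge> J i" unfolding j_def by (rule Max_ge; simp)+
  obtain P0 where P0: "N (\<lambda>x. f x - poly_op P0 (b j) x) < d / 3" using J0 j by blast
  \<comment> \<open>The zero polynomial cannot be perturbed into one without roots on the circle. It
    is replaced by a constant so small that its multiple of \<open>b j\<close> has norm at most
    d/3.\<close>
  obtain P where P: "P \<noteq> 0" "N (\<lambda>x. f x - poly_op P (b j) x) < 2 * d / 3"
  proof (cases "P0 = 0")
    case True
    define c where "c = complex_of_real (d / (3 * (N (b j) + 1)))"
    have c: "c \<noteq> 0" "cmod c * N (b j) \<le> d / 3"
    proof -
      have pos: "N (b j) + 1 > 0" by (simp add: add_nonneg_pos)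
      show "c \<noteq> 0" using d pos by (simp add: c_def del: of_real_divide)
      have "cmod c * N (b j) = (d / 3) * (N (b j) / (N (b j) + 1))"
        using d pos by (simp add: c_def del: of_real_divide)
      also have "\<dots> \<le> (d / 3) * 1" using d pos by (intro mult_left_mono) auto
      finally show "cmod c * N (b j) \<le> d / 3" by simp
    qed
    have cb: "(\<lambda>x. - c * b j x) \<in> L2" by (intro L2_cmult b)
    have "N (\<lambda>x. f x - poly_op [:c:] (b j) x) = N (\<lambda>x. f x + (- c * b j x))"
      by (simp add: poly_op_def)
    also have "\<dots> \<le> N f + cmod c * N (b j)"
      using L2_triangle[OF f cb] L2_seminorm_cmult[of M "- c" "b j"] by simp
    also have "N f < d / 3" using P0 True by (simp add: poly_op_def)
    finally have "N (\<lambda>x. f x - poly_op [:c:] (b j) x) < 2 * d / 3" using c by simp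
    then show ?thesis using c by (intro that[of "[:c:]"]) auto
  next
    case False
    then show ?thesis using P0 d by (intro that[of P0]) auto
  qed
  have "d / 3 > 0" using d by simp
  from poly_op_perturb[OF b P(1) this, of j] obtain Q where Q: "Q \<noteq> 0" "\<And>z. poly Q z = 0 \<Longrightarrow> cmod z \<noteq> 1"
    "N (\<lambda>x. poly_op Q (b j) x - poly_op P (b j) x) < d / 3" by blast
  define f' where "f' = poly_op Q (b j)"
  have f': "f' \<in> L2" by (simp add: f'_def poly_op_L2 b)
  have bj: "b j \<in> cyclic_space f'" unfolding f'_def using in_cyclic_space_poly_op[OF b Q(1,2)] by blast
  have near: "N (\<lambda>x. f' x - f x) < d"
    using L2_triangle_diff[OF f' poly_op_L2[OF b, of P j] f] P(2) Q(3)
    unfolding f'_def by (simp add: L2_seminorm_minus_commute[of M f])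
  have "\<exists>d'>0. \<forall>f''\<in>L2. N (\<lambda>x. f'' x - f' x) \<le> d' \<longrightarrow> (\<exists>F c. finite F \<and> N (\<lambda>x. g i x - comb F c f'' x) < eta)" if i: "i \<le> n" for i
  proof -
    obtain Pi where Pi: "N (\<lambda>x. g i x - poly_op Pi (b j) x) < eta / 2" using J j(2)[OF i] by blast
    have "poly_op Pi (b j) \<in> cyclic_space f'" unfolding poly_op_eq_comb by (intro cyclic_space_comb f' bj)
    then obtain F c where F: "finite F" "N (\<lambda>x. poly_op Pi (b j) x - comb F c f' x) < eta / 4"
      using cyclic_spaceD[of _ f' "eta/4"] eta by auto
    define s where "s = (\<Sum>k\<in>F. cmod (c k))"
    have s: "s \<ge> 0" by (simp add: s_def sum_nonneg)
    \<comment> \<open>The combination with coefficients \<open>c\<close> enlarges norms by a factor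
      of at most \<open>s\<close>, so moving its argument by \<open>d'\<close> costs at most
      eta/4.\<close>
    define d' where "d' = eta / (4 * (s + 1))"
    have d': "d' > 0" "s * d' \<le> eta / 4"
    proof -
      show "d' > 0" using eta s by (simp add: d'_def)
      have "s * d' = (eta / 4) * (s / (s + 1))" by (simp add: d'_def)
      also have "\<dots> \<le> (eta / 4) * 1" using eta s by (intro mult_left_mono) auto
      finally show "s * d' \<le> eta / 4" by simp
    qed
    have "\<exists>F c. finite F \<and> N (\<lambda>x. g i x - comb F c f'' x) < eta"
      if f'': "f'' \<in> L2" "N (\<lambda>x. f'' x - f' x) \<le> d'" for f''
    proof (intro exI conjI)
      have "(\<lambda>x. comb F c f' x - comb F c f'' x) = comb F c (\<lambda>x. f' x - f'' x)"
        by (simp add: fun_eq_iff comb_def sum_subtractf[symmetric] algebra_simps)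
      then have "N (\<lambda>x. comb F c f' x - comb F c f'' x) \<le> s * N (\<lambda>x. f' x - f'' x)"
        using N_comb_le[OF L2_diff[OF f' f''(1)], of F c] by (simp add: s_def)
      also have "\<dots> \<le> s * d'" using f''(2) s by (intro mult_left_mono) (auto simp: L2_seminorm_minus_commute[of M f'])
      finally have 1: "N (\<lambda>x. comb F c f' x - comb F c f'' x) \<le> eta / 4" using d'(2) by linarith
      have 2: "N (\<lambda>x. g i x - comb F c f' x) < eta / 2 + eta / 4"
        using L2_triangle_diff[OF g[of i] poly_op_L2[OF b, of Pi j] comb_L2[OF f', of F c]] Pi F(2) by linarith
      show "N (\<lambda>x. g i x - comb F c f'' x) < eta"
        using L2_triangle_diff[OF g[of i] comb_L2[OF f', of F c] comb_L2[OF f''(1), of F c]] 1 2 by linarith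
    qed (fact F(1))
    then show ?thesis using d'(1) by blast
  qed
  then obtain dd where dd: "\<And>i. i \<le> n \<Longrightarrow> dd i > 0"
    "\<And>i f''. i \<le> n \<Longrightarrow> f'' \<in> L2 \<Longrightarrow> N (\<lambda>x. f'' x - f' x) \<le> dd i \<Longrightarrow> \<exists>F c. finite F \<and> N (\<lambda>x. g i x - comb F c f'' x) < eta"
    by metis
  define d' where "d' = Min (dd ` {..n})"
  have "d' > 0" using dd(1) by (simp add: d'_def)
  moreover have "d' \<le> dd i" if "i \<le> n" for i using that by (simp add: d'_def)
  ultimately have "d' > 0" "\<forall>f''\<in>L2. N (\<lambda>x. f'' x - f' x) \<le> d' \<longrightarrow>
      (\<forall>i\<le>n. \<exists>F c. finite F \<and> N (\<lambda>x. g i x - comb F c f'' x) < eta)"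
    using dd(2) order_trans by blast+
  then show ?thesis using near f' by blast
qed

text \<open>Baire's argument by nested balls: every ball contains a smaller one all of whose members
  approximate \<open>g 0\<close>, ..., \<open>g n\<close> up to (1/2)^n by combinations of their
  translates. The limit of the centres does so for every n. Since the targets span a dense subspace,
  it is cyclic.\<close>

proposition simple_spectrumI:
  fixes b g :: "nat \<Rightarrow> 'a \<Rightarrow> complex"
  assumes b: "\<And>j. b j \<in> L2" and g: "\<And>i. g i \<in> L2"
    and approx: "\<And>h e. h \<in> L2 \<Longrightarrow> e > 0 \<Longrightarrow> \<exists>J. \<forall>j\<ge>J. \<exists>P. N (\<lambda>x. h x - poly_op P (b j) x) < e"
    and dense: "\<And>h e. h \<in> L2 \<Longrightarrow> e > 0 \<Longrightarrow> \<exists>I c. finite I \<and> N (\<lambda>x. h x - (\<Sum>i\<in>I. c i * g i x)) < e"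
  shows "simple_spectrum M S"
proof -
  define good where "good n f = (\<forall>i\<le>n. \<exists>F c. finite F \<and> N (\<lambda>x. g i x - comb F c f x) < (1/2) ^ n)" for n f
  \<comment> \<open>The centre moves by at most half the radius and the radius is at least halved.
    Hence every later centre, and with them the limit, stays within the earlier radius.\<close>
  define Q where "Q n = (\<lambda>(f, d) (f', d' :: real). N (\<lambda>x. f' x - f x) \<le> d / 2 \<and> d' \<le> d / 2 \<and>
     (\<forall>f''\<in>L2. N (\<lambda>x. f'' x - f' x) \<le> d' \<longrightarrow> good n f''))" for n :: nat
  have step: "\<exists>s'. (case s' of (f', d') \<Rightarrow> f' \<in> L2 \<and> 0 < d' \<and> d' \<le> (1/2) ^ Suc n) \<and> Q n s s'"
    if s: "case s of (f, d) \<Rightarrow> f \<in> L2 \<and> 0 < d \<and> d \<le> (1/2) ^ n" for s n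
  proof -
    obtain f d where fd: "s = (f, d)" "f \<in> L2" "0 < d" "d \<le> (1/2) ^ n" using s by (cases s) auto
    have e: "(1/2::real) ^ n > 0" "d / 2 > 0" using fd by simp_all
    obtain f' where f': "f' \<in> L2" "N (\<lambda>x. f' x - f x) < d / 2"
      and "\<exists>d'>0. \<forall>f''\<in>L2. N (\<lambda>x. f'' x - f' x) \<le> d' \<longrightarrow> good n f''"
      using nearly_cyclic_perturbation[where b=b and g=g and n=n, OF b g approx fd(2) e(2) e(1)]
      unfolding good_def by blast
    then obtain d' where d': "d' > 0" "\<And>f''. f'' \<in> L2 \<Longrightarrow> N (\<lambda>x. f'' x - f' x) \<le> d' \<Longrightarrow> good n f''" by blast
    have "min d' (d / 2) \<le> (1/2) ^ Suc n" using fd(4) by simp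
    moreover have "Q n s (f', min d' (d / 2))"
      unfolding fd(1) Q_def prod.case using f'(2) d'(2) by simp
    ultimately show ?thesis using f'(1) d'(1) fd(3) by (intro exI[of _ "(f', min d' (d / 2))"]) simp
  qed
  have "\<exists>s. \<forall>n. (case s n of (f, d) \<Rightarrow> f \<in> L2 \<and> 0 < d \<and> d \<le> (1/2) ^ n) \<and> Q n (s n) (s (Suc n))"
  proof (rule dependent_nat_choice)
    show "\<exists>s. case s of (f, d :: real) \<Rightarrow> f \<in> L2 \<and> 0 < d \<and> d \<le> (1/2) ^ 0"
      by (intro exI[of _ "(\<lambda>x. 0, 1 :: real)"]) simp
  qed (fact step)
  then obtain s where s': "\<forall>n. (case s n of (f, d) \<Rightarrow> f \<in> L2 \<and> 0 < d \<and> d \<le> (1/2) ^ n) \<and> Q n (s n) (s (Suc n))"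
    by (rule exE)
  note s = s'[rule_format, THEN conjunct1] s'[rule_format, THEN conjunct2]
  define f d where "f n = fst (s n)" and "d n = snd (s n)" for n
  have f: "f n \<in> L2" and d: "0 < d n" "d n \<le> (1/2) ^ n" for n
    using s(1)[of n] by (auto simp: f_def d_def split_beta)
  have near: "N (\<lambda>x. f (Suc n) x - f n x) \<le> d n / 2" and dh: "d (Suc n) \<le> d n / 2"
    and gd: "\<And>f''. f'' \<in> L2 \<Longrightarrow> N (\<lambda>x. f'' x - f (Suc n) x) \<le> d (Suc n) \<Longrightarrow> good n f''" for n
    using s(2)[of n] by (auto simp: f_def d_def Q_def split_beta)
  have "N (\<lambda>x. f (Suc n) x - f n x) \<le> (1/2) ^ n" for n
    using near[of n] d[of n] by linarith
  from L2_complete[OF f this] obtain h where h: "h \<in> L2" "\<And>n. N (\<lambda>x. h x - f n x) \<le> 2 * (1/2) ^ n" by blast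
  have tel: "N (\<lambda>x. f (n + k) x - f n x) \<le> d n - d (n + k)" for n k
  proof (induction k)
    case (Suc k)
    show ?case using L2_triangle_diff[OF f[of "Suc (n + k)"] f[of "n + k"] f[of n]] Suc near[of "n + k"] dh[of "n + k"] by simp
  qed (simp add: L2_seminorm_def)
  have hn: "N (\<lambda>x. h x - f n x) \<le> d n" for n
  proof (rule tendsto_lowerbound)
    have "(\<lambda>k. d n + 2 * (1/2) ^ (n + k)) \<longlonglongrightarrow> d n + 2 * ((1/2) ^ n * 0)"
      unfolding power_add by (intro tendsto_intros LIMSEQ_realpow_zero) auto
    then show "(\<lambda>k. d n + 2 * (1/2) ^ (n + k)) \<longlonglongrightarrow> d n" by simp
    show "\<forall>\<^sub>F k in sequentially. N (\<lambda>x. h x - f n x) \<le> d n + 2 * (1/2) ^ (n + k)"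
    proof (intro always_eventually allI)
      fix k
      show "N (\<lambda>x. h x - f n x) \<le> d n + 2 * (1/2) ^ (n + k)"
        using L2_triangle_diff[OF h(1) f[of "n + k"] f[of n]] h(2)[of "n + k"] tel[of n k] d(1)[of "n + k"] by linarith
    qed
  qed simp
  have good: "good n h" for n by (rule gd[OF h(1) hn])
  have gZ: "g i \<in> cyclic_space h" for i
    unfolding cyclic_space_def
  proof (safe)
    fix e :: real assume e: "e > 0"
    obtain n0 where n0: "(1/2::real) ^ n0 < e" using real_arch_pow_inv[OF e, of "1/2"] by auto
    define n where "n = max i n0"
    have pn: "(1/2::real) ^ n \<le> (1/2) ^ n0" by (intro power_decreasing) (auto simp: n_def)
    obtain F c where "finite F" "N (\<lambda>x. g i x - comb F c h x) < (1/2) ^ n"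
      using good[of n] max.cobounded1[of i n0] unfolding good_def n_def by blast
    moreover from this pn n0 have "N (\<lambda>x. g i x - comb F c h x) < e" by linarith
    ultimately show "\<exists>F c. finite F \<and> N (\<lambda>x. g i x - comb F c h x) < e" by blast
  qed (fact g)
  have "k \<in> cyclic_space h" if k: "k \<in> L2" for k
  proof (rule cyclic_space_closed[OF h(1) k])
    fix e :: real assume "e > 0"
    then obtain I c where "N (\<lambda>x. k x - (\<Sum>i\<in>I. c i * g i x)) < e" using dense[OF k] by blast
    moreover have "(\<lambda>x. \<Sum>i\<in>I. c i * g i x) \<in> cyclic_space h"
      by (intro cyclic_space_sum cyclic_space_cmult gZ h)
    ultimately show "\<exists>a\<in>cyclic_space h. N (\<lambda>x. k x - a x) < e" by (rule bexI)
  qed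
  then show ?thesis using h(1) by (auto simp: simple_spectrum_def cyclic_vector_iff)
qed

end

section \<open>Density in \<open>L\<^sub>2\<close>\<close>

text \<open>Induction over Dynkin systems. One approximant \<open>v\<close> serves all measures of
  the finite set \<open>K\<close>; the comparison of several spectral measures on one set relies on
  this.\<close>

lemma L2_indicator_approx:
  fixes K :: "'a measure set" and V :: "('a \<Rightarrow> complex) set"
  assumes K: "finite K" "\<And>\<kappa>. \<kappa> \<in> K \<Longrightarrow> finite_measure \<kappa>" "\<And>\<kappa>. \<kappa> \<in> K \<Longrightarrow> sets \<kappa> = sigma_sets \<Omega> G"
    and G: "G \<subseteq> Pow \<Omega>" "Int_stable G"
    and VL: "\<And>v \<kappa>. v \<in> V \<Longrightarrow> \<kappa> \<in> K \<Longrightarrow> v \<in> L2_funs \<kappa>"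
    and V0: "(\<lambda>x. 0) \<in> V" and V1: "(\<lambda>x. 1) \<in> V"
    and Vadd: "\<And>v w. v \<in> V \<Longrightarrow> w \<in> V \<Longrightarrow> (\<lambda>x. v x + w x) \<in> V"
    and Vdiff: "\<And>v w. v \<in> V \<Longrightarrow> w \<in> V \<Longrightarrow> (\<lambda>x. v x - w x) \<in> V"
    and base: "\<And>A e. A \<in> G \<Longrightarrow> e > 0 \<Longrightarrow> \<exists>v\<in>V. \<forall>\<kappa>\<in>K. L2_seminorm \<kappa> (\<lambda>x. v x - indicator A x) < e"
    and A: "A \<in> sigma_sets \<Omega> G" and e: "e > 0"
  shows "\<exists>v\<in>V. \<forall>\<kappa>\<in>K. L2_seminorm \<kappa> (\<lambda>x. v x - indicator A x) < e"
proof -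
  have sp: "space \<kappa> = \<Omega>" if "\<kappa> \<in> K" for \<kappa>
  proof -
    have "space \<kappa> \<in> sigma_sets \<Omega> G" "\<Omega> \<in> sets \<kappa>" using K(3)[OF that] sigma_sets_top[of \<Omega> G] by auto
    then show ?thesis using sigma_sets_into_sp[OF G(1)] sets.sets_into_space by blast
  qed
  have ind: "(\<lambda>x. indicator A x :: complex) \<in> L2_funs \<kappa>" if "\<kappa> \<in> K" "A \<in> sigma_sets \<Omega> G" for \<kappa> A
  proof -
    interpret finite_measure \<kappa> using K(2) that by blast
    show ?thesis using that by (intro L2_bounded[where B=1] borel_measurable_indicator) (auto simp: K(3) indicator_def)
  qed
  have "\<forall>e>0. \<exists>v\<in>V. \<forall>\<kappa>\<in>K. L2_seminorm \<kappa> (\<lambda>x. v x - indicator A x) < e"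
    using G(2,1) A
  proof (induction rule: sigma_sets_induct_disjoint)
    case (basic A)
    then show ?case using base by blast
  next
    case empty
    then show ?case using V0 by (auto intro!: bexI[of _ "\<lambda>x. 0"] simp: L2_seminorm_def)
  next
    case (compl A)
    show ?case
    proof safe
      fix e :: real assume "e > 0"
      then obtain v where v: "v \<in> V" "\<forall>\<kappa>\<in>K. L2_seminorm \<kappa> (\<lambda>x. v x - indicator A x) < e" using compl by blast
      have "L2_seminorm \<kappa> (\<lambda>x. (1 - v x) - indicator (\<Omega> - A) x) < e" if k: "\<kappa> \<in> K" for \<kappa>
      proof -
        have "L2_seminorm \<kappa> (\<lambda>x. (1 - v x) - indicator (\<Omega> - A) x) = L2_seminorm \<kappa> (\<lambda>x. indicator A x - v x)"
          by (intro L2_seminorm_cong) (auto simp: sp[OF k] indicator_def)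
        then show ?thesis using v(2) k by (simp add: L2_seminorm_minus_commute)
      qed
      then show "\<exists>v\<in>V. \<forall>\<kappa>\<in>K. L2_seminorm \<kappa> (\<lambda>x. v x - indicator (\<Omega> - A) x) < e"
        using Vdiff[OF V1 v(1)] by (intro bexI[of _ "\<lambda>x. 1 - v x"]) auto
    qed
  next
    case (union A)
    show ?case
    proof safe
      fix e :: real assume e: "e > 0"
      \<comment> \<open>The disjoint union is cut off after \<open>n\<close> members by dominated
        convergence, with one \<open>n\<close> for all measures. Each of these members then receives
        an equal share of the other half of the error.\<close>
      have "\<forall>\<^sub>F n in sequentially. L2_seminorm \<kappa> (\<lambda>x. (\<Sum>i<n. indicator (A i) x) - indicator (\<Union>i. A i) x) < e / 2" if k: "\<kappa> \<in> K" for \<kappa>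
      proof -
        interpret finite_measure \<kappa> using K(2) k by blast
        have m [measurable]: "A i \<in> sets \<kappa>" for i using union(2) K(3)[OF k] by auto
        have part: "(\<Sum>i<n. indicator (A i) x) = (indicator (\<Union>i<n. A i) x :: complex)" for n x
        proof (cases "\<exists>i. x \<in> A i")
          case True
          then obtain i where i: "x \<in> A i" by blast
          have "x \<in> A j \<longleftrightarrow> j = i" for j using union(1) i by (auto simp: disjoint_family_on_def)
          then show ?thesis by (simp add: indicator_def)
        qed (auto simp: indicator_def)
        have "(\<lambda>n. L2_seminorm \<kappa> (\<lambda>x. (\<Sum>i<n. indicator (A i) x) - indicator (\<Union>i. A i) x)) \<longlonglongrightarrow> sqrt 0"
          unfolding L2_seminorm_def
        proof (intro tendsto_real_sqrt)
          have "(\<lambda>n. \<integral>x. (cmod ((\<Sum>i<n. indicator (A i) x) - indicator (\<Union>i. A i) x))\<^sup>2 \<partial>\<kappa>) \<longlonglongrightarrow> (\<integral>x. 0 \<partial>\<kappa>)"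
          proof (rule integral_dominated_convergence[where w="\<lambda>x. 1"])
            show "AE x in \<kappa>. (\<lambda>n. (cmod ((\<Sum>i<n. indicator (A i) x) - indicator (\<Union>i. A i) x))\<^sup>2) \<longlonglongrightarrow> 0"
            proof (intro AE_I2)
              fix x
              have "(\<lambda>n. indicator (\<Union>i<n. A i) x :: complex) \<longlonglongrightarrow> indicator (\<Union>i. A i) x"
                by (rule LIMSEQ_indicator_UN)
              then have "(\<lambda>n. (cmod (indicator (\<Union>i<n. A i) x - indicator (\<Union>i. A i) x))\<^sup>2) \<longlonglongrightarrow> (cmod (indicator (\<Union>i. A i) x - indicator (\<Union>i. A i) x))\<^sup>2"
                by (intro tendsto_intros)
              then show "(\<lambda>n. (cmod ((\<Sum>i<n. indicator (A i) x) - indicator (\<Union>i. A i) x))\<^sup>2) \<longlonglongrightarrow> 0"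
                by (simp add: part)
            qed
            show "AE x in \<kappa>. norm ((cmod ((\<Sum>i<n. indicator (A i) x) - indicator (\<Union>i. A i) x))\<^sup>2) \<le> 1" for n
              unfolding part by (intro AE_I2) (auto simp: indicator_def)
          qed auto
          then show "(\<lambda>n. \<integral>x. (cmod ((\<Sum>i<n. indicator (A i) x) - indicator (\<Union>i. A i) x))\<^sup>2 \<partial>\<kappa>) \<longlonglongrightarrow> 0" by simp
        qed
        then show ?thesis by (rule order_tendstoD(2)) (use e in simp)
      qed
      then have "\<forall>\<^sub>F n in sequentially. \<forall>\<kappa>\<in>K. L2_seminorm \<kappa> (\<lambda>x. (\<Sum>i<n. indicator (A i) x) - indicator (\<Union>i. A i) x) < e / 2"
        using K(1) by (intro eventually_ball_finite) auto
      then obtain n where n: "\<forall>\<kappa>\<in>K. L2_seminorm \<kappa> (\<lambda>x. (\<Sum>i<n. indicator (A i) x) - indicator (\<Union>i. A i) x) < e / 2"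
        by (auto simp: eventually_sequentially)
      have "\<forall>i. \<exists>v\<in>V. \<forall>\<kappa>\<in>K. L2_seminorm \<kappa> (\<lambda>x. v x - indicator (A i) x) < e / (2 * (real n + 1))"
        using union(3) e by auto
      then obtain v where v: "\<And>i. v i \<in> V" "\<And>i \<kappa>. \<kappa> \<in> K \<Longrightarrow> L2_seminorm \<kappa> (\<lambda>x. v i x - indicator (A i) x) < e / (2 * (real n + 1))"
        by metis
      have vV: "(\<lambda>x. \<Sum>i<m. v i x) \<in> V" for m by (induction m) (auto intro: V0 Vadd v(1))
      have "L2_seminorm \<kappa> (\<lambda>x. (\<Sum>i<n. v i x) - indicator (\<Union>i. A i) x) < e" if k: "\<kappa> \<in> K" for \<kappa>
      proof -
        have Ai: "A i \<in> sigma_sets \<Omega> G" for i using union(2) by auto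
        have UA: "(\<Union>i. A i) \<in> sigma_sets \<Omega> G" by (rule sigma_sets.Union[OF Ai])
        have "L2_seminorm \<kappa> (\<lambda>x. (\<Sum>i<n. v i x) - (\<Sum>i<n. indicator (A i) x)) \<le> (\<Sum>i<n. L2_seminorm \<kappa> (\<lambda>x. v i x - indicator (A i) x))"
          unfolding sum_subtractf[symmetric] by (rule L2_sum(2)) (intro L2_diff VL v ind k Ai)
        also have "\<dots> \<le> (\<Sum>i<n. e / (2 * (real n + 1)))"
          using v(2)[OF k] by (intro sum_mono less_imp_le) auto
        also have "\<dots> \<le> e / 2" using e by (simp add: field_simps)
        finally have 1: "L2_seminorm \<kappa> (\<lambda>x. (\<Sum>i<n. v i x) - (\<Sum>i<n. indicator (A i) x)) \<le> e / 2" .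
        have "L2_seminorm \<kappa> (\<lambda>x. (\<Sum>i<n. v i x) - indicator (\<Union>i. A i) x) \<le>
            L2_seminorm \<kappa> (\<lambda>x. (\<Sum>i<n. v i x) - (\<Sum>i<n. indicator (A i) x)) +
            L2_seminorm \<kappa> (\<lambda>x. (\<Sum>i<n. indicator (A i) x) - indicator (\<Union>i. A i) x)"
          by (intro L2_triangle_diff VL[OF vV k] L2_sum(1) ind k Ai UA)
        then show ?thesis using 1 n k by fastforce
      qed
      then show "\<exists>v\<in>V. \<forall>\<kappa>\<in>K. L2_seminorm \<kappa> (\<lambda>x. v x - indicator (\<Union>(range A)) x) < e"
        using vV by (intro bexI[of _ "\<lambda>x. \<Sum>i<n. v i x"]) auto
    qed
  qed
  then show ?thesis using e by blast
qed

text \<open>Simple functions bounded by 2 |h| converge to \<open>h\<close> in L2 by dominated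
  convergence. The finitely many level sets of such a function have indicators that are approximated
  inside \<open>V\<close>.\<close>

lemma L2_dense_of_indicators:
  fixes V :: "('a \<Rightarrow> complex) set"
  assumes VL: "V \<subseteq> L2_funs M"
    and V0: "(\<lambda>x. 0) \<in> V"
    and Vadd: "\<And>v w. v \<in> V \<Longrightarrow> w \<in> V \<Longrightarrow> (\<lambda>x. v x + w x) \<in> V"
    and Vscale: "\<And>v c. v \<in> V \<Longrightarrow> (\<lambda>x. c * v x) \<in> V"
    and fin: "finite_measure M"
    and base: "\<And>A e. A \<in> sets M \<Longrightarrow> e > 0 \<Longrightarrow> \<exists>v\<in>V. L2_seminorm M (\<lambda>x. v x - indicator A x) < e"
    and h: "h \<in> L2_funs M" and e: "e > 0"
  shows "\<exists>v\<in>V. L2_seminorm M (\<lambda>x. h x - v x) < e"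
proof -
  interpret finite_measure M by fact
  note [measurable] = L2_funsD(1)[OF h]
  obtain s where s: "\<And>i. simple_function M (s i)" "\<And>x. x \<in> space M \<Longrightarrow> (\<lambda>i. s i x) \<longlonglongrightarrow> h x"
    "\<And>i x. x \<in> space M \<Longrightarrow> cmod (s i x) \<le> 2 * cmod (h x)"
    using borel_measurable_implies_sequence_metric[OF L2_funsD(1)[OF h], of 0] unfolding dist_norm diff_zero by blast
  have [measurable]: "s i \<in> borel_measurable M" for i by (rule borel_measurable_simple_function[OF s(1)])
  have sL: "s i \<in> L2_funs M" for i
  proof -
    have "integrable M (\<lambda>x. (cmod (s i x))\<^sup>2)"
    proof (rule Bochner_Integration.integrable_bound)
      show "integrable M (\<lambda>x. 4 * (cmod (h x))\<^sup>2)" using L2_funsD(2)[OF h] by simp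
      show "AE x in M. norm ((cmod (s i x))\<^sup>2) \<le> norm (4 * (cmod (h x))\<^sup>2)"
        using power_mono[OF s(3) norm_ge_zero, where n=2] by (auto intro!: AE_I2 simp: power_mult_distrib)
    qed simp
    then show ?thesis by (simp add: L2_funs_def)
  qed
  have "(\<lambda>i. L2_seminorm M (\<lambda>x. h x - s i x)) \<longlonglongrightarrow> sqrt 0"
    unfolding L2_seminorm_def
  proof (intro tendsto_real_sqrt)
    have "(\<lambda>i. \<integral>x. (cmod (h x - s i x))\<^sup>2 \<partial>M) \<longlonglongrightarrow> (\<integral>x. 0 \<partial>M)"
    proof (rule integral_dominated_convergence[where w="\<lambda>x. 9 * (cmod (h x))\<^sup>2"])
      show "AE x in M. (\<lambda>i. (cmod (h x - s i x))\<^sup>2) \<longlonglongrightarrow> 0"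
      proof (intro AE_I2)
        fix x assume "x \<in> space M"
        from s(2)[OF this] have "(\<lambda>i. (cmod (h x - s i x))\<^sup>2) \<longlonglongrightarrow> (cmod (h x - h x))\<^sup>2"
          by (intro tendsto_intros)
        then show "(\<lambda>i. (cmod (h x - s i x))\<^sup>2) \<longlonglongrightarrow> 0" by simp
      qed
      show "AE x in M. norm ((cmod (h x - s i x))\<^sup>2) \<le> 9 * (cmod (h x))\<^sup>2" for i
      proof (intro AE_I2)
        fix x assume "x \<in> space M"
        then have "cmod (h x - s i x) \<le> 3 * cmod (h x)"
          using norm_triangle_ineq4[of "h x" "s i x"] s(3)[of x i] by linarith
        from power_mono[OF this, of 2] show "norm ((cmod (h x - s i x))\<^sup>2) \<le> 9 * (cmod (h x))\<^sup>2"
          by (simp add: power_mult_distrib)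
      qed
    qed (use L2_funsD(2)[OF h] in simp_all)
    then show "(\<lambda>i. \<integral>x. (cmod (h x - s i x))\<^sup>2 \<partial>M) \<longlonglongrightarrow> 0" by simp
  qed
  then have "\<forall>\<^sub>F i in sequentially. L2_seminorm M (\<lambda>x. h x - s i x) < e / 2"
    by (rule order_tendstoD(2)) (use e in simp)
  then obtain i where i: "L2_seminorm M (\<lambda>x. h x - s i x) < e / 2" by (auto simp: eventually_sequentially)
  have Vsum: "(\<lambda>x. \<Sum>y\<in>Y. w y x) \<in> V" if "\<And>y. y \<in> Y \<Longrightarrow> w y \<in> V" for Y :: "complex set" and w
    using that by (induction Y rule: infinite_finite_induct) (auto intro: V0 Vadd)
  define Y where "Y = s i ` space M"
  have Y: "finite Y" using s(1)[of i] by (simp add: Y_def simple_function_def)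
  have pre: "s i -` {y} \<inter> space M \<in> sets M" for y using measurable_sets[of "s i" M borel "{y}"] by simp
  define C where "C = (\<Sum>y\<in>Y. cmod y) + 1"
  have C: "C > 0" by (simp add: C_def sum_nonneg add_nonneg_pos)
  have "\<forall>y. \<exists>v\<in>V. L2_seminorm M (\<lambda>x. v x - indicator (s i -` {y} \<inter> space M) x) < e / (2 * C)"
    using base[OF pre] e C by simp
  then obtain v where v: "\<And>y. v y \<in> V" "\<And>y. L2_seminorm M (\<lambda>x. v y x - indicator (s i -` {y} \<inter> space M) x) < e / (2 * C)"
    by metis
  have indL: "(\<lambda>x. indicator (s i -` {y} \<inter> space M) x :: complex) \<in> L2_funs M" for y
    using pre by (intro L2_bounded[where B=1]) (auto simp: indicator_def)
  have "L2_seminorm M (\<lambda>x. s i x - (\<Sum>y\<in>Y. y * v y x)) = L2_seminorm M (\<lambda>x. \<Sum>y\<in>Y. y * (indicator (s i -` {y} \<inter> space M) x - v y x))"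
  proof (rule L2_seminorm_cong)
    fix x assume x: "x \<in> space M"
    have "(\<Sum>y\<in>Y. y * indicator (s i -` {y} \<inter> space M) x) = (\<Sum>y\<in>Y. if y = s i x then y else 0)"
      by (intro sum.cong) (auto simp: x)
    also have "\<dots> = s i x" using x Y by (simp add: Y_def)
    finally show "s i x - (\<Sum>y\<in>Y. y * v y x) = (\<Sum>y\<in>Y. y * (indicator (s i -` {y} \<inter> space M) x - v y x))"
      by (simp add: right_diff_distrib sum_subtractf)
  qed
  also have "\<dots> \<le> (\<Sum>y\<in>Y. cmod y * L2_seminorm M (\<lambda>x. v y x - indicator (s i -` {y} \<inter> space M) x))"
    unfolding L2_seminorm_minus_commute[of M "v _"] L2_seminorm_cmult[symmetric] using VL v(1)
    by (intro L2_sum(2) L2_cmult L2_diff indL) auto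
  also have "\<dots> \<le> (\<Sum>y\<in>Y. cmod y * (e / (2 * C)))"
    by (intro sum_mono mult_left_mono less_imp_le v(2) norm_ge_zero)
  also have "\<dots> = (C - 1) * (e / (2 * C))" unfolding sum_distrib_right[symmetric] by (simp add: C_def)
  also have "\<dots> \<le> e / 2" using C e by (simp add: field_simps)
  finally have "L2_seminorm M (\<lambda>x. s i x - (\<Sum>y\<in>Y. y * v y x)) \<le> e / 2" .
  moreover have inV: "(\<lambda>x. \<Sum>y\<in>Y. y * v y x) \<in> V" by (intro Vsum Vscale v)
  ultimately have "L2_seminorm M (\<lambda>x. h x - (\<Sum>y\<in>Y. y * v y x)) < e"
    using L2_triangle_diff[OF h sL[of i], of "\<lambda>x. \<Sum>y\<in>Y. y * v y x"] VL i by (auto simp: subset_iff)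
  then show ?thesis by (rule bexI[OF _ inV])
qed

section \<open>Spectral measures\<close>

lemma space_circle [simp]: "space circle_borel = sphere 0 1"
  by (simp add: circle_borel_def space_restrict_space)

lemma circle_borel_measurable:
  fixes f :: "complex \<Rightarrow> 'b::topological_space"
  assumes "continuous_on (sphere 0 1) f" "sets \<sigma> = sets circle_borel"
  shows "f \<in> borel_measurable \<sigma>"
  by (subst measurable_cong_sets[OF assms(2) refl])
    (simp add: circle_borel_def borel_measurable_continuous_on_restrict[OF assms(1)])

lemma inverse_eq_cnj: "cmod z = 1 \<Longrightarrow> inverse z = cnj z"
  using complex_norm_square[of z] by (intro inverse_unique) simp

definition trig :: "int set \<Rightarrow> (int \<Rightarrow> complex) \<Rightarrow> complex \<Rightarrow> complex" where
  "trig F c z = (\<Sum>k\<in>F. c k * z powi k)"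

lemma continuous_on_trig [continuous_intros]: "continuous_on (sphere 0 1) (trig F c)"
  unfolding trig_def by (intro continuous_intros) auto

text \<open>Only the values on the circle matter. Polynomials in the real and imaginary part, the
  output of Stone-Weierstrass, can therefore be members.\<close>

definition trigs :: "(complex \<Rightarrow> complex) set" where
  "trigs = {f. \<exists>F c. finite F \<and> (\<forall>z\<in>sphere 0 1. f z = trig F c z)}"

lemma trigs_monom: "(\<lambda>z. a * z powi k) \<in> trigs"
  unfolding trigs_def by (auto intro!: exI[of _ "{k}"] exI[of _ "\<lambda>_. a"] simp: trig_def)

lemma trigs_const: "(\<lambda>z. a) \<in> trigs"
  using trigs_monom[of a 0] by simp

lemma trigs_add:
  assumes "f \<in> trigs" "g \<in> trigs"
  shows "(\<lambda>z. f z + g z) \<in> trigs"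
proof -
  obtain F c where F: "finite F" "\<forall>z\<in>sphere 0 1. f z = trig F c z" using assms(1) by (auto simp: trigs_def)
  obtain G d where G: "finite G" "\<forall>z\<in>sphere 0 1. g z = trig G d z" using assms(2) by (auto simp: trigs_def)
  define c2 where "c2 k = (if k \<in> F then c k else 0) + (if k \<in> G then d k else 0)" for k
  have "trig (F \<union> G) c2 z = trig F c z + trig G d z" for z
  proof -
    have "trig (F \<union> G) c2 z = (\<Sum>k\<in>F \<union> G. if k \<in> F then c k * z powi k else 0) + (\<Sum>k\<in>F \<union> G. if k \<in> G then d k * z powi k else 0)"
      unfolding sum.distrib[symmetric] trig_def by (intro sum.cong) (auto simp: c2_def algebra_simps)
    also have "(\<Sum>k\<in>F \<union> G. if k \<in> F then c k * z powi k else 0) = trig F c z"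
      unfolding trig_def using F G by (intro sum.mono_neutral_cong_right) auto
    also have "(\<Sum>k\<in>F \<union> G. if k \<in> G then d k * z powi k else 0) = trig G d z"
      unfolding trig_def using F G by (intro sum.mono_neutral_cong_right) auto
    finally show ?thesis .
  qed
  with F G show ?thesis unfolding trigs_def by (auto intro!: exI[of _ "F \<union> G"] exI[of _ c2])
qed

lemma trigs_sum: "(\<And>i. i \<in> I \<Longrightarrow> f i \<in> trigs) \<Longrightarrow> (\<lambda>z. \<Sum>i\<in>I. f i z) \<in> trigs"
  by (induction I rule: infinite_finite_induct) (auto intro: trigs_add trigs_const)

lemma trigs_cong: "f \<in> trigs \<Longrightarrow> (\<And>z. z \<in> sphere 0 1 \<Longrightarrow> g z = f z) \<Longrightarrow> g \<in> trigs"
  unfolding trigs_def by auto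

lemma trigs_mult:
  assumes "f \<in> trigs" "g \<in> trigs"
  shows "(\<lambda>z. f z * g z) \<in> trigs"
proof -
  obtain F c where F: "finite F" "\<forall>z\<in>sphere 0 1. f z = trig F c z" using assms(1) by (auto simp: trigs_def)
  obtain G d where G: "finite G" "\<forall>z\<in>sphere 0 1. g z = trig G d z" using assms(2) by (auto simp: trigs_def)
  have "(\<lambda>z. \<Sum>k\<in>F. \<Sum>l\<in>G. (c k * d l) * z powi (k + l)) \<in> trigs"
    by (intro trigs_sum trigs_monom)
  then show ?thesis
  proof (rule trigs_cong)
    fix z :: complex assume z: "z \<in> sphere 0 1"
    then have "z \<noteq> 0" by auto
    then show "f z * g z = (\<Sum>k\<in>F. \<Sum>l\<in>G. (c k * d l) * z powi (k + l))"
      using F G z by (simp add: trig_def sum_product power_int_add algebra_simps)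
  qed
qed

lemma trigs_diff:
  assumes "f \<in> trigs" "g \<in> trigs"
  shows "(\<lambda>z. f z - g z) \<in> trigs"
  using trigs_add[OF assms(1) trigs_mult[OF trigs_const[of "-1"] assms(2)]] by simp

text \<open>On the circle the inverse of z is its conjugate, so the real and imaginary parts are
  combinations of z and z^-1. Sums and products stay inside the trigonometric polynomials.\<close>

lemma trigs_real_polynomial:
  assumes "real_polynomial_function (p :: complex \<Rightarrow> real)"
  shows "(\<lambda>z. complex_of_real (p z)) \<in> trigs"
  using assms
proof induction
  case (linear f)
  have "(\<lambda>z. (complex_of_real (f 1) / 2 + complex_of_real (f \<i>) / (2 * \<i>)) * z powi 1
      + (complex_of_real (f 1) / 2 - complex_of_real (f \<i>) / (2 * \<i>)) * z powi (-1)) \<in> trigs"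
    by (intro trigs_add trigs_monom)
  then show ?case
  proof (rule trigs_cong)
    fix z :: complex assume "z \<in> sphere 0 1"
    then have z: "cmod z = 1" by simp
    then have inv: "inverse z = cnj z" by (rule inverse_eq_cnj)
    have "f z = f (Re z *\<^sub>R 1 + Im z *\<^sub>R \<i>)" by (simp add: complex_eq[symmetric] scaleR_conv_of_real mult.commute)
    also have "\<dots> = Re z * f 1 + Im z * f \<i>"
      using linear by (simp add: linear_simps)
    finally have "complex_of_real (f z) = complex_of_real (f 1) * complex_of_real (Re z) + complex_of_real (f \<i>) * complex_of_real (Im z)"
      by simp
    moreover have "complex_of_real (Re z) = (z + cnj z) / 2" "complex_of_real (Im z) = (z - cnj z) / (2 * \<i>)"
      by (simp_all add: complex_eq_iff)
    ultimately have "complex_of_real (f z) = complex_of_real (f 1) * ((z + cnj z) / 2) + complex_of_real (f \<i>) * ((z - cnj z) / (2 * \<i>))"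
      by simp
    then show "complex_of_real (f z) = (complex_of_real (f 1) / 2 + complex_of_real (f \<i>) / (2 * \<i>)) * z powi 1
      + (complex_of_real (f 1) / 2 - complex_of_real (f \<i>) / (2 * \<i>)) * z powi (-1)"
      by (simp add: power_int_minus inv) (simp add: field_simps)
  qed
qed (auto intro: trigs_const trigs_add trigs_mult)

lemma trigs_L2:
  assumes f: "f \<in> trigs" and s: "finite_measure \<sigma>" "sets \<sigma> = sets circle_borel"
  shows "f \<in> L2_funs \<sigma>"
proof -
  interpret finite_measure \<sigma> by fact
  obtain F c where F: "finite F" "\<And>z. z \<in> sphere 0 1 \<Longrightarrow> f z = trig F c z" using f by (auto simp: trigs_def)
  have sp: "space \<sigma> = sphere 0 1" using sets_eq_imp_space_eq[OF s(2)] by simp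
  have "continuous_on (sphere 0 1) f" by (rule continuous_on_eq[OF continuous_on_trig[of F c]]) (simp add: F(2))
  then show ?thesis
  proof (intro L2_bounded[where B="\<Sum>k\<in>F. cmod (c k)"] circle_borel_measurable s(2))
    fix z assume "z \<in> space \<sigma>"
    then have z: "cmod z = 1" "z \<in> sphere 0 1" by (auto simp: sp)
    have "cmod (f z) \<le> (\<Sum>k\<in>F. cmod (c k * z powi k))" unfolding F(2)[OF z(2)] trig_def by (rule norm_sum)
    also have "\<dots> = (\<Sum>k\<in>F. cmod (c k))" by (simp add: norm_mult norm_power_int z)
    finally show "cmod (f z) \<le> (\<Sum>k\<in>F. cmod (c k))" .
  qed
qed

text \<open>Relatively closed sets form an intersection-stable generator of the Borel sets of the
  circle. The indicator of a closed set is the limit of continuous tents of increasing slope, and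
  these are uniformly approximated by trigonometric polynomials.\<close>

lemma trig_approx_indicator:
  fixes K :: "complex measure set"
  assumes K: "finite K" "\<And>\<kappa>. \<kappa> \<in> K \<Longrightarrow> finite_measure \<kappa>" "\<And>\<kappa>. \<kappa> \<in> K \<Longrightarrow> sets \<kappa> = sets circle_borel"
    and A: "A \<in> sets circle_borel" and e: "e > 0"
  shows "\<exists>v\<in>trigs. \<forall>\<kappa>\<in>K. L2_seminorm \<kappa> (\<lambda>z. v z - indicator A z) < e"
proof -
  define G where "G = (\<inter>) (sphere (0::complex) 1) ` Collect closed"
  have sets_eq: "sets circle_borel = sigma_sets (sphere 0 1) G"
  proof -
    have "sets circle_borel = (\<inter>) (sphere 0 1) ` sigma_sets UNIV (Collect closed)"
      unfolding circle_borel_def sets_restrict_space borel_eq_closed by simp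
    also have "\<dots> = sigma_sets (sphere 0 1) G"
      unfolding G_def by (intro sigma_sets_Int) (auto simp: borel_eq_closed[symmetric] intro: sigma_sets.Basic)
    finally show ?thesis .
  qed
  show ?thesis
  proof (rule L2_indicator_approx[where \<Omega>="sphere 0 1" and G=G, OF K(1,2) _ _ _ _ trigs_const trigs_const trigs_add trigs_diff _ A[unfolded sets_eq] e])
    show "sets \<kappa> = sigma_sets (sphere 0 1) G" if "\<kappa> \<in> K" for \<kappa> using K(3)[OF that] sets_eq by simp
    show "G \<subseteq> Pow (sphere 0 1)" by (auto simp: G_def)
    show "Int_stable G"
    proof (rule Int_stableI)
      fix a b assume "a \<in> G" "b \<in> G"
      then obtain a' b' where "closed a'" "closed b'" "a = sphere 0 1 \<inter> a'" "b = sphere 0 1 \<inter> b'" by (auto simp: G_def)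
      then have "a \<inter> b = sphere 0 1 \<inter> (a' \<inter> b')" "closed (a' \<inter> b')" by auto
      then show "a \<inter> b \<in> G" unfolding G_def by blast
    qed
    show "v \<in> L2_funs \<kappa>" if "v \<in> trigs" "\<kappa> \<in> K" for v \<kappa> using trigs_L2 K that by blast
  next
    fix A and e :: real assume "A \<in> G" and e: "e > 0"
    then have cA: "closed A" by (auto simp: G_def)
    show "\<exists>v\<in>trigs. \<forall>\<kappa>\<in>K. L2_seminorm \<kappa> (\<lambda>z. v z - indicator A z) < e"
    proof (cases "A = {}")
      case True
      then show ?thesis using e trigs_const[of 0] by (intro bexI[of _ "\<lambda>z. 0"]) (auto simp: L2_seminorm_def)
    next
      case False
      define f where "f n z = max 0 (1 - real n * infdist z A)" for n and z :: complex
      have cf: "continuous_on X (f n)" for n X unfolding f_def by (intro continuous_intros)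
      have f01: "0 \<le> f n z" "f n z \<le> 1" for n z using infdist_nonneg[of z A] by (auto simp: f_def)
      have lim: "(\<lambda>n. f n z) \<longlonglongrightarrow> indicator A z" for z
      proof (cases "z \<in> A")
        case True
        then show ?thesis by (simp add: f_def)
      next
        case z: False
        then have d: "infdist z A > 0" using cA False infdist_pos_not_in_closed by blast
        obtain n0 where n0: "real n0 * infdist z A > 1" using ex_less_of_nat_mult[OF d] by blast
        have "\<forall>\<^sub>F n in sequentially. f n z = 0"
        proof (rule eventually_sequentiallyI[of n0])
          fix n assume "n0 \<le> n"
          then have "real n0 * infdist z A \<le> real n * infdist z A" using d by (intro mult_right_mono) auto
          then show "f n z = 0" using n0 by (simp add: f_def)
        qed
        then show ?thesis using z by (simp add: tendsto_eventually)
      qed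
      have "\<forall>\<^sub>F n in sequentially. L2_seminorm \<kappa> (\<lambda>z. complex_of_real (f n z) - indicator A z) < e / 2" if k: "\<kappa> \<in> K" for \<kappa>
      proof -
        interpret finite_measure \<kappa> using K(2) k by blast
        have sp: "space \<kappa> = sphere 0 1" using sets_eq_imp_space_eq[OF K(3)[OF k]] by simp
        have [measurable]: "A \<in> sets \<kappa>" using \<open>A \<in> G\<close> K(3)[OF k] sets_eq by auto
        have [measurable]: "f n \<in> borel_measurable \<kappa>" for n by (rule circle_borel_measurable[OF cf K(3)[OF k]])
        have "(\<lambda>n. L2_seminorm \<kappa> (\<lambda>z. complex_of_real (f n z) - indicator A z)) \<longlonglongrightarrow> sqrt 0"
          unfolding L2_seminorm_def
        proof (intro tendsto_real_sqrt)
          have "(\<lambda>n. \<integral>z. (cmod (complex_of_real (f n z) - indicator A z))\<^sup>2 \<partial>\<kappa>) \<longlonglongrightarrow> (\<integral>z. 0 \<partial>\<kappa>)"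
          proof (rule integral_dominated_convergence[where w="\<lambda>x. 1"])
            show "AE z in \<kappa>. (\<lambda>n. (cmod (complex_of_real (f n z) - indicator A z))\<^sup>2) \<longlonglongrightarrow> 0"
            proof (intro AE_I2)
              fix z
              have eq: "complex_of_real (indicator A z) = indicator A z" by (simp add: indicator_def)
              have "(\<lambda>n. (cmod (complex_of_real (f n z) - complex_of_real (indicator A z)))\<^sup>2) \<longlonglongrightarrow> (cmod (complex_of_real (indicator A z) - complex_of_real (indicator A z)))\<^sup>2"
                by (intro tendsto_intros lim)
              then show "(\<lambda>n. (cmod (complex_of_real (f n z) - indicator A z))\<^sup>2) \<longlonglongrightarrow> 0"
                unfolding eq by simp
            qed
            show "AE z in \<kappa>. norm ((cmod (complex_of_real (f n z) - indicator A z))\<^sup>2) \<le> 1" for n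
            proof (intro AE_I2)
              fix z
              have "cmod (complex_of_real (f n z) - complex_of_real (indicator A z)) \<le> 1"
                unfolding of_real_diff[symmetric] norm_of_real using f01[of n z] by (auto simp: indicator_def)
              then have "(cmod (complex_of_real (f n z) - indicator A z))\<^sup>2 \<le> 1\<^sup>2"
                by (intro power_mono) (auto simp: indicator_def)
              then show "norm ((cmod (complex_of_real (f n z) - indicator A z))\<^sup>2) \<le> 1" by simp
            qed
          qed auto
          then show "(\<lambda>n. \<integral>z. (cmod (complex_of_real (f n z) - indicator A z))\<^sup>2 \<partial>\<kappa>) \<longlonglongrightarrow> 0" by simp
        qed
        then show ?thesis by (rule order_tendstoD(2)) (use e in simp)
      qed
      then have "\<forall>\<^sub>F n in sequentially. \<forall>\<kappa>\<in>K. L2_seminorm \<kappa> (\<lambda>z. complex_of_real (f n z) - indicator A z) < e / 2"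
        using K(1) by (intro eventually_ball_finite) auto
      then obtain n where n: "\<forall>\<kappa>\<in>K. L2_seminorm \<kappa> (\<lambda>z. complex_of_real (f n z) - indicator A z) < e / 2"
        by (auto simp: eventually_sequentially)
      \<comment> \<open>\<open>W\<close> bounds the norm of the constant 1 for every measure of
        \<open>K\<close>, so a uniform error of e/(2 W) becomes at most e/2 in each of them.\<close>
      define W where "W = (\<Sum>\<kappa>\<in>K. L2_seminorm \<kappa> (\<lambda>z. 1)) + 1"
      have W: "W > 0" "\<And>\<kappa>. \<kappa> \<in> K \<Longrightarrow> L2_seminorm \<kappa> (\<lambda>z. 1) \<le> W"
      proof -
        show "W > 0" by (simp add: W_def sum_nonneg add_nonneg_pos)
        show "L2_seminorm \<kappa> (\<lambda>z. 1) \<le> W" if "\<kappa> \<in> K" for \<kappa>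
          using member_le_sum[OF that, of "\<lambda>\<kappa>. L2_seminorm \<kappa> (\<lambda>z. 1)"] K(1) by (simp add: W_def)
      qed
      obtain p where p: "real_polynomial_function p" "\<And>z. z \<in> sphere 0 1 \<Longrightarrow> \<bar>f n z - p z\<bar> < e / (2 * W)"
        using Stone_Weierstrass_real_polynomial_function[OF compact_sphere cf, of "e / (2 * W)" 0 1 n] e W by auto
      have pt: "(\<lambda>z. complex_of_real (p z)) \<in> trigs" by (rule trigs_real_polynomial[OF p(1)])
      have "L2_seminorm \<kappa> (\<lambda>z. complex_of_real (p z) - indicator A z) < e" if k: "\<kappa> \<in> K" for \<kappa>
      proof -
        interpret finite_measure \<kappa> using K(2) k by blast
        have sp: "space \<kappa> = sphere 0 1" using sets_eq_imp_space_eq[OF K(3)[OF k]] by simp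
        have [measurable]: "A \<in> sets \<kappa>" using \<open>A \<in> G\<close> K(3)[OF k] sets_eq by auto
        have [measurable]: "f n \<in> borel_measurable \<kappa>" by (rule circle_borel_measurable[OF cf K(3)[OF k]])
        have pL: "(\<lambda>z. complex_of_real (p z)) \<in> L2_funs \<kappa>" by (rule trigs_L2[OF pt K(2,3)[OF k]])
        have fL: "(\<lambda>z. complex_of_real (f n z)) \<in> L2_funs \<kappa>"
          using f01 by (intro L2_bounded[where B=1]) auto
        have iL: "(\<lambda>z. indicator A z :: complex) \<in> L2_funs \<kappa>"
          by (intro L2_bounded[where B=1]) (auto simp: indicator_def)
        have "L2_seminorm \<kappa> (\<lambda>z. complex_of_real (p z) - complex_of_real (f n z)) \<le> L2_seminorm \<kappa> (\<lambda>z. complex_of_real (e / (2 * W)) * 1)"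
          unfolding L2_seminorm_def
        proof (intro real_sqrt_le_mono integral_mono)
          show "integrable \<kappa> (\<lambda>z. (cmod (complex_of_real (p z) - complex_of_real (f n z)))\<^sup>2)"
            using L2_diff[OF pL fL] by (simp add: L2_funs_def)
          show "(cmod (complex_of_real (p z) - complex_of_real (f n z)))\<^sup>2 \<le> (cmod (complex_of_real (e / (2 * W)) * 1))\<^sup>2" if "z \<in> space \<kappa>" for z
            using p(2)[of z] that e W unfolding mult_1_right norm_of_real of_real_diff[symmetric]
            by (intro power_mono) (auto simp: sp)
        qed simp
        also have "\<dots> = (e / (2 * W)) * L2_seminorm \<kappa> (\<lambda>z. 1)"
          unfolding L2_seminorm_cmult norm_of_real using e W by simp
        also have "\<dots> \<le> (e / (2 * W)) * W" using W e k by (intro mult_left_mono) auto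
        also have "\<dots> = e / 2" using W by simp
        finally show ?thesis using L2_triangle_diff[OF pL fL iL] n k by fastforce
      qed
      then show ?thesis using pt by (intro bexI[of _ "\<lambda>z. complex_of_real (p z)"]) auto
    qed
  qed
qed

lemma integrable_powi:
  assumes s: "finite_measure \<sigma>" "sets \<sigma> = sets circle_borel"
  shows "integrable \<sigma> (\<lambda>z. z powi k :: complex)"
proof -
  interpret finite_measure \<sigma> by fact
  have sp: "space \<sigma> = sphere 0 1" using sets_eq_imp_space_eq[OF s(2)] by simp
  show ?thesis
    by (rule integrable_const_bound[where B=1])
      (auto intro!: AE_I2 circle_borel_measurable[OF _ s(2)] continuous_intros simp: sp norm_power_int)
qed

lemma trig_norm_square:
  assumes "z \<in> sphere 0 1"
  shows "complex_of_real ((cmod (trig F c z))\<^sup>2) = (\<Sum>k\<in>F. \<Sum>l\<in>F. c k * cnj (c l) * z powi (k - l))"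
proof -
  have z: "cmod z = 1" "z \<noteq> 0" using assms by auto
  then have inv: "cnj z = inverse z" by (simp add: inverse_eq_cnj)
  have "complex_of_real ((cmod (trig F c z))\<^sup>2) = (\<Sum>k\<in>F. \<Sum>l\<in>F. c k * z powi k * (cnj (c l) * cnj (z powi l)))"
    unfolding complex_norm_square trig_def cnj_sum sum_product complex_cnj_mult ..
  also have "\<dots> = (\<Sum>k\<in>F. \<Sum>l\<in>F. c k * cnj (c l) * z powi (k - l))"
    using z(2) by (intro sum.cong refl) (simp add: inv power_int_diff power_int_inverse field_simps)
  finally show ?thesis .
qed

context automorphism_space begin

definition corr :: "('a \<Rightarrow> complex) \<Rightarrow> int \<Rightarrow> complex" where
  "corr f k = L2_inner M (U k f) f"

lemma N_comb_square:
  assumes f: "f \<in> L2"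
  shows "complex_of_real ((N (comb F c f))\<^sup>2) = (\<Sum>k\<in>F. \<Sum>l\<in>F. c k * cnj (c l) * corr f (k - l))"
proof -
  have "complex_of_real ((N (comb F c f))\<^sup>2) = (\<integral>x. complex_of_real ((cmod (comb F c f x))\<^sup>2) \<partial>M)"
    unfolding L2_seminorm_square by (rule integral_complex_of_real[symmetric])
  also have "\<dots> = (\<integral>x. (\<Sum>k\<in>F. \<Sum>l\<in>F. c k * cnj (c l) * (U k f x * cnj (U l f x))) \<partial>M)"
    by (intro Bochner_Integration.integral_cong) (auto simp only: complex_norm_square comb_def cnj_sum sum_product complex_cnj_mult ac_simps)
  also have "\<dots> = (\<Sum>k\<in>F. \<Sum>l\<in>F. c k * cnj (c l) * L2_inner M (U k f) (U l f))"
    unfolding L2_inner_def using L2_inner_integrable[OF U_L2[OF f] U_L2[OF f]]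
    by (simp del: U_apply)
  finally show ?thesis by (simp add: inner_U[OF f] corr_def)
qed

text \<open>Both squared norms are the same quadratic form in the coefficients, with matrix entries
  corr f (k - l). Thus z^k corresponds to U^k f, and estimates pass between the circle and the
  space.\<close>

lemma spectral_isometry:
  assumes s: "spectral_measure M S f \<sigma>" and f: "f \<in> L2"
  shows "L2_seminorm \<sigma> (trig F c) = N (comb F c f)"
proof -
  have fin: "finite_measure \<sigma>" "sets \<sigma> = sets circle_borel"
    and r: "\<And>k. (\<integral>z. z powi k \<partial>\<sigma>) = corr f k"
    using s by (auto simp: spectral_measure_def corr_def)
  have sp: "space \<sigma> = sphere 0 1" using sets_eq_imp_space_eq[OF fin(2)] by simp
  have "complex_of_real ((L2_seminorm \<sigma> (trig F c))\<^sup>2) = (\<integral>z. complex_of_real ((cmod (trig F c z))\<^sup>2) \<partial>\<sigma>)"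
    unfolding L2_seminorm_square by (rule integral_complex_of_real[symmetric])
  also have "\<dots> = (\<integral>z. (\<Sum>k\<in>F. \<Sum>l\<in>F. c k * cnj (c l) * z powi (k - l)) \<partial>\<sigma>)"
    by (rule Bochner_Integration.integral_cong) (simp_all only: sp trig_norm_square refl)
  also have "\<dots> = (\<Sum>k\<in>F. \<Sum>l\<in>F. c k * cnj (c l) * corr f (k - l))"
    using integrable_powi[OF fin] by (simp add: r)
  also have "\<dots> = complex_of_real ((N (comb F c f))\<^sup>2)" by (rule N_comb_square[OF f, symmetric])
  finally have "(L2_seminorm \<sigma> (trig F c))\<^sup>2 = (N (comb F c f))\<^sup>2" by (simp only: of_real_eq_iff)
  then show ?thesis by (simp add: power2_eq_iff_nonneg)
qed

end

lemma sum_roots_of_unity: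
  fixes j :: int
  assumes j: "\<bar>j\<bar> < int L"
  shows "(\<Sum>l<L. cis (of_int j * (2 * pi * real l / real L))) = (if j = 0 then of_nat L else 0)"
proof (cases "j = 0")
  case False
  have L: "L > 0" using j by auto
  define w where "w = cis (of_int j * (2 * pi / real L))"
  have pow: "cis (of_int j * (2 * pi * real l / real L)) = w ^ l" for l
    unfolding w_def Complex.DeMoivre by (simp add: algebra_simps)
  have "w ^ L = cis (2 * pi * of_int j)"
    unfolding w_def Complex.DeMoivre by (rule arg_cong[where f=cis]) (use L in \<open>simp add: field_simps\<close>)
  then have wL: "w ^ L = 1" by (simp add: complex_eq_iff cos_int_2pin sin_int_2pin)
  have "w \<noteq> 1"
  proof
    assume "w = 1"
    then have "cos (of_int j * (2 * pi / real L)) = 1" by (simp add: w_def complex_eq_iff)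
    then obtain n :: int where n: "of_int j * (2 * pi / real L) = of_int n * 2 * pi" by (auto simp: cos_one_2pi_int)
    then have "real_of_int j = real_of_int (n * int L)" using L by (simp add: field_simps)
    then have "j = n * int L" by (simp only: of_int_eq_iff)
    then have "int L \<le> \<bar>j\<bar>" using False by (auto simp: abs_mult mult_le_cancel_right1)
    then show False using j by linarith
  qed
  then show ?thesis unfolding pow using False wL by (simp add: geometric_sum)
qed simp

lemma card_int_diff:
  assumes "\<bar>k\<bar> < int n"
  shows "card {a \<in> {0..<int n}. a - k \<in> {0..<int n}} = nat (int n - \<bar>k\<bar>)"
proof -
  have "{a \<in> {0..<int n}. a - k \<in> {0..<int n}} = {max 0 k..<min (int n) (int n + k)}" by auto
  then show ?thesis by auto
qed

context automorphism_space begin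

text \<open>Herglotz: the spectral measure is a weak limit of discrete measures on roots of unity, whose
  weights are squared norms and whose Fourier coefficients are Fejer means.\<close>

proposition spectral_measure_exists:
  assumes f: "f \<in> L2"
  shows "\<exists>\<sigma>. spectral_measure M S f \<sigma>"
proof -
  \<comment> \<open>Angles of the roots of unity of order 3 (n + 1). The order exceeds every
    frequency k - a + b occurring below, so summation over the roots singles out b = a - k.\<close>
  define \<theta> where "\<theta> n l = 2 * pi * real l / real (3 * Suc n)" for n l
  \<comment> \<open>A squared norm, hence a non-negative weight. Up to the quadrature factor it is,
    as a function of the angle, the Fejer mean of the Fourier series with coefficients
    \<open>corr f\<close>.\<close>
  define w where "w n l = (N (comb {0..<int (Suc n)} (\<lambda>k. cis (- of_int k * \<theta> n l)) f))\<^sup>2 / (real (3 * Suc n) * real (Suc n))" for n l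
  have w0: "w n l \<ge> 0" for n l by (simp add: w_def)
  have fourier: "(\<Sum>l<3 * Suc n. complex_of_real (w n l) * cis (of_int k * \<theta> n l)) = (1 - of_int \<bar>k\<bar> / of_nat (Suc n)) * corr f k"
    if k: "\<bar>k\<bar> < int (Suc n)" for n k
  proof -
    let ?F = "{0..<int (Suc n)}"
    have "(\<Sum>l<3 * Suc n. complex_of_real (w n l) * cis (of_int k * \<theta> n l))
       = (\<Sum>l<3 * Suc n. (\<Sum>a\<in>?F. \<Sum>b\<in>?F. corr f (a - b) * cis (of_int (k - a + b) * \<theta> n l)) / (of_nat (3 * Suc n) * of_nat (Suc n)))"
    proof (rule sum.cong[OF refl])
      fix l
      have "complex_of_real (w n l) * cis (of_int k * \<theta> n l) =
         (\<Sum>a\<in>?F. \<Sum>b\<in>?F. cis (- of_int a * \<theta> n l) * cnj (cis (- of_int b * \<theta> n l)) * corr f (a - b)) * cis (of_int k * \<theta> n l) / (of_nat (3 * Suc n) * of_nat (Suc n))"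
        unfolding w_def of_real_divide N_comb_square[OF f] by simp
      also have "(\<Sum>a\<in>?F. \<Sum>b\<in>?F. cis (- of_int a * \<theta> n l) * cnj (cis (- of_int b * \<theta> n l)) * corr f (a - b)) * cis (of_int k * \<theta> n l) =
         (\<Sum>a\<in>?F. \<Sum>b\<in>?F. corr f (a - b) * cis (of_int (k - a + b) * \<theta> n l))"
        unfolding sum_distrib_right
      proof (intro sum.cong refl)
        fix a b
        have "cis (- of_int a * \<theta> n l) * cnj (cis (- of_int b * \<theta> n l)) * cis (of_int k * \<theta> n l) = cis (of_int (k - a + b) * \<theta> n l)"
          by (simp add: cis_cnj cis_mult algebra_simps)
        then show "cis (- of_int a * \<theta> n l) * cnj (cis (- of_int b * \<theta> n l)) * corr f (a - b) * cis (of_int k * \<theta> n l) = corr f (a - b) * cis (of_int (k - a + b) * \<theta> n l)"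
          by (metis mult.assoc mult.commute)
      qed
      finally show "complex_of_real (w n l) * cis (of_int k * \<theta> n l) = (\<Sum>a\<in>?F. \<Sum>b\<in>?F. corr f (a - b) * cis (of_int (k - a + b) * \<theta> n l)) / (of_nat (3 * Suc n) * of_nat (Suc n))" .
    qed
    also have "\<dots> = (\<Sum>a\<in>?F. \<Sum>b\<in>?F. corr f (a - b) * (\<Sum>l<3 * Suc n. cis (of_int (k - a + b) * \<theta> n l))) / (of_nat (3 * Suc n) * of_nat (Suc n))"
      unfolding sum_divide_distrib[symmetric] sum_distrib_left
      by (subst sum.swap, rule arg_cong2[where f="(/)"], rule sum.cong[OF refl], subst sum.swap) simp_all
    also have "(\<Sum>a\<in>?F. \<Sum>b\<in>?F. corr f (a - b) * (\<Sum>l<3 * Suc n. cis (of_int (k - a + b) * \<theta> n l)))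
       = (\<Sum>a\<in>?F. \<Sum>b\<in>?F. if b = a - k then corr f k * of_nat (3 * Suc n) else 0)"
    proof (intro sum.cong refl)
      fix a b assume "a \<in> ?F" "b \<in> ?F"
      then have "\<bar>k - a + b\<bar> < int (3 * Suc n)" using k by auto
      from sum_roots_of_unity[OF this]
      have "(\<Sum>l<3 * Suc n. cis (of_int (k - a + b) * \<theta> n l)) = (if k - a + b = 0 then of_nat (3 * Suc n) else 0)"
        unfolding \<theta>_def .
      moreover have "k - a + b = 0 \<longleftrightarrow> b = a - k" by auto
      ultimately show "corr f (a - b) * (\<Sum>l<3 * Suc n. cis (of_int (k - a + b) * \<theta> n l)) = (if b = a - k then corr f k * of_nat (3 * Suc n) else 0)"
        by simp
    qed
    also have "\<dots> = (\<Sum>a\<in>?F. if a - k \<in> ?F then corr f k * of_nat (3 * Suc n) else 0)"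
      by (intro sum.cong refl) (simp only: sum.delta finite_atLeastLessThan_int)
    also have "\<dots> = of_nat (card {a \<in> ?F. a - k \<in> ?F}) * (corr f k * of_nat (3 * Suc n))"
      by (simp only: sum.inter_filter[symmetric] finite_atLeastLessThan_int sum_constant)
    also have "\<dots> = (of_nat (Suc n) - of_int \<bar>k\<bar>) * (corr f k * of_nat (3 * Suc n))"
    proof -
      have "(of_nat (nat (int (Suc n) - \<bar>k\<bar>)) :: complex) = of_int (int (nat (int (Suc n) - \<bar>k\<bar>)))" by (simp only: of_int_of_nat_eq)
      also have "int (nat (int (Suc n) - \<bar>k\<bar>)) = int (Suc n) - \<bar>k\<bar>" using k by simp
      finally show ?thesis unfolding card_int_diff[OF k] by simp
    qed
    also have "\<dots> / (of_nat (3 * Suc n) * of_nat (Suc n)) = (1 - of_int \<bar>k\<bar> / of_nat (Suc n)) * corr f k"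
    proof -
      have "(of_nat (Suc n) :: complex) \<noteq> 0" "(of_nat (3 * Suc n) :: complex) \<noteq> 0" unfolding of_nat_eq_0_iff by simp_all
      moreover have "(a - j) * (c * t) / (t * a) = (1 - j / a) * c" if "a \<noteq> 0" "t \<noteq> 0" for a t c j :: complex
        using that by (simp add: field_simps)
      ultimately show ?thesis by blast
    qed
    finally show ?thesis .
  qed
  define W where "W = (N f)\<^sup>2"
  have c0: "corr f 0 = complex_of_real W"
    using N_comb_square[OF f, of "{0}" "\<lambda>_. 1"] by (simp add: comb_def[abs_def] W_def)
  have wsum: "(\<Sum>l<3 * Suc n. w n l) = W" for n
  proof -
    have "complex_of_real (\<Sum>l<3 * Suc n. w n l) = complex_of_real W"
      using fourier[of 0 n] c0 by simp
    then show ?thesis by (simp only: of_real_eq_iff)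
  qed
  show ?thesis
  \<comment> \<open>The weights have total mass \<open>W\<close> and cannot be normalised if it is
    0. In that case all weights vanish, and so does every correlation, because its Fejer factor is
    non-zero for large n.\<close>
  proof (cases "W = 0")
    case True
    have "w n l = 0" if "l < 3 * Suc n" for n l
      using sum_nonneg_eq_0_iff[of "{..<3 * Suc n}" "w n"] w0 wsum[of n] True that by auto
    then have "corr f k * (1 - of_int \<bar>k\<bar> / of_nat (Suc (nat \<bar>k\<bar>))) = 0" for k
      using fourier[of k "nat \<bar>k\<bar>"] by simp
    moreover have "(1 - of_int \<bar>k\<bar> / of_nat (Suc (nat \<bar>k\<bar>)) :: complex) \<noteq> 0" for k :: int
    proof -
      have "(of_int \<bar>k\<bar> :: complex) = of_nat (nat \<bar>k\<bar>)" by simp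
      moreover have "(of_nat (Suc (nat \<bar>k\<bar>)) :: complex) - of_nat (nat \<bar>k\<bar>) = 1" by simp
      moreover have "(of_nat (Suc (nat \<bar>k\<bar>)) :: complex) \<noteq> 0" unfolding of_nat_eq_0_iff by simp
      ultimately show ?thesis by (metis diff_divide_distrib divide_self one_neq_zero divide_eq_0_iff)
    qed
    ultimately have c: "corr f k = 0" for k by (metis mult_eq_0_iff)
    interpret finite_measure "null_measure circle_borel" by (auto intro: finite_measureI)
    show ?thesis
      unfolding spectral_measure_def corr_def[symmetric] c
      by (intro exI[of _ "null_measure circle_borel"]) (auto intro: finite_measure_axioms simp: integral_null_measure)
  next
    case False
    then have Wp: "W > 0" by (simp add: W_def)
    define P where "P n = point_measure {..<3 * Suc n} (\<lambda>l. ennreal (w n l / W))" for n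
    have "prob_space (P n)" for n
      unfolding P_def
      by (rule prob_space_point_measure) (use w0 wsum[of n] Wp in \<open>simp_all add: sum_divide_distrib[symmetric] del: sum.lessThan_Suc\<close>)
    then interpret P: prob_space "P n" for n .
    define \<mu> where "\<mu> n = distr (P n) borel (\<theta> n)" for n
    have meas: "\<theta> n \<in> borel_measurable (P n)" for n by (simp add: P_def point_measure_def)
    have rd: "real_distribution (\<mu> n)" for n unfolding \<mu>_def by (rule P.real_distribution_distr[OF meas])
    have range: "\<theta> n l \<in> {-1<..7}" if "l < 3 * Suc n" for n l
    proof -
      have "\<theta> n l \<ge> 0" by (simp add: \<theta>_def)
      moreover have "\<theta> n l \<le> 2 * pi"
        using that by (simp add: \<theta>_def divide_simps)
      moreover have "2 * pi < 7" using pi_less_4 pi_approx by simp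
      ultimately show ?thesis by auto
    qed
    \<comment> \<open>All angles lie in one bounded interval, 7 being larger than 2 pi. Compactness
      is used on the real line; the weak limit is moved to the circle by \<open>cis\<close>
      afterwards.\<close>
    have tight: "tight \<mu>"
      unfolding tight_def
    proof safe
      fix e :: real assume e: "e > 0"
      have "measure (\<mu> n) {-1<..7} = 1" for n
      proof -
        have "measure (\<mu> n) {-1<..7} = measure (P n) (\<theta> n -` {-1<..7} \<inter> space (P n))"
          unfolding \<mu>_def by (rule measure_distr[OF meas]) simp
        also have "\<theta> n -` {-1<..7} \<inter> space (P n) = space (P n)"
          using range by (auto simp: P_def space_point_measure)
        finally show ?thesis by (simp add: P.prob_space)
      qed
      then show "\<exists>a b. a < b \<and> (\<forall>n. 1 - e < measure (\<mu> n) {a<..b})"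
        using e by (intro exI[of _ "-1"] exI[of _ 7]) auto
    qed (rule rd)
    have "strict_mono (id :: nat \<Rightarrow> nat)" by (simp add: strict_mono_def)
    from tight_imp_convergent_subsubsequence[OF tight this]
    obtain r \<mu>' where r: "strict_mono r" and rd': "real_distribution \<mu>'" and wc: "weak_conv_m (\<lambda>n. \<mu> (r n)) \<mu>'"
      by (auto simp: comp_def)
    interpret \<mu>': real_distribution \<mu>' by fact
    have int\<mu>: "(\<integral>t. cis (of_int k * t) \<partial>\<mu> n) = (1 - of_int \<bar>k\<bar> / of_nat (Suc n)) * corr f k / of_real W"
      if k: "\<bar>k\<bar> < int (Suc n)" for k n
    proof -
      have "(\<integral>t. cis (of_int k * t) \<partial>\<mu> n) = (\<integral>l. cis (of_int k * \<theta> n l) \<partial>P n)"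
        unfolding \<mu>_def by (rule integral_distr[OF meas]) (auto intro!: borel_measurable_continuous_onI continuous_intros)
      also have "\<dots> = (\<Sum>l<3 * Suc n. (w n l / W) *\<^sub>R cis (of_int k * \<theta> n l))"
        unfolding P_def using w0 Wp by (intro lebesgue_integral_point_measure_finite) auto
      also have "\<dots> = (\<Sum>l<3 * Suc n. complex_of_real (w n l) * cis (of_int k * \<theta> n l)) / of_real W"
        by (simp add: sum_divide_distrib scaleR_conv_of_real del: sum.lessThan_Suc)
      finally show ?thesis using fourier[OF k] by simp
    qed
    have lim: "(\<integral>t. cis (of_int k * t) \<partial>\<mu>') = corr f k / of_real W" for k
    proof (rule LIMSEQ_unique)
      show "(\<lambda>n. \<integral>t. cis (of_int k * t) \<partial>\<mu> (r n)) \<longlonglongrightarrow> (\<integral>t. cis (of_int k * t) \<partial>\<mu>')"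
      proof (rule weak_conv_imp_integral_bdd_continuous_conv[OF rd rd' wc, where B=1])
        have "continuous_on UNIV (\<lambda>t. cis (of_int k * t))" by (intro continuous_intros)
        then show "isCont (\<lambda>t. cis (of_int k * t)) t" for t by (simp add: continuous_on_eq_continuous_at)
      qed simp
      have "(\<lambda>n. (1 - of_int \<bar>k\<bar> * inverse (of_nat (Suc n))) * corr f k / of_real W) \<longlonglongrightarrow> (1 - of_int \<bar>k\<bar> * 0) * corr f k / of_real W"
        by (intro tendsto_divide tendsto_mult tendsto_diff tendsto_const LIMSEQ_Suc[OF lim_inverse_n]) (use Wp in simp)
      then have l: "(\<lambda>n. (1 - of_int \<bar>k\<bar> / of_nat (Suc n)) * corr f k / of_real W) \<longlonglongrightarrow> corr f k / of_real W"
        by (simp add: divide_inverse)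
      have "(\<lambda>n. (1 - of_int \<bar>k\<bar> / of_nat (Suc (r n))) * corr f k / of_real W) \<longlonglongrightarrow> corr f k / of_real W"
        using LIMSEQ_subseq_LIMSEQ[OF l r] by (simp add: comp_def)
      then show "(\<lambda>n. \<integral>t. cis (of_int k * t) \<partial>\<mu> (r n)) \<longlonglongrightarrow> corr f k / of_real W"
      proof (rule Lim_transform_eventually)
        show "\<forall>\<^sub>F n in sequentially. (1 - of_int \<bar>k\<bar> / of_nat (Suc (r n))) * corr f k / of_real W = (\<integral>t. cis (of_int k * t) \<partial>\<mu> (r n))"
        proof (rule eventually_sequentiallyI[of "nat \<bar>k\<bar>"])
          fix n assume "nat \<bar>k\<bar> \<le> n"
          then have "\<bar>k\<bar> < int (Suc (r n))" using seq_suble[OF r, of n] by linarith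
          then show "(1 - of_int \<bar>k\<bar> / of_nat (Suc (r n))) * corr f k / of_real W = (\<integral>t. cis (of_int k * t) \<partial>\<mu> (r n))"
            by (simp add: int\<mu>)
        qed
      qed
    qed
    have cis_m: "cis \<in> measurable \<mu>' circle_borel"
      unfolding circle_borel_def
      by (intro measurable_restrict_space2) (auto intro!: borel_measurable_continuous_onI continuous_intros simp: measurable_cong_sets[OF \<mu>'.events_eq_borel refl])
    define \<sigma> where "\<sigma> = density (distr \<mu>' circle_borel cis) (\<lambda>_. ennreal W)"
    interpret D: prob_space "distr \<mu>' circle_borel cis" by (rule \<mu>'.prob_space_distr[OF cis_m])
    have sets: "sets \<sigma> = sets circle_borel" by (simp add: \<sigma>_def)
    have fin: "finite_measure \<sigma>"
    proof (rule finite_measureI)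
      have "emeasure \<sigma> (space \<sigma>) = ennreal W * emeasure (distr \<mu>' circle_borel cis) (space (distr \<mu>' circle_borel cis))"
        unfolding \<sigma>_def space_density by (rule emeasure_density_const) (rule sets.top)
      then show "emeasure \<sigma> (space \<sigma>) \<noteq> \<infinity>" unfolding D.emeasure_space_1 by simp
    qed
    have "(\<integral>z. z powi k \<partial>\<sigma>) = corr f k" for k
    proof -
      have m: "(\<lambda>z. z powi k) \<in> borel_measurable circle_borel"
        by (rule circle_borel_measurable) (auto intro!: continuous_intros)
      have "(\<integral>z. z powi k \<partial>\<sigma>) = (\<integral>z. W *\<^sub>R (z powi k) \<partial>distr \<mu>' circle_borel cis)"
        unfolding \<sigma>_def using Wp m by (intro integral_density) auto
      also have "\<dots> = W *\<^sub>R (\<integral>t. cis t powi k \<partial>\<mu>')"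
        using integral_distr[OF cis_m m] by simp
      also have "\<dots> = corr f k" using lim[of k] Wp by (simp add: cis_power_int scaleR_conv_of_real)
      finally show ?thesis .
    qed
    then show ?thesis using fin sets by (auto simp: spectral_measure_def corr_def)
  qed
qed

text \<open>If v is close to the indicator of A, the norm of v(U) g measures \<nu> A. Split g into a
  combination of translates of f and a small remainder: on the first part v(U) is small because
  \<sigma> A = 0, on the second because the spectral measure of the remainder has its squared norm
  as total mass.\<close>

lemma spectral_domination:
  assumes cyc: "cyclic_vector M S f" and s: "spectral_measure M S f \<sigma>"
    and g: "g \<in> L2" and nu: "spectral_measure M S g \<nu>"
  shows "absolutely_continuous \<sigma> \<nu>"
  unfolding absolutely_continuous_def
proof
  fix A assume A: "A \<in> null_sets \<sigma>"
  have f: "f \<in> L2" using cyc by (simp add: cyclic_vector_iff)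
  have fin: "finite_measure \<sigma>" "finite_measure \<nu>" and sets: "sets \<sigma> = sets circle_borel" "sets \<nu> = sets circle_borel"
    using s nu by (auto simp: spectral_measure_def)
  interpret \<nu>: finite_measure \<nu> by fact
  have As: "A \<in> sets circle_borel" using A sets by auto
  have "sqrt (measure \<nu> A) \<le> 3 * e" if e: "e > 0" for e
  proof -
    have "g \<in> cyclic_space f" using cyc g by (auto simp: cyclic_vector_iff)
    then obtain F c where F: "finite F" "N (\<lambda>x. g x - comb F c f x) < e" using cyclic_spaceD[OF _ e] by blast
    define g1 where "g1 = (\<lambda>x. g x - comb F c f x)"
    have g1: "g1 \<in> L2" unfolding g1_def by (intro L2_diff g comb_L2 f)
    obtain \<nu>1 where nu1: "spectral_measure M S g1 \<nu>1" using spectral_measure_exists[OF g1] by blast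
    have fin1: "finite_measure \<nu>1" "sets \<nu>1 = sets circle_borel" using nu1 by (auto simp: spectral_measure_def)
    define C where "C = (\<Sum>k\<in>F. cmod (c k)) + 1"
    have C: "C > 0" by (simp add: C_def sum_nonneg add_nonneg_pos)
    \<comment> \<open>The combination with coefficients \<open>c\<close> may enlarge norms by the
      factor \<open>C - 1\<close>, so the accuracy on the circle must stay below \<open>e\<close>
      even after multiplication by \<open>C\<close>.\<close>
    define d where "d = min e (e / C)"
    have d: "d > 0" "d \<le> e" "C * d \<le> e" using e C by (auto simp: d_def min_def field_simps)
    obtain v where v: "v \<in> trigs" "\<forall>\<kappa>\<in>{\<sigma>, \<nu>, \<nu>1}. L2_seminorm \<kappa> (\<lambda>z. v z - indicator A z) < d"
      using trig_approx_indicator[of "{\<sigma>, \<nu>, \<nu>1}" A d] fin fin1 sets As d(1) by auto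
    obtain G b where G: "finite G" "\<And>z. z \<in> sphere 0 1 \<Longrightarrow> v z = trig G b z" using v(1) by (auto simp: trigs_def)
    have iL: "(\<lambda>z. indicator A z :: complex) \<in> L2_funs \<kappa>" and vL: "v \<in> L2_funs \<kappa>"
      and vN: "L2_seminorm \<kappa> v = L2_seminorm \<kappa> (trig G b)"
      and iN: "L2_seminorm \<kappa> (\<lambda>z. indicator A z) = sqrt (measure \<kappa> A)"
      if k: "finite_measure \<kappa>" "sets \<kappa> = sets circle_borel" for \<kappa>
    proof -
      interpret finite_measure \<kappa> by fact
      have sp: "space \<kappa> = sphere 0 1" using sets_eq_imp_space_eq[OF k(2)] by simp
      have [measurable]: "A \<in> sets \<kappa>" using As k by simp
      show "(\<lambda>z. indicator A z :: complex) \<in> L2_funs \<kappa>" by (intro L2_bounded[where B=1]) (auto simp: indicator_def)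
      show "v \<in> L2_funs \<kappa>" by (rule trigs_L2[OF v(1) k])
      show "L2_seminorm \<kappa> v = L2_seminorm \<kappa> (trig G b)" by (rule L2_seminorm_cong) (use G(2) sp in auto)
      have "(\<integral>z. (cmod (indicator A z))\<^sup>2 \<partial>\<kappa>) = (\<integral>z. indicator A z \<partial>\<kappa>)"
        by (intro Bochner_Integration.integral_cong) (auto simp: indicator_def)
      then show "L2_seminorm \<kappa> (\<lambda>z. indicator A z) = sqrt (measure \<kappa> A)" by (simp add: L2_seminorm_def)
    qed
    have tri: "L2_seminorm \<kappa> (trig G b) \<le> d + sqrt (measure \<kappa> A)" "sqrt (measure \<kappa> A) \<le> d + L2_seminorm \<kappa> (trig G b)"
      if k: "\<kappa> \<in> {\<sigma>, \<nu>, \<nu>1}" for \<kappa>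
    proof -
      have k': "finite_measure \<kappa>" "sets \<kappa> = sets circle_borel" using k fin fin1 sets by auto
      show "L2_seminorm \<kappa> (trig G b) \<le> d + sqrt (measure \<kappa> A)" "sqrt (measure \<kappa> A) \<le> d + L2_seminorm \<kappa> (trig G b)"
        using L2_seminorm_le_add_diff[OF iL[OF k'] vL[OF k']] L2_seminorm_le_add_diff[OF vL[OF k'] iL[OF k']] v(2) k
          L2_seminorm_minus_commute[of \<kappa> v] unfolding vN[OF k'] iN[OF k'] by fastforce+
    qed
    have split: "comb G b g x = comb G b g1 x + comb G b (comb F c f) x" for x
      by (simp add: comb_def[of G] g1_def sum.distrib[symmetric] algebra_simps)
    have "N (comb G b g) \<le> N (comb G b g1) + N (comb G b (comb F c f))"
      unfolding split[abs_def] by (intro L2_triangle comb_L2 g1 f)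
    moreover have "N (comb G b g1) \<le> d + e"
    proof -
      have "measure \<nu>1 A \<le> measure \<nu>1 (space \<nu>1)"
        using fin1 by (intro finite_measure.bounded_measure)
      also have "\<dots> = (N g1)\<^sup>2"
      proof -
        interpret n1: finite_measure \<nu>1 by fact
        have "complex_of_real (measure \<nu>1 (space \<nu>1)) = (\<integral>z. z powi 0 \<partial>\<nu>1)" by (simp add: scaleR_conv_of_real)
        also have "\<dots> = corr g1 0" using nu1 unfolding spectral_measure_def corr_def by blast
        also have "\<dots> = complex_of_real ((N g1)\<^sup>2)"
          using N_comb_square[OF g1, of "{0}" "\<lambda>_. 1"] by (simp add: comb_def[abs_def])
        finally show ?thesis by (simp only: of_real_eq_iff)
      qed
      finally have "sqrt (measure \<nu>1 A) \<le> N g1" by (simp add: real_le_lsqrt)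
      then show ?thesis
        using tri(1)[of \<nu>1] spectral_isometry[OF nu1 g1, of G b] F(2) by (simp add: g1_def)
    qed
    moreover have "N (comb G b (comb F c f)) \<le> (C - 1) * d"
    proof -
      have eq: "comb G b (comb F c f) = (\<lambda>x. comb G b (comb F c f) x)" by simp
      have "N (comb G b (comb F c f)) = N (comb F c (comb G b f))"
      proof (rule L2_seminorm_cong)
        fix x assume x: "x \<in> space M"
        have "comb G b (comb F c f) x = (\<Sum>k\<in>G. \<Sum>l\<in>F. b k * c l * f (pw (l + k) x))"
          unfolding comb_def[of G] by (intro sum.cong) (auto simp: comb_def sum_distrib_left pw_add[OF x] mult.assoc)
        also have "\<dots> = (\<Sum>l\<in>F. \<Sum>k\<in>G. b k * c l * f (pw (l + k) x))" by (rule sum.swap)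
        also have "\<dots> = comb F c (comb G b f) x"
          unfolding comb_def[of F] by (intro sum.cong) (auto simp: comb_def sum_distrib_left pw_add[OF x, symmetric] ac_simps)
        finally show "comb G b (comb F c f) x = comb F c (comb G b f) x" .
      qed
      also have "\<dots> \<le> (C - 1) * N (comb G b f)"
        using N_comb_le[OF comb_L2[OF f], of F c G b] by (simp add: C_def)
      also have "\<dots> \<le> (C - 1) * d"
      proof (rule mult_left_mono)
        have "measure \<sigma> A = 0" using A by (simp add: measure_def null_sets_def)
        then show "N (comb G b f) \<le> d" using tri(1)[of \<sigma>] spectral_isometry[OF s f, of G b] by simp
      qed (simp add: C_def sum_nonneg)
      finally show ?thesis .
    qed
    moreover have "sqrt (measure \<nu> A) \<le> d + N (comb G b g)"
      using tri(2)[of \<nu>] spectral_isometry[OF nu g, of G b] by simp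
    ultimately have "sqrt (measure \<nu> A) \<le> d + (d + e + (C - 1) * d)" by linarith
    also have "\<dots> = d + e + C * d" by (simp add: algebra_simps)
    finally show ?thesis using d by linarith
  qed
  from this[of "sqrt (measure \<nu> A) / 6"] have "sqrt (measure \<nu> A) \<le> 0"
    by (cases "measure \<nu> A = 0") (auto simp: zero_less_measure_iff field_simps)
  then have "measure \<nu> A = 0" by (simp add: measure_le_0_iff)
  then show "A \<in> null_sets \<nu>" using As sets by (auto simp: null_sets_def \<nu>.emeasure_eq_measure)
qed

end

section \<open>Lebesgue measure on the circle, rigidity and singularity\<close>

lemma circle_lebesgue_facts:
  shows finite_circle_lebesgue: "finite_measure circle_lebesgue"
    and sets_circle_lebesgue: "sets circle_lebesgue = sets circle_borel"
    and integral_circle_lebesgue_powi: "(\<integral>z. z powi k \<partial>circle_lebesgue) = (if k = 0 then 2 * pi else 0)"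
proof -
  let ?I = "restrict_space lborel {0..<2 * pi}"
  have m: "cis \<in> measurable ?I circle_borel"
    unfolding circle_borel_def
    by (intro measurable_restrict_space2) (auto intro!: measurable_restrict_space1 borel_measurable_continuous_onI continuous_intros)
  have mk: "(\<lambda>z. z powi k) \<in> borel_measurable circle_borel"
    by (rule circle_borel_measurable) (auto intro!: continuous_intros)
  interpret I: finite_measure ?I
    by (rule finite_measureI) (simp add: emeasure_restrict_space space_restrict_space)
  show "finite_measure circle_lebesgue" unfolding circle_lebesgue_def by (rule I.finite_measure_distr[OF m])
  show "sets circle_lebesgue = sets circle_borel" by (simp add: circle_lebesgue_def)
  have "(\<integral>z. z powi k \<partial>circle_lebesgue) = (\<integral>t. cis t powi k \<partial>?I)"
    unfolding circle_lebesgue_def by (rule integral_distr[OF m mk])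
  also have "\<dots> = (LINT t:{0..<2 * pi}|lborel. cis (of_int k * t))"
    by (simp add: integral_restrict_space set_lebesgue_integral_def cis_power_int)
  also have "\<dots> = (LINT t:{0..2 * pi}|lborel. cis (of_int k * t))"
  proof (rule set_integral_cong_set)
    have m: "(\<lambda>t. cis (of_int k * t)) \<in> borel_measurable lborel"
      by (auto intro!: borel_measurable_continuous_onI continuous_intros)
    show "set_borel_measurable lborel {0..2 * pi} (\<lambda>t. cis (of_int k * t))"
      "set_borel_measurable lborel {0..<2 * pi} (\<lambda>t. cis (of_int k * t))"
      unfolding set_borel_measurable_def using m by auto
    show "AE t in lborel. t \<in> {0..2 * pi} \<longleftrightarrow> t \<in> {0..<2 * pi}"
      using AE_lborel_singleton[of "2 * pi"] by eventually_elim auto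
  qed
  also have "\<dots> = (if k = 0 then 2 * pi else 0)"
  proof (cases "k = 0")
    case True
    then show ?thesis by (simp add: set_lebesgue_integral_def scaleR_conv_of_real)
  next
    case False
    define F where "F t = cis (of_int k * t) / (\<i> * of_int k)" for t
    have "(F has_vector_derivative cis (of_int k * t)) (at t within {0..2 * pi})" for t
      unfolding F_def cis_conv_exp using False
      by (auto intro!: derivative_eq_intros has_vector_derivative_real_field simp: field_simps)
    then have "(LBINT t. indicator {0..2 * pi} t *\<^sub>R cis (of_int k * t)) = F (2 * pi) - F 0"
      by (intro integral_FTC_atLeastAtMost) (auto intro!: continuous_intros)
    also have "F (2 * pi) = F 0"
    proof -
      have "cis (of_int k * (2 * pi)) = 1" using cos_int_2pin[of k] sin_int_2pin[of k] by (simp add: complex_eq_iff mult.commute)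
      then show ?thesis by (simp add: F_def)
    qed
    finally show ?thesis using False by (simp add: set_lebesgue_integral_def)
  qed
  finally show "(\<integral>z. z powi k \<partial>circle_lebesgue) = (if k = 0 then 2 * pi else 0)" .
qed

text \<open>Parseval's identity; the factor is the total mass 2 pi of the unnormalised
  measure.\<close>

lemma circle_lebesgue_trig:
  assumes F: "finite F"
  shows "(L2_seminorm circle_lebesgue (trig F c))\<^sup>2 = 2 * pi * (\<Sum>k\<in>F. (cmod (c k))\<^sup>2)"
proof -
  note fin = finite_circle_lebesgue sets_circle_lebesgue
  have sp: "space circle_lebesgue = sphere 0 1" using sets_eq_imp_space_eq[OF fin(2)] by simp
  have "complex_of_real ((L2_seminorm circle_lebesgue (trig F c))\<^sup>2) = (\<integral>z. complex_of_real ((cmod (trig F c z))\<^sup>2) \<partial>circle_lebesgue)"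
    unfolding L2_seminorm_square by (rule integral_complex_of_real[symmetric])
  also have "\<dots> = (\<integral>z. (\<Sum>k\<in>F. \<Sum>l\<in>F. c k * cnj (c l) * z powi (k - l)) \<partial>circle_lebesgue)"
    by (rule Bochner_Integration.integral_cong) (simp_all only: sp trig_norm_square refl)
  also have "\<dots> = (\<Sum>k\<in>F. \<Sum>l\<in>F. c k * cnj (c l) * (if k - l = 0 then 2 * pi else 0))"
    using integrable_powi[OF fin] by (simp add: integral_circle_lebesgue_powi)
  also have "\<dots> = (\<Sum>k\<in>F. c k * cnj (c k) * (2 * pi))"
  proof (rule sum.cong[OF refl])
    fix k assume "k \<in> F"
    have "(\<Sum>l\<in>F. c k * cnj (c l) * (if k - l = 0 then 2 * pi else 0)) = (\<Sum>l\<in>F. if l = k then c k * cnj (c k) * (2 * pi) else 0)"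
      by (intro sum.cong) auto
    then show "(\<Sum>l\<in>F. c k * cnj (c l) * (if k - l = 0 then 2 * pi else 0)) = c k * cnj (c k) * (2 * pi)"
      using F \<open>k \<in> F\<close> by simp
  qed
  also have "\<dots> = complex_of_real (2 * pi * (\<Sum>k\<in>F. (cmod (c k))\<^sup>2))"
    by (simp only: complex_norm_square[symmetric] of_real_mult of_real_sum sum_distrib_left of_real_numeral mult.commute)
  finally show ?thesis by (simp only: of_real_eq_iff)
qed

text \<open>Averages of the functions z^(h_j) along rigid times h_j separate the two measures. They
  tend to 1 in L2 of \<sigma>, since U^(h_j) f is close to f, and to 0 in L2 of Lebesgue measure,
  since distinct powers are orthogonal. Along a common subsequence both limits hold almost
  everywhere.\<close>

lemma (in automorphism_space) singular_of_rigid: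
  fixes H :: "nat \<Rightarrow> int"
  assumes s: "spectral_measure M S f \<sigma>" and f: "f \<in> L2"
    and H: "filterlim H at_top sequentially" and rigid: "(\<lambda>n. N (\<lambda>x. U (H n) f x - f x)) \<longlonglongrightarrow> 0"
  shows "mutually_singular \<sigma> circle_lebesgue"
proof -
  have fin: "finite_measure \<sigma>" "sets \<sigma> = sets circle_borel" using s by (auto simp: spectral_measure_def)
  note finl = finite_circle_lebesgue sets_circle_lebesgue
  have sp: "space \<sigma> = sphere 0 1" "space circle_lebesgue = sphere 0 1"
    using sets_eq_imp_space_eq[OF fin(2)] sets_eq_imp_space_eq[OF finl(2)] by simp_all
  \<comment> \<open>Extraction of strictly increasing times with errors (1/2)^n: the errors become
    summable, and the exponents become distinct, as orthogonality demands.\<close>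
  have step: "\<exists>h. h > a \<and> N (\<lambda>x. U h f x - f x) \<le> (1/2) ^ n" for a :: int and n :: nat
  proof -
    have "\<forall>\<^sub>F m in sequentially. a < H m"
      using filterlim_at_top[THEN iffD1, rule_format, OF H, of "a + 1"] by eventually_elim simp
    moreover have "\<forall>\<^sub>F m in sequentially. N (\<lambda>x. U (H m) f x - f x) < (1/2) ^ n"
      using rigid by (rule order_tendstoD) simp
    ultimately have "\<forall>\<^sub>F m in sequentially. a < H m \<and> N (\<lambda>x. U (H m) f x - f x) < (1/2) ^ n" by eventually_elim auto
    then obtain m where "a < H m \<and> N (\<lambda>x. U (H m) f x - f x) < (1/2) ^ n" by (auto simp: eventually_sequentially)
    then show ?thesis by (intro exI[of _ "H m"]) auto
  qed
  have "\<exists>h. \<forall>n. N (\<lambda>x. U (h n) f x - f x) \<le> (1/2) ^ n \<and> (h n :: int) < h (Suc n)"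
    by (rule dependent_nat_choice) (use step in blast)+
  then obtain h where h: "\<And>n. N (\<lambda>x. U (h n) f x - f x) \<le> (1/2) ^ n" "\<And>n. h n < h (Suc n)" by blast
  have "strict_mono h" by (rule strict_monoI_Suc) (fact h(2))
  then have inj: "inj_on h A" for A by (rule inj_on_subset[OF strict_mono_imp_inj_on subset_UNIV])
  define g where "g n = trig (h ` {..n}) (\<lambda>_. 1 / of_nat (Suc n))" for n
  have g: "g n z = (\<Sum>j\<le>n. z powi h j) / of_nat (Suc n)" for n z
    by (simp add: g_def trig_def sum.reindex[OF inj] sum_divide_distrib)
  have gt: "g n \<in> trigs" for n by (auto simp: g_def trigs_def intro!: exI[of _ "h ` {..n}"])
  have gL: "g n \<in> L2_funs \<sigma>" "g n \<in> L2_funs circle_lebesgue" "(\<lambda>z. g n z - 1) \<in> L2_funs \<sigma>" for n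
    using trigs_L2[OF gt fin] trigs_L2[OF gt finl] trigs_L2[OF trigs_diff[OF gt trigs_const[of 1]] fin] by auto
  have lebesgue: "(\<integral>z. (cmod (g n z))\<^sup>2 \<partial>circle_lebesgue) = 2 * pi / real (Suc n)" for n
  proof -
    have "(\<integral>z. (cmod (g n z))\<^sup>2 \<partial>circle_lebesgue) = 2 * pi * (\<Sum>k\<in>h ` {..n}. (cmod (1 / of_nat (Suc n)))\<^sup>2)"
      unfolding L2_seminorm_square[symmetric] g_def by (rule circle_lebesgue_trig) simp
    also have "(\<Sum>k\<in>h ` {..n}. (cmod (1 / of_nat (Suc n)))\<^sup>2) = real (Suc n) * (1 / real (Suc n))\<^sup>2"
      by (simp add: card_image[OF inj] norm_divide del: of_nat_Suc)
    finally show ?thesis by (simp add: power2_eq_square del: of_nat_Suc)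
  qed
  have sigma: "L2_seminorm \<sigma> (\<lambda>z. g n z - 1) \<le> 2 / real (Suc n)" for n
  proof -
    have pL: "(\<lambda>z. z powi h j - 1) \<in> L2_funs \<sigma>" for j
      using trigs_L2[OF trigs_diff[OF trigs_monom[of 1 "h j"] trigs_const[of 1]] fin] by simp
    have pN: "L2_seminorm \<sigma> (\<lambda>z. z powi h j - 1) \<le> (1/2) ^ j" for j
    \<comment> \<open>For h_j = 0 the exponents h_j and 0 coincide, and the coefficients
      \<open>c\<close> used below would not describe z^(h_j) - 1.\<close>
    proof (cases "h j = 0")
      case False
      define c where "c k = (if k = 0 then -1 else 1 :: complex)" for k :: int
      have "L2_seminorm \<sigma> (\<lambda>z. z powi h j - 1) = L2_seminorm \<sigma> (trig {h j, 0} c)"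
        by (rule L2_seminorm_cong) (use False in \<open>simp add: trig_def c_def\<close>)
      also have "\<dots> = N (comb {h j, 0} c f)" by (rule spectral_isometry[OF s f])
      also have "\<dots> = N (\<lambda>x. U (h j) f x - f x)"
        by (rule L2_seminorm_cong) (use False in \<open>simp add: comb_def c_def\<close>)
      finally show ?thesis using h(1) by simp
    qed (simp add: L2_seminorm_def)
    have "(\<lambda>z. g n z - 1) = (\<lambda>z. (1 / of_nat (Suc n)) * (\<Sum>j\<le>n. z powi h j - 1))"
      by (simp add: fun_eq_iff g sum_subtractf diff_divide_distrib del: of_nat_Suc)
    then have "L2_seminorm \<sigma> (\<lambda>z. g n z - 1) = (1 / real (Suc n)) * L2_seminorm \<sigma> (\<lambda>z. \<Sum>j\<le>n. z powi h j - 1)"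
      by (simp only: L2_seminorm_cmult norm_divide norm_one norm_of_nat)
    also have "\<dots> \<le> (1 / real (Suc n)) * (\<Sum>j\<le>n. (1/2) ^ j)"
      by (intro mult_left_mono order_trans[OF L2_sum(2)] sum_mono pL pN) simp
    also have "\<dots> \<le> (1 / real (Suc n)) * 2"
    proof (rule mult_left_mono)
      have "(\<Sum>j<Suc n. (1/2::real) ^ j) = 2 - 2 * (1/2) ^ Suc n" by (subst sum_gp_strict) simp
      then show "(\<Sum>j\<le>n. (1/2) ^ j) \<le> (2::real)" unfolding lessThan_Suc_atMost by (simp del: power_Suc)
    qed simp
    finally show ?thesis by simp
  qed
  have "(\<lambda>n. \<integral>z. norm ((cmod (g n z - 1))\<^sup>2) \<partial>\<sigma>) \<longlonglongrightarrow> 0"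
  proof (rule tendsto_sandwich[where f="\<lambda>_. 0" and h="\<lambda>n. (2 * inverse (real (Suc n)))\<^sup>2"])
    have "(\<lambda>n. (2 * inverse (real (Suc n)))\<^sup>2) \<longlonglongrightarrow> (2 * 0)\<^sup>2"
      by (intro tendsto_intros LIMSEQ_inverse_real_of_nat)
    then show "(\<lambda>n. (2 * inverse (real (Suc n)))\<^sup>2) \<longlonglongrightarrow> 0" by simp
    show "\<forall>\<^sub>F n in sequentially. (\<integral>z. norm ((cmod (g n z - 1))\<^sup>2) \<partial>\<sigma>) \<le> (2 * inverse (real (Suc n)))\<^sup>2"
      using power_mono[OF sigma L2_seminorm_nonneg, where n=2]
      by (intro always_eventually allI) (simp add: L2_seminorm_square divide_inverse del: of_nat_Suc)
  qed auto
  from tendsto_L1_AE_subseq[OF _ this] obtain r where r: "strict_mono r"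
    "AE z in \<sigma>. (\<lambda>n. (cmod (g (r n) z - 1))\<^sup>2) \<longlonglongrightarrow> 0"
    using L2_funsD(2)[OF gL(3)] by blast
  have "(\<lambda>n. \<integral>z. norm ((cmod (g (r n) z))\<^sup>2) \<partial>circle_lebesgue) \<longlonglongrightarrow> 0"
  proof -
    have "(\<lambda>n. 2 * pi * inverse (real (Suc n))) \<longlonglongrightarrow> 2 * pi * 0"
      by (intro tendsto_intros LIMSEQ_inverse_real_of_nat)
    then have "(\<lambda>n. \<integral>z. (cmod (g n z))\<^sup>2 \<partial>circle_lebesgue) \<longlonglongrightarrow> 0"
      unfolding lebesgue by (simp add: divide_inverse)
    from LIMSEQ_subseq_LIMSEQ[OF this r(1)] show ?thesis by (simp add: comp_def)
  qed
  from tendsto_L1_AE_subseq[OF _ this] obtain r' where r': "strict_mono r'"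
    "AE z in circle_lebesgue. (\<lambda>n. (cmod (g (r (r' n)) z))\<^sup>2) \<longlonglongrightarrow> 0"
    using L2_funsD(2)[OF gL(2)] by blast
  have gm: "(\<lambda>z. (cmod (g n z - 1))\<^sup>2) \<in> borel_measurable circle_borel" for n
    using L2_funsD(1)[OF trigs_L2[OF trigs_diff[OF gt[of n] trigs_const[of 1]] finl]]
    by (simp add: measurable_cong_sets[OF sets_circle_lebesgue refl])
  define A where "A = {z \<in> space circle_borel. \<not> (\<lambda>n. (cmod (g (r n) z - 1))\<^sup>2) \<longlonglongrightarrow> 0}"
  have A: "A \<in> sets circle_borel"
  proof -
    have [measurable]: "(\<lambda>z. (cmod (g (r n) z - 1))\<^sup>2) \<in> borel_measurable circle_borel" for n by (rule gm)
    show ?thesis unfolding A_def by measurable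
  qed
  have "A \<in> null_sets \<sigma>"
  proof (rule AE_iff_null_sets[THEN iffD2])
    show "A \<in> sets \<sigma>" using A fin by simp
    show "AE z in \<sigma>. z \<notin> A" using r(2) by eventually_elim (simp add: A_def)
  qed
  moreover have "space circle_lebesgue - A \<in> null_sets circle_lebesgue"
  proof (rule AE_iff_null_sets[THEN iffD2])
    show "space circle_lebesgue - A \<in> sets circle_lebesgue" using A finl(2) by auto
    show "AE z in circle_lebesgue. z \<notin> space circle_lebesgue - A"
      using r'(2)
    proof eventually_elim
      case (elim z)
      have "z \<in> A" if z: "z \<in> sphere 0 1"
      proof (rule ccontr)
        assume "z \<notin> A"
        then have "(\<lambda>n. (cmod (g (r n) z - 1))\<^sup>2) \<longlonglongrightarrow> 0" using z by (simp add: A_def)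
        then have "(\<lambda>n. cmod (g (r n) z - 1)) \<longlonglongrightarrow> 0" using tendsto_real_sqrt[of "\<lambda>n. (cmod (g (r n) z - 1))\<^sup>2" 0] by simp
        then have "(\<lambda>n. g (r n) z - 1) \<longlonglongrightarrow> 0" by (simp add: tendsto_norm_zero_iff)
        from LIMSEQ_subseq_LIMSEQ[OF this r'(1)] have 1: "(\<lambda>n. g (r (r' n)) z - 1) \<longlonglongrightarrow> 0" by (simp add: comp_def)
        have "(\<lambda>n. cmod (g (r (r' n)) z)) \<longlonglongrightarrow> 0" using tendsto_real_sqrt[OF elim] by simp
        then have "(\<lambda>n. g (r (r' n)) z) \<longlonglongrightarrow> 0" by (simp add: tendsto_norm_zero_iff)
        then have "(\<lambda>n. g (r (r' n)) z - 1) \<longlonglongrightarrow> 0 - 1" by (intro tendsto_intros)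
        from LIMSEQ_unique[OF this 1] show False by simp
      qed
      then show ?case by (auto simp: sp)
    qed
  qed
  ultimately show ?thesis unfolding mutually_singular_def by blast
qed

text \<open>The spectral measure of a cyclic vector dominates all others and hence represents the
  maximal spectral type. Rigidity is applied to this one vector.\<close>

proposition (in automorphism_space) singular_spectrumI:
  assumes "simple_spectrum M S" and "filterlim H at_top sequentially"
    and "\<And>f. f \<in> L2 \<Longrightarrow> (\<lambda>n::nat. N (\<lambda>x. U (H n) f x - f x)) \<longlonglongrightarrow> 0"
  shows "singular_spectrum M S"
proof -
  obtain f where cyc: "cyclic_vector M S f" using assms(1) by (auto simp: simple_spectrum_def)
  then have f: "f \<in> L2" by (simp add: cyclic_vector_iff)
  obtain \<sigma> where s: "spectral_measure M S f \<sigma>" using spectral_measure_exists[OF f] by blast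
  have "maximal_spectral_type M S \<sigma>"
    unfolding maximal_spectral_type_def using f s spectral_domination[OF cyc s] by blast
  then show ?thesis
    unfolding singular_spectrum_def using singular_of_rigid[OF s f assms(2) assms(3)[OF f]] by blast
qed

section \<open>Isomorphic automorphisms\<close>

text \<open>It occurs in two roles: as a map of the odometer that conjugates the first automorphism
  to the second on the same space, and as an injection that carries both automorphisms to a measure
  on the reals.\<close>

locale measure_isomorphism = automorphism_space +
  fixes N :: "'b measure" and f :: "'a \<Rightarrow> 'b"
  assumes f_bij: "bij_betw f (space M) (space N)"
    and f_measurable [measurable]: "f \<in> measurable M N"
    and fi_measurable [measurable]: "inv_into (space M) f \<in> measurable N M"
    and distr_f: "distr M N f = N"
begin

abbreviation "fi \<equiv> inv_into (space M) f"
definition T where "T y = f (S (fi y))"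

lemma f_space: "x \<in> space M \<Longrightarrow> f x \<in> space N" using f_bij bij_betwE by blast
lemma fi_space: "y \<in> space N \<Longrightarrow> fi y \<in> space M"
  using f_bij by (metis bij_betw_imp_surj_on inv_into_into)
lemma f_fi: "y \<in> space N \<Longrightarrow> f (fi y) = y"
  using f_bij by (metis bij_betw_imp_surj_on f_inv_into_f)
lemma fi_f: "x \<in> space M \<Longrightarrow> fi (f x) = x"
  using f_bij by (metis bij_betw_imp_inj_on inv_into_f_f)

lemma distr_fi: "distr N M fi = M"
proof -
  have "M = distr M M (\<lambda>x. x)" by (simp add: distr_id2)
  also have "\<dots> = distr M M (fi \<circ> f)"
    by (intro distr_cong) (auto simp: fi_f)
  also have "\<dots> = distr (distr M N f) M fi"
    by (rule distr_distr[symmetric]) measurable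
  finally show ?thesis by (simp add: distr_f)
qed

lemma integral_f:
  fixes g :: "'b \<Rightarrow> 'c::{banach, second_countable_topology}"
  assumes "g \<in> borel_measurable N"
  shows "(\<integral>y. g y \<partial>N) = (\<integral>x. g (f x) \<partial>M)"
  using integral_distr[OF f_measurable assms] by (simp add: distr_f)

lemma L2_comp_f: "g \<in> L2_funs N \<Longrightarrow> (\<lambda>x. g (f x)) \<in> L2_funs M"
  using integrable_distr[OF f_measurable, of "\<lambda>x. (cmod (g x))\<^sup>2"]
  by (auto simp: L2_funs_def distr_f intro: measurable_compose[OF f_measurable])

lemma L2_comp_fi: "g \<in> L2_funs M \<Longrightarrow> (\<lambda>y. g (fi y)) \<in> L2_funs N"
  using integrable_distr[OF fi_measurable, of "\<lambda>x. (cmod (g x))\<^sup>2"]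
  by (auto simp: L2_funs_def distr_fi intro: measurable_compose[OF fi_measurable])

lemma L2_seminorm_comp_f:
  assumes "g \<in> L2_funs N"
  shows "L2_seminorm N g = L2_seminorm M (\<lambda>x. g (f x))"
  unfolding L2_seminorm_def using L2_funsD(1)[OF assms] by (subst integral_f) simp_all

lemma T_f: "x \<in> space M \<Longrightarrow> T (f x) = f (S x)" by (simp add: T_def fi_f)

lemma T_inverse: "y \<in> space N \<Longrightarrow> inv_into (space N) T y = f (Si (fi y))"
  and T_bij: "bij_betw T (space N) (space N)"
proof -
  have T1: "T (f (Si (fi y))) = y" if "y \<in> space N" for y
    using that by (simp add: T_def fi_f Si_space fi_space S_Si f_fi)
  have T2: "f (Si (fi (T y))) = y" if "y \<in> space N" for y
    using that by (simp add: T_def fi_f S_space fi_space Si_S f_fi)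
  have sp: "T y \<in> space N" "f (Si (fi y)) \<in> space N" if "y \<in> space N" for y
    using that by (simp_all add: T_def f_space S_space fi_space Si_space)
  show bij: "bij_betw T (space N) (space N)"
    by (rule bij_betwI[where g="\<lambda>y. f (Si (fi y))"]) (auto simp: T1 T2 sp)
  show "inv_into (space N) T y = f (Si (fi y))" if "y \<in> space N"
    using T1[OF that] sp(2)[OF that] bij by (metis bij_betw_imp_inj_on inv_into_f_f)
qed

lemma T_automorphism: "automorphism N T"
proof -
  note [measurable] = S_measurable Si_measurable
  have T: "T = f \<circ> (S \<circ> fi)" by (auto simp: T_def)
  have Tm: "T \<in> measurable N N" unfolding T by measurable
  have "(\<lambda>y. f (Si (fi y))) \<in> measurable N N" by measurable
  then have Tim: "inv_into (space N) T \<in> measurable N N"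
    by (subst measurable_cong[where g="\<lambda>y. f (Si (fi y))"]) (simp_all add: T_inverse)
  have "distr N N T = distr (distr (distr N M fi) M S) N f"
    by (simp add: distr_distr T comp_assoc)
  then show ?thesis using T_bij Tm Tim by (simp add: automorphism_def distr_fi distr_S distr_f)
qed

lemma prob_space_N: "prob_space N"
  using prob_space_distr[OF f_measurable] by (simp add: distr_f)

lemma automorphism_space_T: "automorphism_space N T"
  using prob_space_N T_automorphism by (simp add: automorphism_space_def automorphism_space_axioms_def)

lemma T_power:
  assumes x: "x \<in> space M"
  shows "aut_power N T k (f x) = f (pw k x)"
proof -
  interpret T: automorphism_space N T by (rule automorphism_space_T)
  show ?thesis
  proof (induction k rule: int_induct[where k=0])
    case (step1 i)
    then show ?case
      using T.pw_plus1[OF f_space[OF x], of i] pw_plus1[OF x, of i] by (simp add: T_f pw_space[OF x])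
  next
    case (step2 i)
    then show ?case
      using T.pw_minus1[OF f_space[OF x], of i] pw_minus1[OF x, of i]
      by (simp add: T_inverse f_space fi_f pw_space[OF x])
  qed simp
qed

lemma T_simple_spectrum:
  assumes "simple_spectrum M S"
  shows "simple_spectrum N T"
proof -
  interpret T: automorphism_space N T by (rule automorphism_space_T)
  obtain h where h: "h \<in> L2" "L2 \<subseteq> cyclic_space h"
    using assms by (auto simp: simple_spectrum_def cyclic_vector_iff)
  define h' where "h' y = h (fi y)" for y
  have h': "h' \<in> L2_funs N" unfolding h'_def by (rule L2_comp_fi[OF h(1)])
  have "g \<in> T.cyclic_space h'" if g: "g \<in> L2_funs N" for g
    unfolding T.cyclic_space_def
  proof (safe)
    fix e :: real assume e: "e > 0"
    have "(\<lambda>x. g (f x)) \<in> cyclic_space h" using h(2) L2_comp_f[OF g] by blast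
    then obtain F c where F: "finite F" "L2_seminorm M (\<lambda>x. g (f x) - comb F c h x) < e" using cyclic_spaceD[OF _ e] by blast
    have "L2_seminorm N (\<lambda>y. g y - T.comb F c h' y) = L2_seminorm M (\<lambda>x. g (f x) - T.comb F c h' (f x))"
      by (intro L2_seminorm_comp_f L2_diff g T.comb_L2 h')
    also have "\<dots> = L2_seminorm M (\<lambda>x. g (f x) - comb F c h x)"
      by (intro L2_seminorm_cong) (simp add: comb_def T.comb_def T_power h'_def fi_f pw_space)
    finally have "L2_seminorm N (\<lambda>y. g y - T.comb F c h' y) < e" using F(2) by simp
    then show "\<exists>F c. finite F \<and> L2_seminorm N (\<lambda>y. g y - T.comb F c h' y) < e" using F(1) by blast
  qed (fact g)
  then show ?thesis using h' by (auto simp: simple_spectrum_def T.cyclic_vector_iff)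
qed

lemma T_spectral_measure:
  assumes g: "g \<in> L2_funs N"
  shows "spectral_measure N T g \<sigma> \<longleftrightarrow> spectral_measure M S (\<lambda>x. g (f x)) \<sigma>"
proof -
  interpret T: automorphism_space N T by (rule automorphism_space_T)
  have "L2_inner N (koopman (aut_power N T k) g) g = L2_inner M (U k (\<lambda>x. g (f x))) (\<lambda>x. g (f x))" for k
  proof -
    have "(\<lambda>y. koopman (aut_power N T k) g y * cnj (g y)) \<in> borel_measurable N"
      by (rule borel_measurable_integrable[OF L2_inner_integrable[OF T.U_L2[OF g] g]])
    from integral_f[OF this] show ?thesis
      unfolding L2_inner_def by (auto intro!: Bochner_Integration.integral_cong simp: T_power)
  qed
  then show ?thesis by (simp add: spectral_measure_def)
qed

lemma T_singular_spectrum: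
  assumes "singular_spectrum M S"
  shows "singular_spectrum N T"
proof -
  obtain \<sigma> h where s: "mutually_singular \<sigma> circle_lebesgue" "h \<in> L2" "spectral_measure M S h \<sigma>"
    "\<And>g \<nu>. g \<in> L2 \<Longrightarrow> spectral_measure M S g \<nu> \<Longrightarrow> absolutely_continuous \<sigma> \<nu>"
    using assms by (auto simp: singular_spectrum_def maximal_spectral_type_def)
  have h': "(\<lambda>y. h (fi y)) \<in> L2_funs N" by (rule L2_comp_fi[OF s(2)])
  have "L2_inner M (U k (\<lambda>x. h (fi (f x)))) (\<lambda>x. h (fi (f x))) = L2_inner M (U k h) h" for k
    unfolding L2_inner_def by (intro Bochner_Integration.integral_cong) (auto simp: fi_f pw_space)
  then have "spectral_measure N T (\<lambda>y. h (fi y)) \<sigma>"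
    using s(3) unfolding T_spectral_measure[OF h'] by (simp add: spectral_measure_def)
  moreover have "absolutely_continuous \<sigma> \<nu>" if "g \<in> L2_funs N" "spectral_measure N T g \<nu>" for g \<nu>
    using s(4)[OF L2_comp_f[OF that(1)]] that by (simp add: T_spectral_measure)
  ultimately have "maximal_spectral_type N T \<sigma>" unfolding maximal_spectral_type_def using h' by blast
  then show ?thesis using s(1) by (auto simp: singular_spectrum_def)
qed

lemma T_power_image:
  assumes "C \<subseteq> space M"
  shows "aut_power N T k ` (f ` C) = f ` (pw k ` C)"
  unfolding image_image using assms by (intro image_cong refl T_power) auto

lemma measure_image:
  assumes "A \<in> sets M"
  shows "measure N (f ` A) = measure M A" "f ` A \<in> sets N"
proof -
  have A: "A \<subseteq> space M" using assms sets.sets_into_space by blast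
  have im: "f ` A = fi -` A \<inter> space N"
    proof (intro set_eqI iffI)
    fix y assume "y \<in> fi -` A \<inter> space N"
    then show "y \<in> f ` A" using f_fi[of y] by (intro image_eqI[of _ _ "fi y"]) auto
  qed (use A f_space fi_f in auto)
  show "f ` A \<in> sets N" unfolding im using assms by (rule measurable_sets[OF fi_measurable])
  have "measure M A = measure (distr N M fi) A" by (simp add: distr_fi)
  also have "\<dots> = measure N (f ` A)" unfolding im using assms by (rule measure_distr[OF fi_measurable])
  finally show "measure N (f ` A) = measure M A" ..
qed

end

section \<open>Standardness\<close>

text \<open>\<open>F\<close> pushes Lebesgue measure forward to \<open>N\<close> and has the
  measurable left inverse \<open>G\<close>. The points with F (G x) different from x form a null set
  because no value of \<open>F\<close> on [0, 1) is among them. The remaining work is the passage to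
  the completed sigma-algebras.\<close>

lemma standard_prob_spaceI:
  fixes N :: "'b measure" and F :: "real \<Rightarrow> 'b" and G :: "'b \<Rightarrow> real"
  defines "I \<equiv> restrict_space lborel {0..<1::real}"
  assumes "prob_space N" and F: "F \<in> measurable I N" and G: "G \<in> borel_measurable N"
    and GF: "\<And>t. t \<in> {0..<1} \<Longrightarrow> G (F t) = t" and distr: "distr I N F = N"
    and FG: "{x \<in> space N. F (G x) = x} \<in> sets N"
  shows "standard_prob_space N"
proof -
  interpret prob_space N by fact
  have spI: "space I = {0..<1}" by (simp add: I_def space_restrict_space)
  have em: "emeasure N X = emeasure lborel {t \<in> {0..<1}. F t \<in> X}" and emm: "{t \<in> {0..<1}. F t \<in> X} \<in> sets lborel" if X: "X \<in> sets N" for X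
  proof -
    have *: "F -` X \<inter> space I = {t \<in> {0..<1}. F t \<in> X}" by (auto simp: spI)
    have s: "F -` X \<inter> space I \<in> sets I" using measurable_sets[OF F X] .
    then have "F -` X \<inter> space I \<in> sets lborel"
      using sets_restrict_space_iff[of "{0..<1::real}" lborel "F -` X \<inter> space I"] by (simp add: I_def)
    then show "{t \<in> {0..<1}. F t \<in> X} \<in> sets lborel" unfolding * .
    have "emeasure N X = emeasure I (F -` X \<inter> space I)" using emeasure_distr[OF F X] by (simp add: distr)
    also have "\<dots> = emeasure I {t \<in> {0..<1}. F t \<in> X}" by (simp only: *)
    also have "\<dots> = emeasure lborel {t \<in> {0..<1}. F t \<in> X}"
      unfolding I_def by (rule emeasure_restrict_space) auto
    finally show "emeasure N X = emeasure lborel {t \<in> {0..<1}. F t \<in> X}" .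
  qed
  define A where "A = space N - {x \<in> space N. F (G x) = x \<and> G x \<in> {0..<1}}"
  have "{x \<in> space N. F (G x) = x} \<inter> (G -` {0..<1} \<inter> space N) \<in> sets N"
    by (rule sets.Int[OF FG measurable_sets[OF G]]) simp
  also have "{x \<in> space N. F (G x) = x} \<inter> (G -` {0..<1} \<inter> space N) = {x \<in> space N. F (G x) = x \<and> G x \<in> {0..<1}}" by auto
  finally have A: "A \<in> sets N" by (simp add: A_def)
  have Fsp: "F t \<in> space N" if "t \<in> {0..<1}" for t using measurable_space[OF F, of t] that by (simp add: spI)
  have FA: "F t \<notin> A" if "t \<in> {0..<1}" for t using GF[OF that] Fsp[OF that] that by (simp add: A_def)
  then have empty: "{t \<in> {0..<1}. F t \<in> A} = {}" by auto
  have "emeasure N A = 0" unfolding em[OF A] empty by simp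
  then have A0: "A \<in> null_sets N" using A by (simp add: null_sets_def)
  have spA: "space N - A = {x \<in> space N. F (G x) = x \<and> G x \<in> {0..<1}}" by (auto simp: A_def)
  let ?L = "lebesgue_on {0..1::real}"
  \<comment> \<open>The closed interval of the definition is reduced to [0, 1) by discarding its
    right endpoint.\<close>
  have B: "{1::real} \<in> null_sets ?L"
    by (simp add: null_sets_restrict_space)
  define N' where "N' = restrict_space (completion N) (space (completion N) - A)"
  define L' where "L' = restrict_space ?L (space ?L - {1})"
  have spL': "space L' = {0..<1}" by (auto simp: L'_def space_restrict_space)
  have setsL': "X \<in> sets L' \<longleftrightarrow> X \<in> sets lebesgue \<and> X \<subseteq> {0..<1}" for X
  proof -
    have "{0..1} \<inter> ({0..1} - {1}) = {0..<1::real}" by auto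
    then have "L' = lebesgue_on {0..<1}" unfolding L'_def by (simp add: restrict_restrict_space)
    then show ?thesis by (simp add: sets_restrict_space_iff conj_commute)
  qed
  have emL': "emeasure L' X = emeasure lebesgue X" if "X \<in> sets L'" for X
  proof -
    have "{0..1} \<inter> ({0..1} - {1}) = {0..<1::real}" by auto
    then have "L' = lebesgue_on {0..<1}" unfolding L'_def by (simp add: restrict_restrict_space)
    then show ?thesis using that setsL' by (simp add: emeasure_restrict_space)
  qed
  have spN': "space N' = space N - A" by (auto simp: N'_def space_restrict_space)
  have sA: "space N - A \<in> sets (completion N)" using A by (intro sets_completionI_sets) auto
  have setsN': "X \<in> sets N' \<longleftrightarrow> X \<in> sets (completion N) \<and> X \<subseteq> space N - A" for X
  proof -
    have "(space (completion N) - A) \<inter> space (completion N) = space N - A" by auto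
    then have "(space (completion N) - A) \<inter> space (completion N) \<in> sets (completion N)" using sA by metis
    from sets_restrict_space_iff[OF this, of X] show ?thesis unfolding N'_def by auto
  qed
  \<comment> \<open>A Lebesgue measurable set is a Borel set up to a null set. Measurability of
    \<open>G\<close> between the completed spaces therefore rests on null sets having null
    preimages.\<close>
  have nullG: "G -` Z \<inter> space N \<in> null_sets N" if Z: "Z \<in> null_sets lborel" for Z
  proof -
    have Zs: "Z \<in> sets borel" using Z by auto
    have s: "G -` Z \<inter> space N \<in> sets N" using measurable_sets[OF G Zs] .
    have *: "{t \<in> {0..<1}. F t \<in> G -` Z \<inter> space N} = {0..<1} \<inter> Z" using GF Fsp by auto
    have "{0..<1} \<inter> Z \<in> null_sets lborel" using Z by (intro null_set_Int1) auto
    then have "emeasure N (G -` Z \<inter> space N) = 0" unfolding em[OF s] * by (simp add: null_sets_def)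
    then show ?thesis using s by (simp add: null_sets_def)
  qed
  have Gm: "G \<in> measurable N' L'"
  proof (rule measurableI)
    fix X assume X: "X \<in> sets L'"
    have "G \<in> measurable (completion N) lebesgue"
    proof (rule completion.measurable_completion2)
      show G': "G \<in> measurable (completion N) lborel" using G by (simp add: measurable_completion)
      show "null_sets lborel \<subseteq> null_sets (distr (completion N) lborel G)"
      proof
        fix Z :: "real set" assume Z: "Z \<in> null_sets lborel"
        then show "Z \<in> null_sets (distr (completion N) lborel G)"
          unfolding null_sets_distr_iff[OF G'] using null_sets_completionI[OF nullG[OF Z]] by auto
      qed
    qed
    then have "G -` X \<inter> space N \<in> sets (completion N)"
      using X measurable_sets[of G "completion N" lebesgue X] by (simp add: setsL')
    then have "(G -` X \<inter> space N) \<inter> (space N - A) \<in> sets (completion N)" using sA by (rule sets.Int)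
    also have "(G -` X \<inter> space N) \<inter> (space N - A) = G -` X \<inter> space N'" by (auto simp: spN')
    finally show "G -` X \<inter> space N' \<in> sets N'" unfolding setsN' by (auto simp: spN')
  qed (auto simp: spN' spL' spA)
  have Fm: "F \<in> measurable L' N'"
  proof (rule measurableI)
    fix X assume X: "X \<in> sets N'"
    then obtain S' N0 Z where Z: "X = S' \<union> N0" "N0 \<subseteq> Z" "Z \<in> null_sets N" "S' \<in> sets N"
      unfolding setsN' by (auto elim: sets_completionE)
    have "F -` X \<inter> space L' = {t \<in> {0..<1}. F t \<in> S'} \<union> {t \<in> {0..<1}. F t \<in> N0}" using Z by (auto simp: spL')
    moreover have "{t \<in> {0..<1}. F t \<in> Z} \<in> null_sets lborel"
    proof -
      have Zs: "Z \<in> sets N" using Z(3) by auto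
      have "emeasure lborel {t \<in> {0..<1}. F t \<in> Z} = 0" unfolding em[OF Zs, symmetric] using Z(3) by (simp add: null_sets_def)
      then show ?thesis using emm[OF Zs] unfolding null_sets_def by blast
    qed
    ultimately have "F -` X \<inter> space L' \<in> sets lebesgue"
      using emm[OF Z(4)] Z(2) by (intro sets_completionI[of _ "{t \<in> {0..<1}. F t \<in> S'}" "{t \<in> {0..<1}. F t \<in> N0}" "{t \<in> {0..<1}. F t \<in> Z}"]) auto
    then show "F -` X \<inter> space L' \<in> sets L'" unfolding setsL' by (auto simp: spL')
  qed (use FA Fsp in \<open>auto simp: spN' spL'\<close>)
  have distr': "distr N' L' G = L'"
  proof (rule measure_eqI)
    fix X assume "X \<in> sets (distr N' L' G)"
    then have X: "X \<in> sets L'" by simp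
    then obtain S' N0 Z where Z: "X = S' \<union> N0" "N0 \<subseteq> Z" "Z \<in> null_sets lborel" "S' \<in> sets lborel"
      unfolding setsL' by (auto elim: sets_completionE)
    have S': "S' \<subseteq> {0..<1}" using X Z(1) by (auto simp: setsL')
    have s1: "G -` S' \<inter> space N \<in> sets N" using measurable_sets[OF G, of S'] Z(4) by simp
    have s2: "G -` S' \<inter> space N - A \<in> sets N" using s1 A by blast
    have n0: "G -` N0 \<inter> space N - A \<in> null_sets (completion N)"
      using null_sets_completion_subset[of "G -` N0 \<inter> space N - A" "G -` Z \<inter> space N" N] nullG[OF Z(3)] Z(2) null_sets_completionI by blast
    have "emeasure (distr N' L' G) X = emeasure N' (G -` X \<inter> space N')" by (rule emeasure_distr[OF Gm X])
    also have "\<dots> = emeasure (completion N) (G -` X \<inter> space N')"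
    proof -
      have "(space (completion N) - A) \<inter> space (completion N) = space N - A" by auto
      then have "(space (completion N) - A) \<inter> space (completion N) \<in> sets (completion N)" using sA by metis
      then show ?thesis unfolding N'_def by (rule emeasure_restrict_space) (auto simp: space_restrict_space)
    qed
    also have "G -` X \<inter> space N' = (G -` S' \<inter> space N - A) \<union> (G -` N0 \<inter> space N - A)" using Z(1) by (auto simp: spN')
    also have "emeasure (completion N) \<dots> = emeasure (completion N) (G -` S' \<inter> space N - A)"
      using n0 s2 by (intro emeasure_Un_null_set) auto
    also have "\<dots> = emeasure N (G -` S' \<inter> space N - A)" using s2 by simp
    also have "\<dots> = emeasure lborel {t \<in> {0..<1}. F t \<in> G -` S' \<inter> space N - A}" by (rule em[OF s2])
    also have "{t \<in> {0..<1}. F t \<in> G -` S' \<inter> space N - A} = S'" using S' FA Fsp GF by auto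
    also have "emeasure lborel S' = emeasure lebesgue X"
    proof -
      have "N0 \<in> null_sets lebesgue" using Z(2,3) null_sets_completion_subset null_sets_completionI by blast
      then show ?thesis using Z(1,4) by (simp add: emeasure_Un_null_set)
    qed
    finally show "emeasure (distr N' L' G) X = emeasure L' X" using emL'[OF X] by simp
  qed simp
  have "iso_mod_null (completion N) ?L"
    unfolding iso_mod_null_def
  proof (intro bexI[of _ A] bexI[of _ "{1}"] exI[of _ G] exI[of _ F] conjI)
    show "\<forall>x\<in>space (completion N) - A. F (G x) = x" by (auto simp: A_def)
    show "\<forall>y\<in>space ?L - {1}. G (F y) = y" using GF by auto
    show "A \<in> null_sets (completion N)" using A0 by (rule null_sets_completionI)
  qed (use Gm Fm distr' B in \<open>simp_all add: N'_def L'_def\<close>)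
  then show ?thesis using prob_space_axioms by (simp add: standard_prob_space_def)
qed

text \<open>Any injection will do, whether Borel measurable or not: the image receives the
  transported sigma-algebra and not the Borel sets of the reals.\<close>

lemma ex_inj_nat_seq_real: "\<exists>c :: (nat \<Rightarrow> nat) \<Rightarrow> real. inj c"
proof -
  obtain b :: "nat set \<Rightarrow> real" where b: "bij b"
    using nat_sets_eqpoll_reals by (auto simp: eqpoll_def)
  define e :: "(nat \<Rightarrow> nat) \<Rightarrow> nat set" where "e x = {prod_encode (n, x n) | n. True}" for x
  have "inj e"
  proof (rule injI)
    fix x y assume "e x = e y"
    show "x = y"
    proof
      fix n
      have "prod_encode (n, x n) \<in> e x" by (auto simp: e_def)
      then obtain k where "prod_encode (n, x n) = prod_encode (k, y k)" unfolding \<open>e x = e y\<close> by (auto simp: e_def)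
      then show "x n = y n" by (auto simp: prod_encode_eq)
    qed
  qed
  then have "inj (b \<circ> e)" using b by (auto intro: inj_compose bij_is_inj)
  then show ?thesis by blast
qed

section \<open>Mixed radix expansions\<close>

locale mixed_radix =
  fixes m :: "nat \<Rightarrow> nat"
  assumes m_ge_2: "m j \<ge> 2"
begin

definition H :: "nat \<Rightarrow> nat" where "H n = (\<Prod>i<n. m i)"
definition \<Omega> :: "(nat \<Rightarrow> nat) set" where "\<Omega> = {x. \<forall>j. x j < m j}"
text \<open>The address of \<open>x\<close> in the tower of height \<open>H n\<close>, with digit 0
  least significant as in an odometer. In the expansion of a real number digit 0 is the most
  significant one.\<close>

definition pos :: "nat \<Rightarrow> (nat \<Rightarrow> nat) \<Rightarrow> nat" where "pos n x = (\<Sum>i<n. H i * x i)"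
definition dig :: "real \<Rightarrow> nat \<Rightarrow> nat" where "dig t j = nat \<lfloor>t * H (Suc j)\<rfloor> mod m j"
definition \<Sigma> :: "(nat \<Rightarrow> nat) measure" where "\<Sigma> = PiM UNIV (\<lambda>j. count_space {..<m j})"
text \<open>This is the product of the uniform measures on the digits. Presented as the image of
  Lebesgue measure under the digit expansion, it comes with the parametrisation that shows it to be
  standard.\<close>

definition P :: "(nat \<Rightarrow> nat) measure" where "P = distr (restrict_space lborel {0..<1}) \<Sigma> dig"

lemma m_pos [simp]: "0 < m j" using m_ge_2[of j] by simp

lemma H_0 [simp]: "H 0 = 1" and H_Suc: "H (Suc n) = H n * m n" by (simp_all add: H_def)

lemma H_pos [simp]: "0 < H n" by (induction n) (auto simp: H_Suc)

lemma H_ge: "2 ^ n \<le> H n"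
proof (induction n)
  case (Suc n)
  then have "2 ^ n * 2 \<le> H n * m n" using m_ge_2 by (intro mult_mono) auto
  then show ?case by (simp add: H_Suc mult.commute)
qed simp

lemma H_dvd: "n \<le> n' \<Longrightarrow> H n dvd H n'"
  by (induction n' rule: dec_induct) (auto simp: H_Suc)

lemma pos_0 [simp]: "pos 0 x = 0" and pos_Suc: "pos (Suc n) x = pos n x + H n * x n" by (simp_all add: pos_def)

lemma pos_less: "x \<in> \<Omega> \<Longrightarrow> pos n x < H n"
proof (induction n)
  case (Suc n)
  then have "x n + 1 \<le> m n" by (auto simp: \<Omega>_def Suc_le_eq)
  then have "H n * (x n + 1) \<le> H n * m n" by (rule mult_le_mono2)
  then show ?case using Suc by (simp add: pos_Suc H_Suc algebra_simps)
qed simp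

lemma pos_Suc_mod: "x \<in> \<Omega> \<Longrightarrow> pos (Suc n) x mod H n = pos n x"
  and pos_Suc_div: "x \<in> \<Omega> \<Longrightarrow> pos (Suc n) x div H n = x n"
  using pos_less[of x n] by (simp_all add: pos_Suc)

lemma pos_mod:
  assumes "x \<in> \<Omega>" "n \<le> n'"
  shows "pos n' x mod H n = pos n x"
  using assms(2)
proof (induction n' rule: dec_induct)
  case (step k)
  then have "pos (Suc k) x mod H k mod H n = pos n x" using assms(1) by (simp add: pos_Suc_mod)
  then show ?case using H_dvd[OF step(1)] by (simp add: mod_mod_cancel)
qed (simp add: assms pos_less)

lemma pos_eq_iff:
  assumes "x \<in> \<Omega>" "y \<in> \<Omega>"
  shows "pos n x = pos n y \<longleftrightarrow> (\<forall>i<n. x i = y i)"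
proof
  assume eq: "pos n x = pos n y"
  show "\<forall>i<n. x i = y i"
  proof safe
    fix i assume "i < n"
    then have "pos (Suc i) x = pos (Suc i) y" using pos_mod[OF assms(1), of "Suc i" n] pos_mod[OF assms(2), of "Suc i" n] eq by simp
    then show "x i = y i" using pos_Suc_div assms by metis
  qed
qed (simp add: pos_def)

lemma \<Omega>_eqI: "x \<in> \<Omega> \<Longrightarrow> y \<in> \<Omega> \<Longrightarrow> (\<And>n. pos n x = pos n y) \<Longrightarrow> x = y"
  using pos_eq_iff by blast

lemma ex_pos: "k < H n \<Longrightarrow> \<exists>x\<in>\<Omega>. pos n x = k"
proof (induction n arbitrary: k)
  case 0
  then show ?case by (intro bexI[of _ "\<lambda>_. 0"]) (auto simp: \<Omega>_def)
next
  case (Suc n)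
  obtain x where x: "x \<in> \<Omega>" "pos n x = k mod H n" using Suc(1)[of "k mod H n"] by auto
  have "k div H n < m n" using Suc(2) by (simp add: H_Suc less_mult_imp_div_less mult.commute)
  then have "x(n := k div H n) \<in> \<Omega>" using x by (auto simp: \<Omega>_def)
  moreover have "pos n (x(n := k div H n)) = pos n x" by (simp add: pos_def)
  then have "pos (Suc n) (x(n := k div H n)) = k" unfolding pos_Suc fun_upd_same x(2) by simp
  ultimately show ?case by blast
qed

lemma space_\<Sigma> [simp]: "space \<Sigma> = \<Omega>" by (auto simp: \<Sigma>_def \<Omega>_def space_PiM PiE_def)

lemma coordinate_measurable: "(\<lambda>x. x j) \<in> measurable \<Sigma> (count_space UNIV)"
  by (rule measurable_compose[OF measurable_component_singleton[of j UNIV "\<lambda>j. count_space {..<m j}", folded \<Sigma>_def]]) simp_all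

lemma pos_measurable [measurable]: "pos n \<in> measurable \<Sigma> (count_space UNIV)"
proof -
  note [measurable] = coordinate_measurable
  show ?thesis
  proof (induction n)
    case (Suc n)
    have "(\<lambda>x. i + H n * x n) \<in> measurable \<Sigma> (count_space UNIV)" for i
      by (rule measurable_compose[OF coordinate_measurable]) simp
    then show ?case unfolding pos_Suc[abs_def] using Suc by (rule measurable_compose_countable)
  qed (simp add: pos_def[abs_def])
qed

definition cylinders :: "(nat \<Rightarrow> nat) set set" where
  "cylinders = {{x \<in> \<Omega>. pos n x = k} | n k. True}"

text \<open>A longer address determines the shorter ones, so two cylinders are either disjoint or
  nested.\<close>

lemma Int_stable_cylinders: "Int_stable (insert {} cylinders)"
proof (rule Int_stableI)
  have *: "A \<inter> B \<in> insert {} cylinders" if "A = {x \<in> \<Omega>. pos n x = k}" "B = {x \<in> \<Omega>. pos n' x = k'}" "n \<le> n'" for A B n k n' k'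
  proof (cases "k' mod H n = k")
    case True
    then have "A \<inter> B = B" using that pos_mod by auto
    then show ?thesis using that by (auto simp: cylinders_def)
  next
    case False
    then have "A \<inter> B = {}" using that pos_mod by auto
    then show ?thesis by simp
  qed
  fix A B assume "A \<in> insert {} cylinders" "B \<in> insert {} cylinders"
  then consider "A = {}" | "B = {}" | n k n' k' where "A = {x \<in> \<Omega>. pos n x = k}" "B = {x \<in> \<Omega>. pos n' x = k'}"
    by (auto simp: cylinders_def)
  then show "A \<inter> B \<in> insert {} cylinders"
  proof cases
    case 3
    then show ?thesis using *[OF 3] *[OF 3(2,1)] by (cases "n \<le> n'") (auto simp: Int_commute)
  qed auto
qed

lemma cylinders_Pow: "insert {} cylinders \<subseteq> Pow \<Omega>" by (auto simp: cylinders_def)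

lemma sets_\<Sigma>: "sets \<Sigma> = sigma_sets \<Omega> (insert {} cylinders)"
proof
  have E: "(\<Pi>\<^sub>E j\<in>UNIV. space (count_space {..<m j})) = \<Omega>" by (auto simp: \<Omega>_def PiE_def)
  have "sets \<Sigma> = sigma_sets \<Omega> {{x \<in> \<Omega>. x i \<in> A} | i A. A \<subseteq> {..<m i}}"
    unfolding \<Sigma>_def sets_PiM_single E by simp
  also have "\<dots> \<subseteq> sigma_sets \<Omega> (insert {} cylinders)"
  proof (rule sigma_sets_mono, safe)
    fix i :: nat and A :: "nat set"
    have "{x \<in> \<Omega>. x i \<in> A} = (\<Union>k\<in>{k. k div H i \<in> A}. {x \<in> \<Omega>. pos (Suc i) x = k})"
      using pos_Suc_div by auto
    also have "\<dots> \<in> sigma_sets \<Omega> (insert {} cylinders)"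
      by (intro sigma_sets_UNION countable_image) (auto simp: cylinders_def intro!: sigma_sets.Basic)
    finally show "{x \<in> \<Omega>. x i \<in> A} \<in> sigma_sets \<Omega> (insert {} cylinders)" .
  qed
  finally show "sets \<Sigma> \<subseteq> sigma_sets \<Omega> (insert {} cylinders)" .
  have "C \<in> sets \<Sigma>" if "C \<in> insert {} cylinders" for C
  proof -
    have "{x \<in> space \<Sigma>. pos n x = k} \<in> sets \<Sigma>" for n k by measurable
    then show ?thesis using that by (auto simp: cylinders_def)
  qed
  then show "sigma_sets \<Omega> (insert {} cylinders) \<subseteq> sets \<Sigma>"
    using sets.sigma_sets_subset[of "insert {} cylinders" \<Sigma>] by auto
qed

lemma sets_P [simp, measurable_cong]: "sets P = sets \<Sigma>" and space_P [simp]: "space P = \<Omega>" by (simp_all add: P_def)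

lemma measure_unique:
  assumes Q: "sets Q = sets \<Sigma>" "finite_measure Q" "sets Q' = sets \<Sigma>" "finite_measure Q'"
    and eq: "\<And>n k. k < H n \<Longrightarrow> emeasure Q {x \<in> \<Omega>. pos n x = k} = emeasure Q' {x \<in> \<Omega>. pos n x = k}"
  shows "Q = Q'"
proof (rule measure_eqI_generator_eq[OF Int_stable_cylinders cylinders_Pow, where A="\<lambda>_. \<Omega>"])
  fix X assume "X \<in> insert {} cylinders"
  then consider "X = {}" | n k where "X = {x \<in> \<Omega>. pos n x = k}" "k < H n" | n k where "X = {x \<in> \<Omega>. pos n x = k}" "\<not> k < H n"
    by (auto simp: cylinders_def)
  then show "emeasure Q X = emeasure Q' X"
  proof cases
    case 3
    then have "X = {}" using pos_less by auto
    then show ?thesis by simp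
  qed (auto simp: eq)
next
  have "\<Omega> \<in> cylinders" unfolding cylinders_def by (intro CollectI exI[of _ 0]) simp
  then show "range (\<lambda>_::nat. \<Omega>) \<subseteq> insert {} cylinders" by auto
  interpret Q: finite_measure Q by fact
  show "emeasure Q \<Omega> \<noteq> \<infinity>" by simp
qed (use Q sets_\<Sigma> in auto)

lemma dig_less: "dig t j < m j" by (simp add: dig_def)

lemma dig_\<Omega>: "dig t \<in> \<Omega>" by (simp add: \<Omega>_def dig_less)

lemma dig_measurable [measurable]: "dig \<in> measurable (restrict_space lborel {0..<1}) \<Sigma>"
  unfolding \<Sigma>_def
proof (rule measurable_PiM_single')
  fix i
  have "(\<lambda>t. nat \<lfloor>t * H (Suc i)\<rfloor>) \<in> measurable (restrict_space lborel {0..<1}) (count_space UNIV)"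
    by (intro measurable_restrict_space1) measurable
  then have "(\<lambda>t. nat \<lfloor>t * H (Suc i)\<rfloor> mod m i) \<in> measurable (restrict_space lborel {0..<1}) (count_space UNIV)"
    by measurable
  moreover have "count_space {..<m i} = restrict_space (count_space UNIV) {..<m i}" by (simp add: restrict_count_space)
  ultimately show "(\<lambda>t. dig t i) \<in> measurable (restrict_space lborel {0..<1}) (count_space {..<m i})"
    using dig_less[of _ i] by (simp add: dig_def measurable_restrict_space2)
qed (auto simp: dig_less)

text \<open>The integer formed by the first n digits in the opposite order of significance. For the
  digits of t it is the integer part of t H_n, which links addresses to intervals.\<close>

fun lead :: "nat \<Rightarrow> (nat \<Rightarrow> nat) \<Rightarrow> nat" where
  "lead 0 a = 0"
| "lead (Suc n) a = lead n a * m n + a n"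

lemma lead_less: "a \<in> \<Omega> \<Longrightarrow> lead n a < H n"
proof (induction n)
  case (Suc n)
  then have "(lead n a + 1) * m n \<le> H n * m n" by (intro mult_le_mono1) auto
  moreover have "a n < m n" using Suc(2) by (simp add: \<Omega>_def)
  ultimately show ?case by (simp add: H_Suc)
qed simp

lemma floor_Suc_div:
  fixes t :: real
  assumes "t \<ge> 0"
  shows "nat \<lfloor>t * H (Suc n)\<rfloor> div m n = nat \<lfloor>t * H n\<rfloor>"
proof -
  have "\<lfloor>t * H (Suc n) / real_of_int (int (m n))\<rfloor> = \<lfloor>t * H (Suc n)\<rfloor> div int (m n)"
    by (rule floor_divide_real_eq_div) simp
  then have "\<lfloor>t * H (Suc n)\<rfloor> div int (m n) = \<lfloor>t * H n\<rfloor>" using m_pos[of n] by (simp add: H_Suc)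
  then show ?thesis by (metis nat_div_distrib' nat_int of_nat_0_le_iff)
qed

lemma floor_eq_lead:
  fixes t :: real
  assumes t: "t \<in> {0..<1}"
  shows "nat \<lfloor>t * H n\<rfloor> = lead n (dig t)"
proof (induction n)
  case 0
  then show ?case using t by (simp add: floor_eq_iff)
next
  case (Suc n)
  have 1: "nat \<lfloor>t * H (Suc n)\<rfloor> div m n = lead n (dig t)" using floor_Suc_div[of t n] t Suc by simp
  have "nat \<lfloor>t * H (Suc n)\<rfloor> = (nat \<lfloor>t * H (Suc n)\<rfloor> div m n) * m n + nat \<lfloor>t * H (Suc n)\<rfloor> mod m n"
    by (rule div_mult_mod_eq[symmetric])
  also have "\<dots> = lead n (dig t) * m n + dig t n" unfolding 1 dig_def ..
  finally show ?case unfolding lead.simps .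
qed

lemma lead_eq_iff:
  assumes "a \<in> \<Omega>" "b \<in> \<Omega>"
  shows "lead n a = lead n b \<longleftrightarrow> (\<forall>i<n. a i = b i)"
proof (induction n)
  case (Suc n)
  have l: "a n < m n" "b n < m n" using assms by (auto simp: \<Omega>_def)
  have "lead (Suc n) a = lead (Suc n) b \<longleftrightarrow> lead n a = lead n b \<and> a n = b n"
  proof
    assume eq: "lead (Suc n) a = lead (Suc n) b"
    have "lead (Suc n) a div m n = lead n a" "lead (Suc n) a mod m n = a n"
      "lead (Suc n) b div m n = lead n b" "lead (Suc n) b mod m n = b n" using l by simp_all
    then show "lead n a = lead n b \<and> a n = b n" using eq by metis
  qed simp
  then show ?case using Suc by (auto simp: less_Suc_eq)
qed simp

text \<open>An address of length n fixes the first n digits, in whichever order of significance they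
  are read. This confines t to one interval of length 1 / H_n.\<close>

lemma emeasure_cylinder:
  assumes k: "k < H n"
  shows "emeasure P {x \<in> \<Omega>. pos n x = k} = ennreal (1 / real (H n))"
proof -
  obtain a where a: "a \<in> \<Omega>" "pos n a = k" using ex_pos[OF k] by blast
  define c where "c = lead n a"
  have c: "c < H n" unfolding c_def by (rule lead_less[OF a(1)])
  have "{x \<in> space \<Sigma>. pos n x = k} \<in> sets \<Sigma>" by measurable
  then have s: "{x \<in> \<Omega>. pos n x = k} \<in> sets \<Sigma>" by simp
  have "emeasure P {x \<in> \<Omega>. pos n x = k} = emeasure (restrict_space lborel {0..<1}) (dig -` {x \<in> \<Omega>. pos n x = k} \<inter> space (restrict_space lborel {0..<1}))"
    unfolding P_def by (rule emeasure_distr[OF dig_measurable s])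
  also have "dig -` {x \<in> \<Omega>. pos n x = k} \<inter> space (restrict_space lborel {0..<1}) = {c / H n ..< (c + 1) / H n}"
  proof (intro set_eqI iffI)
    fix t assume "t \<in> dig -` {x \<in> \<Omega>. pos n x = k} \<inter> space (restrict_space lborel {0..<1})"
    then have t: "t \<in> {0..<1}" "pos n (dig t) = pos n a" by (auto simp: space_restrict_space a)
    then have "lead n (dig t) = c" using pos_eq_iff[OF dig_\<Omega> a(1)] lead_eq_iff[OF dig_\<Omega> a(1)] by (simp add: c_def)
    then have "nat \<lfloor>t * H n\<rfloor> = c" using floor_eq_lead[OF t(1)] by simp
    then have "\<lfloor>t * H n\<rfloor> = int c" using t(1) by auto
    then have "real c \<le> t * H n" "t * H n < real c + 1" by (auto simp: floor_eq_iff)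
    then show "t \<in> {c / H n ..< (c + 1) / H n}" by (auto simp: divide_le_eq less_divide_eq)
  next
    fix t assume t: "t \<in> {c / H n ..< (c + 1) / H n}"
    then have l: "real c \<le> t * H n" "t * H n < real c + 1" by (auto simp: divide_le_eq less_divide_eq)
    have "0 \<le> real c / real (H n)" by simp
    then have t0: "0 \<le> t" using t by (meson atLeastLessThan_iff order_trans)
    have "t * H n < 1 * real (H n)" using l(2) c by linarith
    then have t1: "t < 1" by (rule mult_right_less_imp_less) simp
    have "\<lfloor>t * H n\<rfloor> = int c" using l by (simp add: floor_eq_iff)
    then have "lead n (dig t) = lead n a" using floor_eq_lead[of t n] t0 t1 by (simp add: c_def)
    then have "pos n (dig t) = k" using pos_eq_iff[OF dig_\<Omega> a(1)] lead_eq_iff[OF dig_\<Omega> a(1)] a(2) by blast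
    then show "t \<in> dig -` {x \<in> \<Omega>. pos n x = k} \<inter> space (restrict_space lborel {0..<1})"
      using t0 t1 dig_\<Omega> by (auto simp: space_restrict_space)
  qed
  also have "emeasure (restrict_space lborel {0..<1}) {c / H n ..< (c + 1) / H n} = emeasure lborel {c / H n ..< (c + 1) / H n}"
  proof (rule emeasure_restrict_space)
    have "(real c + 1) / H n \<le> 1" using c by (simp add: divide_le_eq)
    moreover have "0 \<le> real c / H n" by simp
    ultimately show "{c / H n ..< (c + 1) / H n} \<subseteq> {0..<1}"
      by (intro ivl_subset[THEN iffD2] disjI2 conjI) simp_all
  qed simp
  also have "\<dots> = ennreal ((c + 1) / H n - c / H n)" by (simp add: divide_right_mono)
  also have "(c + 1) / H n - c / H n = 1 / H n" by (simp add: diff_divide_distrib[symmetric])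
  finally show ?thesis .
qed

lemma prob_space_P: "prob_space P"
proof -
  have "prob_space (restrict_space lborel {0..<1::real})"
    by (rule prob_spaceI) (simp add: space_restrict_space emeasure_restrict_space)
  then show ?thesis unfolding P_def by (rule prob_space.prob_space_distr) measurable
qed

sublocale P: prob_space P by (rule prob_space_P)

lemma pos_set_in_sets: "{x \<in> \<Omega>. pos n x \<in> K} \<in> sets P"
proof -
  have "{x \<in> space \<Sigma>. pos n x \<in> K} \<in> sets \<Sigma>" by measurable
  then show ?thesis by simp
qed

lemma measure_cylinder: "k < H n \<Longrightarrow> measure P {x \<in> \<Omega>. pos n x = k} = 1 / real (H n)"
  unfolding measure_def by (subst emeasure_cylinder) simp_all

lemma measure_pos_set: "measure P {x \<in> \<Omega>. pos n x \<in> K} = real (card (K \<inter> {..<H n})) / real (H n)"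
proof -
  have eq: "{x \<in> \<Omega>. pos n x \<in> K} = (\<Union>k\<in>K \<inter> {..<H n}. {x \<in> \<Omega>. pos n x = k})" using pos_less by auto
  have "measure P {x \<in> \<Omega>. pos n x \<in> K} = (\<Sum>k\<in>K \<inter> {..<H n}. measure P {x \<in> \<Omega>. pos n x = k})"
    unfolding eq
  proof (rule P.finite_measure_finite_Union)
    show "(\<lambda>k. {x \<in> \<Omega>. pos n x = k}) ` (K \<inter> {..<H n}) \<subseteq> sets P"
    proof (rule image_subsetI)
      fix k
      show "{x \<in> \<Omega>. pos n x = k} \<in> sets P" using pos_set_in_sets[of n "{k}"] by simp
    qed
    show "disjoint_family_on (\<lambda>k. {x \<in> \<Omega>. pos n x = k}) (K \<inter> {..<H n})"
      unfolding disjoint_family_on_def by blast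
  qed simp
  also have "\<dots> = (\<Sum>k\<in>K \<inter> {..<H n}. 1 / real (H n))"
  proof (rule sum.cong[OF refl])
    fix k assume "k \<in> K \<inter> {..<H n}"
    then have "k < H n" by blast
    then show "measure P {x \<in> \<Omega>. pos n x = k} = 1 / real (H n)" by (rule measure_cylinder)
  qed
  finally show ?thesis by simp
qed

definition dig_inv :: "(nat \<Rightarrow> nat) \<Rightarrow> real" where "dig_inv x = (\<Sum>i. x i / H (Suc i))"

lemma dig_inv_dig:
  assumes t: "t \<in> {0..<1}"
  shows "dig_inv (dig t) = t"
proof -
  have eq: "(\<Sum>i<n. dig t i / H (Suc i)) = lead n (dig t) / H n" for n
    by (induction n) (simp_all add: H_Suc field_simps)
  have "(\<lambda>n. lead n (dig t) / H n) \<longlonglongrightarrow> t"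
  proof (rule real_tendsto_sandwich)
    have near: "lead n (dig t) / H n \<le> t" "t - (1/2) ^ n \<le> lead n (dig t) / H n" for n
    proof -
      have "lead n (dig t) = \<lfloor>t * H n\<rfloor>" using floor_eq_lead[OF t, of n, symmetric] t by simp
      then have l: "real (lead n (dig t)) = of_int \<lfloor>t * H n\<rfloor>" by (metis of_int_of_nat_eq)
      show "lead n (dig t) / H n \<le> t" unfolding l by (simp add: divide_le_eq)
      have "(t - 1 / H n) * H n \<le> of_int \<lfloor>t * H n\<rfloor>"
        using real_of_int_floor_add_one_ge[of "t * H n"] by (simp add: left_diff_distrib)
      then have "t - 1 / H n \<le> lead n (dig t) / H n" unfolding l by (subst pos_le_divide_eq) simp_all
      moreover have "1 / real (H n) \<le> (1/2) ^ n"
      proof -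
        have "real (2 ^ n) \<le> real (H n)" using H_ge[of n] by (simp only: of_nat_le_iff)
        then show ?thesis by (simp add: power_divide divide_le_eq field_simps)
      qed
      ultimately show "t - (1/2) ^ n \<le> lead n (dig t) / H n" by linarith
    qed
    show "\<forall>\<^sub>F n in sequentially. t - (1/2) ^ n \<le> lead n (dig t) / H n" using near by simp
    show "\<forall>\<^sub>F n in sequentially. lead n (dig t) / H n \<le> t" using near by simp
    have "(\<lambda>n. t - (1/2) ^ n) \<longlonglongrightarrow> t - 0" by (intro tendsto_intros LIMSEQ_realpow_zero) auto
    then show "(\<lambda>n. t - (1/2) ^ n) \<longlonglongrightarrow> t" by simp
  qed simp
  then have "(\<lambda>i. dig t i / H (Suc i)) sums t" unfolding sums_def eq .
  then show ?thesis unfolding dig_inv_def by (rule sums_unique[symmetric])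
qed

lemma dig_inv_measurable [measurable]: "dig_inv \<in> borel_measurable P"
proof -
  have [measurable]: "(\<lambda>x. real (x j)) \<in> borel_measurable P" for j
    using measurable_compose[OF coordinate_measurable[of j], of real borel] by (simp add: measurable_cong_sets[OF sets_P refl])
  show ?thesis unfolding dig_inv_def[abs_def] by measurable
qed

text \<open>Sequences that end in maximal digits are not expansions, so \<open>dig\<close> and
  \<open>dig_inv\<close> are not inverse everywhere on \<Omega>. The exceptional sequences are
  handled by comparing digits, a countable intersection.\<close>

lemma dig_dig_inv_sets: "{x \<in> \<Omega>. dig (dig_inv x) = x} \<in> sets P"
proof -
  have "{x \<in> space P. dig (dig_inv x) j = x j} \<in> sets P" for j
  proof -
    have [measurable]: "(\<lambda>x. x j) \<in> measurable P (count_space UNIV)"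
      using coordinate_measurable by (simp add: measurable_cong_sets[OF sets_P refl])
    show ?thesis unfolding dig_def by measurable
  qed
  then have "(\<Inter>j. {x \<in> space P. dig (dig_inv x) j = x j}) \<in> sets P" by (intro sets.countable_INT) auto
  also have "(\<Inter>j. {x \<in> space P. dig (dig_inv x) j = x j}) = {x \<in> \<Omega>. dig (dig_inv x) = x}" by (auto simp: fun_eq_iff)
  finally show ?thesis .
qed

lemma standard_embed:
  assumes c: "inj (c :: (nat \<Rightarrow> nat) \<Rightarrow> real)"
  shows "standard_prob_space (embed_measure P c)"
proof (rule standard_prob_spaceI[where F="\<lambda>t. c (dig t)" and G="\<lambda>y. dig_inv (the_inv c y)"])
  have cm: "c \<in> measurable P (embed_measure P c)" by (rule measurable_embed_measure2[OF c])
  have E: "embed_measure P c = distr P (embed_measure P c) c" by (rule embed_measure_eq_distr[OF c])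
  show "prob_space (embed_measure P c)" by (subst E) (rule P.prob_space_distr[OF cm])
  have dm: "dig \<in> measurable (restrict_space lborel {0..<1}) P" using dig_measurable by (simp add: measurable_cong_sets[OF refl sets_P])
  show "(\<lambda>t. c (dig t)) \<in> measurable (restrict_space lborel {0..<1}) (embed_measure P c)"
    by (rule measurable_compose[OF dm cm])
  show "(\<lambda>y. dig_inv (the_inv c y)) \<in> borel_measurable (embed_measure P c)"
    by (rule measurable_embed_measure1) (simp add: the_inv_f_f[OF c])
  show "dig_inv (the_inv c (c (dig t))) = t" if "t \<in> {0..<1}" for t
    using dig_inv_dig[OF that] by (simp add: the_inv_f_f[OF c])
  have "embed_measure P c = distr P (embed_measure P c) c" by (rule E)
  also have "\<dots> = distr (distr (restrict_space lborel {0..<1}) P dig) (embed_measure P c) c"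
  proof -
    have "distr (restrict_space lborel {0..<1}) P dig = P" by (subst (2) P_def) (intro distr_cong; simp)
    then show ?thesis by simp
  qed
  also have "\<dots> = distr (restrict_space lborel {0..<1}) (embed_measure P c) (c \<circ> dig)"
    by (rule distr_distr[OF cm dm])
  finally show "distr (restrict_space lborel {0..<1}) (embed_measure P c) (\<lambda>t. c (dig t)) = embed_measure P c"
    by (simp add: comp_def)
  have "c ` {x \<in> \<Omega>. dig (dig_inv x) = x} \<in> sets (embed_measure P c)"
    using dig_dig_inv_sets by (rule in_sets_embed_measure)
  also have "c ` {x \<in> \<Omega>. dig (dig_inv x) = x} = {y \<in> space (embed_measure P c). c (dig (dig_inv (the_inv c y))) = y}"
    using c by (auto simp: space_embed_measure the_inv_f_f[OF c] inj_eq)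
  finally show "{y \<in> space (embed_measure P c). c (dig (dig_inv (the_inv c y))) = y} \<in> sets (embed_measure P c)" .
qed

end

lemma automorphismI:
  assumes "f \<in> measurable M M" "g \<in> measurable M M"
    and gf: "\<And>x. x \<in> space M \<Longrightarrow> g (f x) = x" and fg: "\<And>x. x \<in> space M \<Longrightarrow> f (g x) = x"
    and "distr M M f = M"
  shows "automorphism M f" and "\<And>x. x \<in> space M \<Longrightarrow> inv_into (space M) f x = g x"
proof -
  have sp: "f x \<in> space M" "g x \<in> space M" if "x \<in> space M" for x
    using assms(1,2) that by (auto dest: measurable_space)
  have bij: "bij_betw f (space M) (space M)"
    by (rule bij_betwI[where g=g]) (auto simp: gf fg sp)
  show inv: "inv_into (space M) f x = g x" if "x \<in> space M" for x
    using fg[OF that] sp(2)[OF that] bij by (metis bij_betw_imp_inj_on inv_into_f_f)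
  have "inv_into (space M) f \<in> measurable M M"
    using assms(2) by (subst measurable_cong[where g=g]) (simp_all add: inv)
  then show "automorphism M f" using bij assms by (simp add: automorphism_def)
qed

lemma automorphism_comp:
  assumes "automorphism M f" "automorphism M g"
  shows "automorphism M (\<lambda>x. f (g x))"
proof (rule automorphismI)
  let ?fi = "inv_into (space M) f" and ?gi = "inv_into (space M) g"
  have m: "f \<in> measurable M M" "g \<in> measurable M M" "?fi \<in> measurable M M" "?gi \<in> measurable M M"
    and b: "bij_betw f (space M) (space M)" "bij_betw g (space M) (space M)"
    and d: "distr M M f = M" "distr M M g = M"
    using assms by (auto simp: automorphism_def)
  show "(\<lambda>x. f (g x)) \<in> measurable M M" using m by (auto intro: measurable_compose)
  show "(\<lambda>x. ?gi (?fi x)) \<in> measurable M M" using m by (auto intro: measurable_compose)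
  have sp: "f x \<in> space M" "g x \<in> space M" "?fi x \<in> space M" "?gi x \<in> space M" if "x \<in> space M" for x
    using m that by (auto dest: measurable_space)
  have i: "?fi (f x) = x" "?gi (g x) = x" "f (?fi x) = x" "g (?gi x) = x" if "x \<in> space M" for x
    using b that by (auto simp: bij_betw_inv_into_left bij_betw_inv_into_right)
  show "?gi (?fi (f (g x))) = x" "f (g (?gi (?fi x))) = x" if "x \<in> space M" for x
    using that by (simp_all add: i sp)
  have "distr M M (\<lambda>x. f (g x)) = distr (distr M M g) M f"
    using m by (subst distr_distr) (auto simp: comp_def)
  then show "distr M M (\<lambda>x. f (g x)) = M" by (simp add: d)
qed

context mixed_radix begin

section \<open>Compatible bijections of the finite levels\<close>

text \<open>An automorphism of the tree of cylinders, given by its permutation of each level. The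
  odometer translation and the conjugating maps are both of this form.\<close>

definition compatible :: "(nat \<Rightarrow> nat \<Rightarrow> nat) \<Rightarrow> bool" where
  "compatible \<tau> \<longleftrightarrow> (\<forall>n. bij_betw (\<tau> n) {..<H n} {..<H n}) \<and>
     (\<forall>n. \<forall>k<H (Suc n). \<tau> (Suc n) k mod H n = \<tau> n (k mod H n))"

text \<open>Digit j of the image is the leading digit of its address of length j + 1; compatibility
  makes the lower digits of that address agree with the shorter addresses.\<close>

definition lift :: "(nat \<Rightarrow> nat \<Rightarrow> nat) \<Rightarrow> (nat \<Rightarrow> nat) \<Rightarrow> nat \<Rightarrow> nat" where
  "lift \<tau> x j = \<tau> (Suc j) (pos (Suc j) x) div H j"

definition inv_family :: "(nat \<Rightarrow> nat \<Rightarrow> nat) \<Rightarrow> nat \<Rightarrow> nat \<Rightarrow> nat" where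
  "inv_family \<tau> n = inv_into {..<H n} (\<tau> n)"

lemma compatible_less: "compatible \<tau> \<Longrightarrow> k < H n \<Longrightarrow> \<tau> n k < H n"
  unfolding compatible_def using bij_betwE by blast

lemma inv_family_left: "compatible \<tau> \<Longrightarrow> k < H n \<Longrightarrow> inv_family \<tau> n (\<tau> n k) = k"
  and inv_family_right: "compatible \<tau> \<Longrightarrow> k < H n \<Longrightarrow> \<tau> n (inv_family \<tau> n k) = k"
  unfolding compatible_def inv_family_def by (auto intro: bij_betw_inv_into_left bij_betw_inv_into_right)

lemma compatible_inv_family:
  assumes c: "compatible \<tau>"
  shows "compatible (inv_family \<tau>)"
proof -
  have bij: "bij_betw (inv_family \<tau> n) {..<H n} {..<H n}" for n
    using c unfolding compatible_def inv_family_def by (simp add: bij_betw_inv_into)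
  have "inv_family \<tau> (Suc n) k mod H n = inv_family \<tau> n (k mod H n)" if k: "k < H (Suc n)" for n k
  proof -
    define l where "l = inv_family \<tau> (Suc n) k"
    have l: "l < H (Suc n)" using bij[of "Suc n"] k bij_betwE unfolding l_def by blast
    have "\<tau> (Suc n) l = k" unfolding l_def by (rule inv_family_right[OF c k])
    then have "\<tau> n (l mod H n) = k mod H n" using c l by (auto simp: compatible_def)
    then have "inv_family \<tau> n (k mod H n) = l mod H n"
      using inv_family_left[OF c, of "l mod H n" n] by simp
    then show ?thesis by (simp add: l_def)
  qed
  then show ?thesis using bij by (simp add: compatible_def)
qed

lemma lift_\<Omega>:
  assumes "compatible \<tau>" "x \<in> \<Omega>"
  shows "lift \<tau> x \<in> \<Omega>"
proof -
  have "\<tau> (Suc j) (pos (Suc j) x) < m j * H j" for j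
    using compatible_less[OF assms(1) pos_less[OF assms(2)], of "Suc j"] by (simp add: H_Suc mult.commute)
  then show ?thesis by (simp add: \<Omega>_def lift_def less_mult_imp_div_less)
qed

lemma pos_lift:
  assumes c: "compatible \<tau>" and x: "x \<in> \<Omega>"
  shows "pos n (lift \<tau> x) = \<tau> n (pos n x)"
proof (induction n)
  case 0
  have "\<tau> 0 0 < H 0" by (rule compatible_less[OF c]) simp
  then show ?case by simp
next
  case (Suc n)
  have "\<tau> (Suc n) (pos (Suc n) x) mod H n = \<tau> n (pos (Suc n) x mod H n)"
    using c pos_less[OF x, of "Suc n"] by (auto simp: compatible_def)
  then have "\<tau> (Suc n) (pos (Suc n) x) mod H n = \<tau> n (pos n x)"
    by (simp add: pos_Suc_mod[OF x])
  then show ?case using Suc mod_mult_div_eq[of "\<tau> (Suc n) (pos (Suc n) x)" "H n"]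
    unfolding pos_Suc[of n "lift \<tau> x"] lift_def[of \<tau> x n] by (simp add: lift_def[of \<tau> x n])
qed

lemma measurable_\<Sigma>I:
  assumes "\<And>j. (\<lambda>x. f x j) \<in> measurable M (count_space UNIV)" "\<And>x. x \<in> space M \<Longrightarrow> f x \<in> \<Omega>"
  shows "f \<in> measurable M \<Sigma>"
  unfolding \<Sigma>_def
proof (rule measurable_PiM_single')
  fix i
  have "count_space {..<m i} = restrict_space (count_space UNIV) {..<m i}" by (simp add: restrict_count_space)
  then show "(\<lambda>x. f x i) \<in> measurable M (count_space {..<m i})"
    using assms by (auto simp: \<Omega>_def intro!: measurable_restrict_space2)
qed (use assms in \<open>auto simp: \<Omega>_def PiE_def\<close>)

lemma pos_measurable_P [measurable]: "pos n \<in> measurable P (count_space UNIV)"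
  using pos_measurable by (simp add: measurable_cong_sets[OF sets_P refl])

lemma lift_measurable: "compatible \<tau> \<Longrightarrow> lift \<tau> \<in> measurable P P"
proof -
  assume c: "compatible \<tau>"
  have "(\<lambda>x. lift \<tau> x j) \<in> measurable P (count_space UNIV)" for j
    unfolding lift_def by (rule measurable_compose[OF pos_measurable_P]) simp
  then have "lift \<tau> \<in> measurable P \<Sigma>" by (intro measurable_\<Sigma>I) (auto simp: lift_\<Omega> c)
  then show ?thesis by (simp add: measurable_cong_sets[OF refl sets_P])
qed

lemma lift_inv_family:
  assumes c: "compatible \<tau>" and x: "x \<in> \<Omega>"
  shows "lift (inv_family \<tau>) (lift \<tau> x) = x" "lift \<tau> (lift (inv_family \<tau>) x) = x"
proof -
  note ci = compatible_inv_family[OF c]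
  show "lift (inv_family \<tau>) (lift \<tau> x) = x"
    by (rule \<Omega>_eqI) (simp_all add: lift_\<Omega> c ci x pos_lift inv_family_left pos_less)
  show "lift \<tau> (lift (inv_family \<tau>) x) = x"
    by (rule \<Omega>_eqI) (simp_all add: lift_\<Omega> c ci x pos_lift inv_family_right pos_less)
qed

text \<open>The cylinders of one level are permuted, and they all have the same measure.\<close>

lemma distr_lift:
  assumes c: "compatible \<tau>"
  shows "distr P P (lift \<tau>) = P"
proof (rule measure_unique)
  fix n k assume k: "k < H n"
  have s: "{x \<in> \<Omega>. pos n x = k} \<in> sets P" using pos_set_in_sets[of n "{k}"] by simp
  have "emeasure (distr P P (lift \<tau>)) {x \<in> \<Omega>. pos n x = k} = emeasure P (lift \<tau> -` {x \<in> \<Omega>. pos n x = k} \<inter> space P)"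
    by (rule emeasure_distr[OF lift_measurable[OF c] s])
  also have "lift \<tau> -` {x \<in> \<Omega>. pos n x = k} \<inter> space P = {x \<in> \<Omega>. pos n x = inv_family \<tau> n k}"
  proof (intro set_eqI iffI)
    fix x assume "x \<in> lift \<tau> -` {x \<in> \<Omega>. pos n x = k} \<inter> space P"
    then have x: "x \<in> \<Omega>" "\<tau> n (pos n x) = k" using pos_lift[OF c] by auto
    then have "inv_family \<tau> n k = pos n x" using inv_family_left[OF c pos_less[OF x(1)]] by blast
    then show "x \<in> {x \<in> \<Omega>. pos n x = inv_family \<tau> n k}" using x by simp
  next
    fix x assume "x \<in> {x \<in> \<Omega>. pos n x = inv_family \<tau> n k}"
    then show "x \<in> lift \<tau> -` {x \<in> \<Omega>. pos n x = k} \<inter> space P"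
      using pos_lift[OF c] lift_\<Omega>[OF c] inv_family_right[OF c k] by auto
  qed
  finally show "emeasure (distr P P (lift \<tau>)) {x \<in> \<Omega>. pos n x = k} = emeasure P {x \<in> \<Omega>. pos n x = k}"
    using compatible_less[OF compatible_inv_family[OF c] k] k by (simp add: emeasure_cylinder)
qed (use P.prob_space_distr[OF lift_measurable[OF c]] in \<open>auto simp: prob_space_def P.finite_measure_axioms\<close>)

lemma lift_automorphism:
  assumes c: "compatible \<tau>"
  shows "automorphism P (lift \<tau>)" and "\<And>x. x \<in> \<Omega> \<Longrightarrow> inv_into \<Omega> (lift \<tau>) x = lift (inv_family \<tau>) x"
  using automorphismI[OF lift_measurable[OF c] lift_measurable[OF compatible_inv_family[OF c]] _ _ distr_lift[OF c]]
    lift_inv_family[OF c] by simp_all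

lemma level_L2: "(\<lambda>x. c (pos n x)) \<in> L2_funs P"
proof (rule P.L2_bounded[where B="\<Sum>k<H n. cmod (c k)"])
  show "(\<lambda>x. c (pos n x)) \<in> borel_measurable P" by (rule measurable_compose[OF pos_measurable_P]) simp
  show "cmod (c (pos n x)) \<le> (\<Sum>k<H n. cmod (c k))" if "x \<in> space P" for x
    using that pos_less[of x n] member_le_sum[of "pos n x" "{..<H n}" "\<lambda>k. cmod (c k)"] by simp
qed

text \<open>Cylinder indicators are functions of an address, and any two addresses are functions of
  a common longer one. Functions of finite addresses thus form a linear space to which approximation
  from cylinders applies.\<close>

lemma level_dense:
  assumes h: "h \<in> L2_funs P" and e: "e > 0"
  shows "\<exists>n c. L2_seminorm P (\<lambda>x. h x - c (pos n x)) < e"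
proof -
  define V where "V = {v. \<exists>n c. \<forall>x\<in>\<Omega>. v x = (c (pos n x) :: complex)}"
  have VL: "V \<subseteq> L2_funs P"
  proof
    fix v assume "v \<in> V"
    then obtain n c where v: "\<And>x. x \<in> \<Omega> \<Longrightarrow> v x = c (pos n x)" by (auto simp: V_def)
    have "v \<in> borel_measurable P \<longleftrightarrow> (\<lambda>x. c (pos n x)) \<in> borel_measurable P"
      by (rule measurable_cong) (simp add: v)
    moreover have "integrable P (\<lambda>x. (cmod (v x))\<^sup>2) \<longleftrightarrow> integrable P (\<lambda>x. (cmod (c (pos n x)))\<^sup>2)"
      by (rule Bochner_Integration.integrable_cong) (simp_all add: v)
    ultimately show "v \<in> L2_funs P" using level_L2[of c n] by (simp add: L2_funs_def)
  qed
  have V2: "(\<lambda>x. op (v x) (w x)) \<in> V" if "v \<in> V" "w \<in> V" for op v w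
  proof -
    obtain n c n' c' where v: "\<And>x. x \<in> \<Omega> \<Longrightarrow> v x = c (pos n x)" and w: "\<And>x. x \<in> \<Omega> \<Longrightarrow> w x = c' (pos n' x)"
      using \<open>v \<in> V\<close> \<open>w \<in> V\<close> by (auto simp: V_def)
    define k where "k = max n n'"
    have "op (v x) (w x) = op (c (pos k x mod H n)) (c' (pos k x mod H n'))" if "x \<in> \<Omega>" for x
      using that by (simp add: v w k_def pos_mod)
    then show ?thesis unfolding V_def by (intro CollectI exI[of _ k] exI[of _ "\<lambda>i. op (c (i mod H n)) (c' (i mod H n'))"]) simp
  qed
  have Vc: "(\<lambda>x. a) \<in> V" for a unfolding V_def by (intro CollectI exI[of _ 0] exI[of _ "\<lambda>_. a"]) simp
  have ind: "\<exists>v\<in>V. L2_seminorm P (\<lambda>x. v x - indicator A x) < d" if A: "A \<in> sets P" and d: "d > 0" for A d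
  proof -
    have "\<exists>v\<in>V. \<forall>\<kappa>\<in>{P}. L2_seminorm \<kappa> (\<lambda>x. v x - indicator A x) < d"
    proof (rule L2_indicator_approx[where \<Omega>=\<Omega> and G="insert {} cylinders"])
      show "sets \<kappa> = sigma_sets \<Omega> (insert {} cylinders)" "finite_measure \<kappa>" if "\<kappa> \<in> {P}" for \<kappa>
        using that by (simp_all add: sets_\<Sigma> P.finite_measure_axioms)
      show "A \<in> sigma_sets \<Omega> (insert {} cylinders)" using A by (simp add: sets_\<Sigma>)
      fix B and d :: real assume B: "B \<in> insert {} cylinders" and d: "d > 0"
      have "(\<lambda>x. indicator B x) \<in> V"
      proof -
        consider "B = {}" | n k where "B = {x \<in> \<Omega>. pos n x = k}" using B by (auto simp: cylinders_def)
        then show ?thesis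
        proof cases
          case 2
          then show ?thesis unfolding V_def by (intro CollectI exI[of _ n] exI[of _ "\<lambda>i. indicator {k} i"]) (auto simp: indicator_def)
        qed (simp add: Vc)
      qed
      then show "\<exists>v\<in>V. \<forall>\<kappa>\<in>{P}. L2_seminorm \<kappa> (\<lambda>x. v x - indicator B x) < d"
        using d by (intro bexI[of _ "\<lambda>x. indicator B x"]) (simp_all add: L2_seminorm_def)
    qed (use VL d Int_stable_cylinders cylinders_Pow Vc V2[of _ _ "(+)"] V2[of _ _ "(-)"] in \<open>auto simp: subset_iff\<close>)
    then show ?thesis by simp
  qed
  have "\<exists>v\<in>V. L2_seminorm P (\<lambda>x. h x - v x) < e"
    by (rule L2_dense_of_indicators[OF VL Vc _ _ P.finite_measure_axioms ind h e])
      (use V2[of _ _ "(+)"] V2[OF Vc, of _ "(*)"] in auto)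
  then obtain v n c where v: "L2_seminorm P (\<lambda>x. h x - v x) < e" "\<And>x. x \<in> \<Omega> \<Longrightarrow> v x = c (pos n x)"
    by (auto simp: V_def)
  have "L2_seminorm P (\<lambda>x. h x - c (pos n x)) = L2_seminorm P (\<lambda>x. h x - v x)"
    by (rule L2_seminorm_cong) (simp add: v)
  then show ?thesis using v(1) by (intro exI[of _ n] exI[of _ c]) simp
qed

end

section \<open>The skew product over the odometer\<close>

text \<open>Digit 0 has two values and serves as the group coordinate \<open>g\<close>; the digits
  from 1 on form the odometer, with heights \<open>L n\<close> and positions \<open>s n\<close>. One
  mixed radix system thus holds the whole skew product, and \<epsilon> lists the signs of the
  blocks.\<close>

locale skew_odometer = mixed_radix +
  fixes \<epsilon> :: "nat \<Rightarrow> nat \<Rightarrow> bool"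
  assumes m_0: "m 0 = 2"
begin

definition L :: "nat \<Rightarrow> nat" where "L n = (\<Prod>i<n. m (Suc i))"
definition s :: "nat \<Rightarrow> (nat \<Rightarrow> nat) \<Rightarrow> nat" where "s n x = (\<Sum>i<n. L i * x (Suc i))"
definition g :: "(nat \<Rightarrow> nat) \<Rightarrow> bool" where "g x = odd (x 0)"

text \<open>Truth values stand for the group of order two, with \<open>\<noteq>\<close> as addition.
  The pattern of level n + 1 is a row of copies of the pattern of level n, copy b being inverted if
  \<open>\<epsilon> n b\<close> holds.\<close>

fun u :: "nat \<Rightarrow> nat \<Rightarrow> bool" where
  "u 0 k = False"
| "u (Suc n) k = (u n (k mod L n) \<noteq> \<epsilon> n (k div L n))"

lemma L_0 [simp]: "L 0 = 1" and L_Suc: "L (Suc n) = L n * m (Suc n)" by (simp_all add: L_def)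
lemma L_pos [simp]: "0 < L n" by (induction n) (auto simp: L_Suc)
lemma H_L: "H (Suc n) = 2 * L n" by (induction n) (simp_all add: H_Suc L_Suc m_0)
lemma s_0 [simp]: "s 0 x = 0" and s_Suc: "s (Suc n) x = s n x + L n * x (Suc n)" by (simp_all add: s_def)
lemma pos_s: "pos (Suc n) x = x 0 + 2 * s n x"
  by (induction n) (simp_all add: pos_Suc[of "Suc _"] pos_Suc[of 0] s_Suc H_L algebra_simps)

lemma x0_less: "x \<in> \<Omega> \<Longrightarrow> x 0 < 2" using m_0 by (auto simp: \<Omega>_def dest: spec[of _ 0])
lemma pos_div2: "x \<in> \<Omega> \<Longrightarrow> pos (Suc n) x div 2 = s n x" using x0_less[of x] by (simp add: pos_s)
lemma odd_pos: "odd (pos (Suc n) x) = g x" by (simp add: pos_s g_def)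
lemma s_less: "x \<in> \<Omega> \<Longrightarrow> s n x < L n" using pos_less[of x "Suc n"] by (simp add: pos_s H_L)
lemma s_Suc_mod: "x \<in> \<Omega> \<Longrightarrow> s (Suc n) x mod L n = s n x"
  and s_Suc_div: "x \<in> \<Omega> \<Longrightarrow> s (Suc n) x div L n = x (Suc n)"
  using s_less[of x n] by (simp_all add: s_Suc)
lemma pos_sg: "x \<in> \<Omega> \<Longrightarrow> pos (Suc n) x = 2 * s n x + of_bool (g x)"
  using x0_less[of x] by (cases "x 0 = 0") (auto simp: pos_s g_def less_2_cases_iff)

lemma s_set_in_sets: "{x \<in> \<Omega>. Q (s n x) (g x)} \<in> sets P"
proof -
  have "{x \<in> \<Omega>. Q (s n x) (g x)} = {x \<in> \<Omega>. pos (Suc n) x \<in> {k. Q (k div 2) (odd k)}}"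
    using pos_div2 odd_pos by auto
  then show ?thesis by (simp only: pos_set_in_sets)
qed

text \<open>Any level whose tower contains the next step may be consulted, and all of them agree. A
  point that is at the top of every tower receives the value False.\<close>

definition \<phi> :: "(nat \<Rightarrow> nat) \<Rightarrow> bool" where
  "\<phi> x \<longleftrightarrow> (\<exists>n. s n x + 1 < L n \<and> u n (s n x) \<noteq> u n (s n x + 1))"

text \<open>The cocycle is a coboundary of \<open>u n\<close> as long as the orbit stays inside the tower of level \<open>n\<close>.\<close>

lemma \<phi>_eq:
  assumes x: "x \<in> \<Omega>" and n: "s n x + 1 < L n"
  shows "\<phi> x \<longleftrightarrow> u n (s n x) \<noteq> u n (s n x + 1)"
proof -
  have step: "s (Suc k) x + 1 < L (Suc k) \<and> (u (Suc k) (s (Suc k) x) \<noteq> u (Suc k) (s (Suc k) x + 1)) = (u k (s k x) \<noteq> u k (s k x + 1))"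
    if k: "s k x + 1 < L k" for k
  proof -
    have "x (Suc k) + 1 \<le> m (Suc k)" using x by (auto simp: \<Omega>_def Suc_le_eq)
    then have "L k * (x (Suc k) + 1) \<le> L k * m (Suc k)" by (rule mult_le_mono2)
    then have 1: "s (Suc k) x + 1 < L (Suc k)" using k by (simp add: s_Suc L_Suc algebra_simps)
    have e: "s (Suc k) x + 1 = (s k x + 1) + L k * x (Suc k)" by (simp add: s_Suc)
    have "(s (Suc k) x + 1) mod L k = s k x + 1" "(s (Suc k) x + 1) div L k = x (Suc k)"
      unfolding e using k div_mult_self2[of "L k" "s k x + 1" "x (Suc k)"] by simp_all
    then show ?thesis using 1 s_Suc_mod[OF x, of k] s_Suc_div[OF x, of k] by auto
  qed
  have all: "s k x + 1 < L k \<and> (u k (s k x) \<noteq> u k (s k x + 1)) = (u j (s j x) \<noteq> u j (s j x + 1))"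
    if "s j x + 1 < L j" "j \<le> k" for j k
    using that(2) by (induction k rule: dec_induct) (use that(1) step in \<open>auto simp del: u.simps\<close>)
  show ?thesis
  proof
    assume "\<phi> x"
    then obtain j where "s j x + 1 < L j" "u j (s j x) \<noteq> u j (s j x + 1)" by (auto simp: \<phi>_def)
    then show "u n (s n x) \<noteq> u n (s n x + 1)" using all[of j n] all[of n j] n by (cases "j \<le> n") auto
  qed (use n in \<open>auto simp: \<phi>_def\<close>)
qed

definition flip :: "(nat \<Rightarrow> nat) \<Rightarrow> nat \<Rightarrow> nat" where "flip x = x(0 := 1 - x 0)"
definition cflip :: "(nat \<Rightarrow> nat) \<Rightarrow> nat \<Rightarrow> nat" where "cflip x = (if \<phi> x then flip x else x)"
text \<open>Adding 2 leaves digit 0 unchanged and adds 1 to the odometer formed by the other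
  digits.\<close>

definition odo :: "(nat \<Rightarrow> nat) \<Rightarrow> nat \<Rightarrow> nat" where "odo = lift (\<lambda>n k. (k + 2) mod H n)"
definition S :: "(nat \<Rightarrow> nat) \<Rightarrow> nat \<Rightarrow> nat" where "S x = odo (cflip x)"

lemma compatible_odo: "compatible (\<lambda>n k. (k + 2) mod H n)"
  unfolding compatible_def
proof (intro conjI allI impI)
  fix n
  have le: "a = b" if ab: "a \<le> b" "b < H n" "(b + 2) mod H n = (a + 2) mod H n" for a b
  proof -
    have "H n dvd (b + 2) - (a + 2)" using mod_eq_dvd_iff_nat[of "a + 2" "b + 2" "H n"] ab by simp
    then have "H n dvd b - a" by simp
    then show ?thesis using ab dvd_imp_le[of "H n" "b - a"] by (cases "b - a = 0") auto
  qed
  have "inj_on (\<lambda>k. (k + 2) mod H n) {..<H n}"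
  proof (rule inj_onI)
    fix a b assume "a \<in> {..<H n}" "b \<in> {..<H n}" "(a + 2) mod H n = (b + 2) mod H n"
    then show "a = b" using le[of a b] le[of b a] by (cases "a \<le> b") auto
  qed
  then show "bij_betw (\<lambda>k. (k + 2) mod H n) {..<H n} {..<H n}"
    unfolding bij_betw_def by (intro conjI endo_inj_surj) auto
  fix k
  have "(k + 2) mod H (Suc n) mod H n = (k + 2) mod H n" by (rule mod_mod_cancel) (simp add: H_Suc)
  also have "\<dots> = (k mod H n + 2) mod H n" by (rule mod_add_left_eq[symmetric])
  finally show "(k + 2) mod H (Suc n) mod H n = (k mod H n + 2) mod H n" .
qed

lemma s_flip [simp]: "s n (flip x) = s n x" by (simp add: s_def flip_def)
lemma flip_\<Omega>: "x \<in> \<Omega> \<Longrightarrow> flip x \<in> \<Omega>" using m_0 by (auto simp: \<Omega>_def flip_def)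
lemma flip_flip: "x \<in> \<Omega> \<Longrightarrow> flip (flip x) = x" using x0_less[of x] by (auto simp: flip_def fun_eq_iff)
lemma g_flip: "x \<in> \<Omega> \<Longrightarrow> g (flip x) \<longleftrightarrow> \<not> g x" using x0_less[of x] by (auto simp: flip_def g_def less_2_cases_iff)
lemma \<phi>_flip [simp]: "\<phi> (flip x) = \<phi> x" by (simp add: \<phi>_def)

lemma flip_measurable: "flip \<in> measurable P P"
proof -
  have c: "(\<lambda>x. x j) \<in> measurable P (count_space UNIV)" for j
    using coordinate_measurable by (simp add: measurable_cong_sets[OF sets_P refl])
  have "(\<lambda>x. flip x j) \<in> measurable P (count_space UNIV)" for j
  proof (cases "j = 0")
    case True
    have "(\<lambda>x. 1 - x 0) \<in> measurable P (count_space UNIV)" by (rule measurable_compose[OF c]) simp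
    then show ?thesis using True by (simp add: flip_def)
  qed (simp add: flip_def c)
  then have "flip \<in> measurable P \<Sigma>" by (intro measurable_\<Sigma>I) (auto simp: flip_\<Omega>)
  then show ?thesis by (simp add: measurable_cong_sets[OF refl sets_P])
qed

lemma distr_flip: "distr P P flip = P"
proof (rule measure_unique)
  fix n k assume k: "k < H n"
  have set: "{x \<in> \<Omega>. pos n x = k} \<in> sets P" using pos_set_in_sets[of n "{k}"] by simp
  have "emeasure (distr P P flip) {x \<in> \<Omega>. pos n x = k} = emeasure P (flip -` {x \<in> \<Omega>. pos n x = k} \<inter> space P)"
    by (rule emeasure_distr[OF flip_measurable set])
  also have "\<dots> = emeasure P {x \<in> \<Omega>. pos n x = k}"
  proof (cases n)
    case 0
    then show ?thesis using flip_\<Omega> by (intro arg_cong[where f="emeasure P"]) auto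
  next
    case (Suc n')
    define k' where "k' = 2 * (k div 2) + of_bool (even k)"
    have k': "k' < H n" using k unfolding Suc H_L k'_def by (cases "even k") auto
    have "flip -` {x \<in> \<Omega>. pos n x = k} \<inter> space P = {x \<in> \<Omega>. pos n x = k'}"
    proof (intro set_eqI iffI)
      fix x assume "x \<in> flip -` {x \<in> \<Omega>. pos n x = k} \<inter> space P"
      then have "x \<in> \<Omega>" "2 * s n' x + of_bool (\<not> g x) = k" by (auto simp: Suc pos_sg g_flip flip_\<Omega>)
      then show "x \<in> {x \<in> \<Omega>. pos n x = k'}" by (cases "g x") (auto simp: Suc pos_sg k'_def)
    next
      fix x assume "x \<in> {x \<in> \<Omega>. pos n x = k'}"
      then have x: "x \<in> \<Omega>" "2 * s n' x + of_bool (g x) = k'" by (auto simp: Suc pos_sg)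
      have "2 * s n' x + of_bool (\<not> g x) = k" using x(2) unfolding k'_def by (cases "g x"; cases "even k") (auto; presburger)+
      then show "x \<in> flip -` {x \<in> \<Omega>. pos n x = k} \<inter> space P" using x(1) by (auto simp: Suc pos_sg g_flip flip_\<Omega>)
    qed
    then show ?thesis using k k' by (simp add: emeasure_cylinder)
  qed
  finally show "emeasure (distr P P flip) {x \<in> \<Omega>. pos n x = k} = emeasure P {x \<in> \<Omega>. pos n x = k}" .
qed (use P.prob_space_distr[OF flip_measurable] in \<open>auto simp: prob_space_def P.finite_measure_axioms\<close>)

lemma \<phi>_sets: "{x \<in> \<Omega>. \<phi> x} \<in> sets P"
proof -
  have "{x \<in> \<Omega>. \<phi> x} = (\<Union>n. {x \<in> \<Omega>. s n x + 1 < L n \<and> u n (s n x) \<noteq> u n (s n x + 1)})" by (auto simp: \<phi>_def)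
  also have "\<dots> \<in> sets P" by (intro sets.countable_UN) (use s_set_in_sets[where Q="\<lambda>k _. k + 1 < L n \<and> u n k \<noteq> u n (k + 1)" and n=n for n] in auto)
  finally show ?thesis .
qed

text \<open>The cocycle does not see digit 0, so the set where it holds is invariant under
  \<open>flip\<close>. Hence \<open>cflip\<close> is an involution that acts as a measure-preserving
  map on this set and as the identity off it.\<close>

lemma cflip_automorphism: "automorphism P cflip"
proof (rule automorphismI(1))
  have pr: "Measurable.pred P \<phi>" unfolding pred_def using \<phi>_sets by simp
  show m: "cflip \<in> measurable P P"
    unfolding cflip_def[abs_def] using pr flip_measurable by measurable
  then show "cflip \<in> measurable P P" .
  show "cflip (cflip x) = x" if "x \<in> space P" for x using that by (simp add: cflip_def flip_flip)
  then show "cflip (cflip x) = x" if "x \<in> space P" for x using that by blast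
  show "distr P P cflip = P"
  proof (rule measure_eqI)
    fix A assume "A \<in> sets (distr P P cflip)"
    then have A: "A \<in> sets P" by simp
    let ?F = "{x \<in> \<Omega>. \<phi> x}"
    have A\<Omega>: "A \<subseteq> \<Omega>" using sets.sets_into_space[OF A] by simp
    have "emeasure (distr P P cflip) A = emeasure P (cflip -` A \<inter> space P)" by (rule emeasure_distr[OF m A])
    also have "cflip -` A \<inter> space P = (flip -` (A \<inter> ?F) \<inter> space P) \<union> (A - ?F)"
      using A\<Omega> flip_\<Omega> by (auto simp: cflip_def split: if_splits)
    also have "emeasure P \<dots> = emeasure P (flip -` (A \<inter> ?F) \<inter> space P) + emeasure P (A - ?F)"
      by (rule plus_emeasure[symmetric])
        (use A \<phi>_sets measurable_sets[OF flip_measurable, of "A \<inter> ?F"] in auto)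
    also have "emeasure P (flip -` (A \<inter> ?F) \<inter> space P) = emeasure (distr P P flip) (A \<inter> ?F)"
      using A \<phi>_sets by (intro emeasure_distr[symmetric] flip_measurable) auto
    also have "\<dots> + emeasure P (A - ?F) = emeasure P ((A \<inter> ?F) \<union> (A - ?F))"
      unfolding distr_flip by (rule plus_emeasure) (use A \<phi>_sets in auto)
    also have "(A \<inter> ?F) \<union> (A - ?F) = A" by auto
    finally show "emeasure (distr P P cflip) A = emeasure P A" .
  qed simp
qed

lemma S_automorphism: "automorphism P S"
  unfolding S_def[abs_def] odo_def by (rule automorphism_comp[OF lift_automorphism(1)[OF compatible_odo] cflip_automorphism])

sublocale S: automorphism_space P S
  by unfold_locales (rule S_automorphism)

lemma S_step:
  assumes x: "x \<in> \<Omega>"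
  shows "s n (S x) = (s n x + 1) mod L n" "g (S x) = (g x \<noteq> \<phi> x)" "S x \<in> \<Omega>"
proof -
  have c: "cflip x \<in> \<Omega>" "s n (cflip x) = s n x" "g (cflip x) = (g x \<noteq> \<phi> x)" for n
    using flip_\<Omega>[OF x] g_flip[OF x] x by (auto simp: cflip_def)
  show o: "S x \<in> \<Omega>" unfolding S_def odo_def by (rule lift_\<Omega>[OF compatible_odo c(1)])
  have p: "pos (Suc n) (S x) = (pos (Suc n) (cflip x) + 2) mod H (Suc n)" for n
    unfolding S_def odo_def by (rule pos_lift[OF compatible_odo c(1)])
  have "odd (pos (Suc 0) (S x)) = odd (pos (Suc 0) (cflip x))" unfolding p H_L by simp
  then show "g (S x) = (g x \<noteq> \<phi> x)" unfolding odd_pos c(3) .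
  have "s n (S x) = ((pos (Suc n) (cflip x) + 2) mod (2 * L n)) div 2"
    using pos_div2[OF o, of n] by (simp add: p H_L)
  also have "\<dots> = ((pos (Suc n) (cflip x) + 2) div 2) mod L n"
    by (simp add: mod_mult2_eq)
  also have "(pos (Suc n) (cflip x) + 2) div 2 = s n x + 1" using pos_div2[OF c(1), of n] c(2) by simp
  finally show "s n (S x) = (s n x + 1) mod L n" .
qed

lemma S_power_\<Omega>: "x \<in> \<Omega> \<Longrightarrow> (S ^^ k) x \<in> \<Omega>" by (induction k) (auto simp: S_step)

lemma s_power: "x \<in> \<Omega> \<Longrightarrow> s n ((S ^^ k) x) = (s n x + k) mod L n"
proof (induction k)
  case 0
  then show ?case using s_less by simp
next
  case (Suc k)
  then show ?case using S_step(1)[OF S_power_\<Omega>[OF Suc(2)], of n k] by (simp add: mod_Suc_eq)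
qed

text \<open>Inside the tower the cocycle is a coboundary, so its sum along the orbit telescopes. The
  hypothesis on \<open>k\<close> keeps the orbit below the top.\<close>

lemma g_power:
  assumes x: "x \<in> \<Omega>"
  shows "s n x + k < L n \<Longrightarrow> g ((S ^^ k) x) = (g x \<noteq> (u n (s n x) \<noteq> u n (s n x + k)))"
proof (induction k)
  case (Suc k)
  let ?y = "(S ^^ k) x"
  have y: "?y \<in> \<Omega>" "s n ?y = s n x + k" using S_power_\<Omega>[OF x] s_power[OF x, of n k] Suc(2) by simp_all
  have "g (S ?y) = (g ?y \<noteq> (u n (s n ?y) \<noteq> u n (s n ?y + 1)))"
    using S_step(2)[OF y(1)] \<phi>_eq[OF y(1), of n] y(2) Suc(2) by simp
  then show ?case using Suc y(2) by auto
qed simp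

end

section \<open>Alternating blocks: approximate rank one and rigidity\<close>

lemma (in automorphism_space) ex_poly_op: "\<exists>Q. \<forall>x. poly_op Q b x = (\<Sum>k<n. d k * U (int k) b x)"
proof -
  define Q where "Q = (\<Sum>k<n. monom (d k) k)"
  have co: "coeff Q k = (if k < n then d k else 0)" for k
    by (simp add: Q_def coeff_sum coeff_monom)
  have "poly_op Q b x = (\<Sum>k<n. d k * U (int k) b x)" for x
  proof -
    have "(\<Sum>k\<le>degree Q. coeff Q k * U (int k) b x) = (\<Sum>k\<in>{..degree Q} \<union> {..<n}. coeff Q k * U (int k) b x)"
      by (rule sum.mono_neutral_left) (auto simp: coeff_eq_0)
    also have "\<dots> = (\<Sum>k<n. coeff Q k * U (int k) b x)"
      by (rule sum.mono_neutral_right) (auto simp: co)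
    finally show ?thesis by (simp add: poly_op_def co)
  qed
  then show ?thesis by blast
qed

lemma (in prob_space) L2_seminorm_le_off_small_set:
  assumes f: "f \<in> L2_funs M" and A: "A \<in> sets M" and B: "0 \<le> B"
    and le: "\<And>x. x \<in> space M \<Longrightarrow> cmod (f x) \<le> B * indicator A x"
  shows "L2_seminorm M f \<le> B * sqrt (prob A)"
proof -
  have "(L2_seminorm M f)\<^sup>2 \<le> (\<integral>x. B\<^sup>2 * indicator A x \<partial>M)"
    unfolding L2_seminorm_square
  proof (rule integral_mono)
    show "(cmod (f x))\<^sup>2 \<le> B\<^sup>2 * indicator A x" if "x \<in> space M" for x
      using power_mono[OF le[OF that] norm_ge_zero, where n=2] by (auto simp: indicator_def split: if_splits)
    show "integrable M (\<lambda>x. B\<^sup>2 * indicator A x)"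
      by (intro integrable_mult_right integrable_real_indicator A) (simp add: emeasure_eq_measure)
  qed (rule L2_funsD(2)[OF f])
  also have "\<dots> = (B * sqrt (prob A))\<^sup>2" using A sets.sets_into_space[OF A] by (simp add: power_mult_distrib Int_absorb1)
  finally show ?thesis by (rule power2_le_imp_le) (simp add: B)
qed

context skew_odometer begin

text \<open>Block b is followed by two more blocks with alternating signs. Advancing by one block
  exchanges the two sheets relative to the pattern, advancing by two restores them, so 2 L_n steps
  traverse both sheets of the tower.\<close>

definition good :: "nat \<Rightarrow> nat \<Rightarrow> bool" where
  "good n b \<longleftrightarrow> b + 2 < m (Suc n) \<and> \<epsilon> n (b + 1) \<noteq> \<epsilon> n b \<and> \<epsilon> n (b + 2) = \<epsilon> n b"

definition bad :: "nat \<Rightarrow> (nat \<Rightarrow> nat) set" where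
  "bad n = {x \<in> \<Omega>. \<not> good n (x (Suc n))}"

lemma bad_sets: "bad n \<in> sets P"
proof -
  have "bad n = {x \<in> \<Omega>. \<not> good n (s (Suc n) x div L n)}" using s_Suc_div by (auto simp: bad_def)
  then show ?thesis using s_set_in_sets[of "\<lambda>k _. \<not> good n (k div L n)" "Suc n"] by simp
qed

text \<open>Since a good block has two successors in the tower of level n + 1, an orbit segment that
  ends before the third block boundary stays in this tower. There \<open>u (Suc n)\<close> splits
  into the pattern of level n and the block sign.\<close>

lemma g_tower:
  assumes x: "x \<in> \<Omega>" and good: "good n (x (Suc n))" and k: "s n x + k < 3 * L n"
  shows "g ((S ^^ k) x) = (g x \<noteq> ((u n (s n x) \<noteq> \<epsilon> n (x (Suc n))) \<noteq>
     (u n ((s n x + k) mod L n) \<noteq> \<epsilon> n (x (Suc n) + (s n x + k) div L n))))"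
proof -
  define b where "b = x (Suc n)"
  have sS: "s (Suc n) x = s n x + L n * b" by (simp add: s_Suc b_def)
  have "b + 3 \<le> m (Suc n)" using good by (simp add: good_def b_def)
  then have "L n * (b + 3) \<le> L n * m (Suc n)" by (rule mult_le_mono2)
  then have "s (Suc n) x + k < L (Suc n)" using k by (simp add: sS L_Suc algebra_simps)
  from g_power[OF x this] have "g ((S ^^ k) x) = (g x \<noteq> (u (Suc n) (s (Suc n) x) \<noteq> u (Suc n) (s (Suc n) x + k)))" .
  moreover have "u (Suc n) (s (Suc n) x) = (u n (s n x) \<noteq> \<epsilon> n b)"
    using s_less[OF x, of n] by (simp add: sS)
  moreover have "u (Suc n) (s (Suc n) x + k) = (u n ((s n x + k) mod L n) \<noteq> \<epsilon> n (b + (s n x + k) div L n))"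
  proof -
    have "s (Suc n) x + k = (s n x + k) + L n * b" by (simp add: sS)
    moreover have "((s n x + k) + L n * b) div L n = b + (s n x + k) div L n" by (rule div_mult_self2) simp
    ultimately have "(s (Suc n) x + k) mod L n = (s n x + k) mod L n" "(s (Suc n) x + k) div L n = b + (s n x + k) div L n"
      by (simp_all only: mod_mult_self2)
    then show ?thesis by simp
  qed
  ultimately show ?thesis by (simp add: b_def)
qed

text \<open>The top floor of one sheet, the sheet being selected by comparison with
  \<open>u n\<close>. The Koopman operator evaluates at forward iterates and forward orbits climb,
  so non-negative powers applied to the top floor reach every floor.\<close>

definition base :: "nat \<Rightarrow> (nat \<Rightarrow> nat) \<Rightarrow> complex" where
  "base n = indicator {x \<in> \<Omega>. s n x = L n - 1 \<and> g x = u n (s n x)}"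

lemma base_L2: "base n \<in> L2_funs P"
proof (rule P.L2_bounded[where B=1])
  show "base n \<in> borel_measurable P" unfolding base_def
    by (rule borel_measurable_indicator) (rule s_set_in_sets)
qed (auto simp: base_def indicator_def)

text \<open>Levels \<open>0, \<dots>, L n - 1\<close> of the tower and their flipped copies are visited one after the other, up to the
  bad set; this is the rank one structure that produces simple spectrum.\<close>

lemma level_poly_op:
  assumes B: "\<And>k. cmod (c k) \<le> B"
  shows "\<exists>Q. (\<forall>x\<in>\<Omega>. good n (x (Suc n)) \<longrightarrow> S.poly_op Q (base n) x = c (pos (Suc n) x)) \<and>
    (\<forall>x\<in>\<Omega>. cmod (S.poly_op Q (base n) x) \<le> 2 * B)"
proof -
  define l where "l = L n"
  have l: "l > 0" by (simp add: l_def)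
  \<comment> \<open>A point at height s is on the top floor after l - 1 - s steps and again l steps
    later. From a good block exactly one of the two visits is on the selected sheet. Its time
    reveals both height and sheet of the starting point, and the coefficient is the value of
    \<open>c\<close> at that address.\<close>
  define d where "d k = (if k < l then c (2 * (l - 1 - k) + of_bool (u n (l - 1 - k)))
     else c (2 * (2 * l - 1 - k) + of_bool (\<not> u n (2 * l - 1 - k))))" for k
  obtain Q where Q: "\<And>x. S.poly_op Q (base n) x = (\<Sum>k<2 * l. d k * S.U (int k) (base n) x)"
    using S.ex_poly_op[where b="base n" and n="2 * l" and d=d] by blast
  have sum: "S.poly_op Q (base n) x = d (l - 1 - s n x) * base n ((S ^^ (l - 1 - s n x)) x) + d (2 * l - 1 - s n x) * base n ((S ^^ (2 * l - 1 - s n x)) x)"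
    if x: "x \<in> \<Omega>" for x
  proof -
    have sl: "s n x < l" using s_less[OF x] by (simp add: l_def)
    have z: "base n ((S ^^ k) x) = 0" if k: "k < 2 * l" "k \<notin> {l - 1 - s n x, 2 * l - 1 - s n x}" for k
    proof -
      have "(s n x + k) mod l \<noteq> l - 1"
      proof
        assume e: "(s n x + k) mod l = l - 1"
        define q where "q = (s n x + k) div l"
        have eq: "s n x + k = l * q + (l - 1)" using mult_div_mod_eq[of l "s n x + k"] e by (simp add: q_def)
        have "q < 2"
        proof (rule ccontr)
          assume "\<not> q < 2"
          then have "l * 2 \<le> l * q" by (intro mult_le_mono2) simp
          then show False using eq sl k(1) by linarith
        qed
        then consider "q = 0" | "q = 1" by linarith
        then show False using eq k(2) sl by cases auto
      qed
      then show ?thesis using s_power[OF x, of n k] by (simp add: base_def l_def)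
    qed
    have "S.poly_op Q (base n) x = (\<Sum>k<2 * l. d k * base n ((S ^^ k) x))"
      unfolding Q by (simp add: S.pw_nat)
    also have "\<dots> = (\<Sum>k\<in>{l - 1 - s n x, 2 * l - 1 - s n x}. d k * base n ((S ^^ k) x))"
      by (rule sum.mono_neutral_right) (use z sl in auto)
    also have "\<dots> = d (l - 1 - s n x) * base n ((S ^^ (l - 1 - s n x)) x) + d (2 * l - 1 - s n x) * base n ((S ^^ (2 * l - 1 - s n x)) x)"
      using sl l by simp
    finally show ?thesis .
  qed
  have "S.poly_op Q (base n) x = c (pos (Suc n) x)" if x: "x \<in> \<Omega>" and gd: "good n (x (Suc n))" for x
  proof -
    have sl: "s n x < l" using s_less[OF x] by (simp add: l_def)
    let ?k0 = "l - 1 - s n x" and ?k1 = "2 * l - 1 - s n x"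
    have e0: "s n x + ?k0 = l - 1" and e1: "s n x + ?k1 = (l - 1) + l" using sl by auto
    have m0: "(s n x + ?k0) mod l = l - 1" "(s n x + ?k0) div l = 0" unfolding e0 using l by simp_all
    have m1: "(s n x + ?k1) mod l = l - 1" "(s n x + ?k1) div l = 1" unfolding e1 by (subst mod_add_self2, use l in simp) (subst div_add_self2, use l in simp_all)
    have l3: "s n x + ?k0 < 3 * L n" "s n x + ?k1 < 3 * L n" unfolding l_def[symmetric] e0 e1 using l by linarith+
    have E: "\<epsilon> n (x (Suc n) + 1) = (\<not> \<epsilon> n (x (Suc n)))" using gd by (auto simp: good_def)
    have g0: "g ((S ^^ ?k0) x) = (g x \<noteq> (u n (s n x) \<noteq> u n (l - 1)))"
      using g_tower[OF x gd l3(1)] m0 by (auto simp: l_def[symmetric])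
    have g1: "g ((S ^^ ?k1) x) = (g x \<noteq> (u n (s n x) \<noteq> (\<not> u n (l - 1))))"
      using g_tower[OF x gd l3(2)] m1 E by (auto simp: l_def[symmetric])
    have s0: "s n ((S ^^ ?k0) x) = l - 1" "s n ((S ^^ ?k1) x) = l - 1"
      using s_power[OF x, of n] m0 m1 by (simp_all add: l_def)
    have b0: "base n ((S ^^ ?k0) x) = of_bool (g x = u n (s n x))"
      using S_power_\<Omega>[OF x] s0 g0 by (auto simp: base_def indicator_def l_def[symmetric])
    have b1: "base n ((S ^^ ?k1) x) = of_bool (g x \<noteq> u n (s n x))"
      using S_power_\<Omega>[OF x] s0 g1 by (auto simp: base_def indicator_def l_def[symmetric])
    have d0: "d ?k0 = c (2 * s n x + of_bool (u n (s n x)))" using sl by (simp add: d_def)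
    have k1: "\<not> ?k1 < l" "2 * l - 1 - ?k1 = s n x" using sl by linarith+
    have d1: "d ?k1 = c (2 * s n x + of_bool (\<not> u n (s n x)))" unfolding d_def k1(2) using k1(1) by simp
    show ?thesis unfolding sum[OF x] b0 b1 d0 d1 pos_sg[OF x] by (cases "g x"; cases "u n (s n x)") auto
  qed
  moreover have "cmod (S.poly_op Q (base n) x) \<le> 2 * B" if x: "x \<in> \<Omega>" for x
  proof -
    have db: "cmod (d k * base n y) \<le> B" for k y
    proof -
      have "cmod (d k) \<le> B" by (simp add: d_def B)
      moreover have "cmod (base n y) \<le> 1" by (simp add: base_def indicator_def)
      ultimately have "cmod (d k) * cmod (base n y) \<le> B * 1" by (intro mult_mono) (auto intro: order_trans[OF norm_ge_zero])
      then show ?thesis by (simp add: norm_mult)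
    qed
    show ?thesis unfolding sum[OF x] using norm_triangle_mono[OF db db] by simp
  qed
  ultimately show ?thesis by blast
qed

text \<open>The bound does not involve \<open>n\<close>, so estimates stay uniform while
  \<open>n\<close> grows and the bad sets shrink.\<close>

lemma level_lower:
  fixes c :: "nat \<Rightarrow> complex"
  assumes n: "i \<le> n"
  obtains c' where "\<And>x. x \<in> \<Omega> \<Longrightarrow> c (pos i x) = c' (pos n x)" "\<And>k. cmod (c' k) \<le> (\<Sum>k<H i. cmod (c k))"
proof (rule that[of "\<lambda>k. c (k mod H i)"])
  show "c (pos i x) = c (pos n x mod H i)" if "x \<in> \<Omega>" for x using pos_mod[OF that n] by simp
  show "cmod (c (k mod H i)) \<le> (\<Sum>k<H i. cmod (c k))" for k
    using member_le_sum[of "k mod H i" "{..<H i}" "\<lambda>k. cmod (c k)"] by simp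
qed

context
  assumes bad_0: "(\<lambda>n. measure P (bad n)) \<longlonglongrightarrow> 0"
begin

lemma bad_eventually_small:
  assumes "e > 0"
  shows "\<exists>J. \<forall>n\<ge>J. B * sqrt (measure P (bad n)) < e"
proof -
  have "(\<lambda>n. B * sqrt (measure P (bad n))) \<longlonglongrightarrow> B * sqrt 0"
    by (intro tendsto_intros bad_0)
  from order_tendstoD(2)[OF this, of e] show ?thesis using assms by (simp add: eventually_sequentially)
qed

lemma base_approx:
  assumes h: "h \<in> L2_funs P" and e: "e > 0"
  shows "\<exists>J. \<forall>n\<ge>J. \<exists>Q. L2_seminorm P (\<lambda>x. h x - S.poly_op Q (base n) x) < e"
proof -
  obtain i c where c: "L2_seminorm P (\<lambda>x. h x - c (pos i x)) < e / 2" using level_dense[OF h, of "e/2"] e by auto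
  define B where "B = (\<Sum>k<H i. cmod (c k))"
  have B: "B \<ge> 0" by (simp add: B_def sum_nonneg)
  obtain J where J: "\<And>n. n \<ge> J \<Longrightarrow> (3 * B) * sqrt (measure P (bad n)) < e / 2"
    using bad_eventually_small[of "e/2" "3 * B"] e by auto
  have "\<exists>Q. L2_seminorm P (\<lambda>x. h x - S.poly_op Q (base n) x) < e" if n: "n \<ge> max i J" for n
  proof -
    have "i \<le> Suc n" using n by simp
    then obtain c' where c': "\<And>x. x \<in> \<Omega> \<Longrightarrow> c (pos i x) = c' (pos (Suc n) x)" "\<And>k. cmod (c' k) \<le> B"
      using level_lower[of i "Suc n" c] unfolding B_def by blast
    obtain Q where Q: "\<And>x. x \<in> \<Omega> \<Longrightarrow> good n (x (Suc n)) \<Longrightarrow> S.poly_op Q (base n) x = c' (pos (Suc n) x)"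
      "\<And>x. x \<in> \<Omega> \<Longrightarrow> cmod (S.poly_op Q (base n) x) \<le> 2 * B"
      using level_poly_op[where c=c' and B=B and n=n, OF c'(2)] by blast
    have pL: "S.poly_op Q (base n) \<in> L2_funs P" by (rule S.poly_op_L2[OF base_L2])
    \<comment> \<open>Off the bad set both functions agree. On it the level function contributes at
      most B and the polynomial at most 2 B.\<close>
    have "L2_seminorm P (\<lambda>x. c (pos i x) - S.poly_op Q (base n) x) \<le> (3 * B) * sqrt (measure P (bad n))"
    proof (rule P.L2_seminorm_le_off_small_set[OF L2_diff[OF level_L2 pL] bad_sets])
      fix x assume "x \<in> space P"
      then have x: "x \<in> \<Omega>" by simp
      show "cmod (c (pos i x) - S.poly_op Q (base n) x) \<le> 3 * B * indicator (bad n) x"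
      proof (cases "good n (x (Suc n))")
        case True
        then show ?thesis using x Q(1) c'(1) B by (simp add: bad_def)
      next
        case False
        have "cmod (c (pos i x) - S.poly_op Q (base n) x) \<le> cmod (c' (pos (Suc n) x)) + cmod (S.poly_op Q (base n) x)"
          unfolding c'(1)[OF x] by (rule norm_triangle_ineq4)
        also have "\<dots> \<le> B + 2 * B" by (intro add_mono c' Q x)
        finally show ?thesis using False x by (simp add: bad_def)
      qed
    qed (use B in simp)
    then have "L2_seminorm P (\<lambda>x. h x - S.poly_op Q (base n) x) < e"
      using L2_triangle_diff[OF h level_L2[of c i] pL] c J[of n] n by simp
    then show ?thesis by blast
  qed
  then show ?thesis by blast
qed

text \<open>The targets of the Baire argument are the indicators of all cylinders, enumerated
  through pairs of level and address.\<close>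

lemma S_simple_spectrum: "simple_spectrum P S"
proof (rule S.simple_spectrumI[where b=base and g="\<lambda>j. indicator {x \<in> \<Omega>. pos (fst (prod_decode j)) x = snd (prod_decode j)}"])
  show "indicator {x \<in> \<Omega>. pos (fst (prod_decode j)) x = snd (prod_decode j)} \<in> L2_funs P" for j
  proof (rule P.L2_bounded[where B=1])
    show "indicator {x \<in> \<Omega>. pos (fst (prod_decode j)) x = snd (prod_decode j)} \<in> borel_measurable P"
      using pos_set_in_sets[of "fst (prod_decode j)" "{snd (prod_decode j)}"] by (intro borel_measurable_indicator) simp
  qed (simp add: indicator_def)
next
  fix h and e :: real assume h: "h \<in> L2_funs P" and e: "e > 0"
  obtain n c where c: "L2_seminorm P (\<lambda>x. h x - c (pos n x)) < e" using level_dense[OF h e] by blast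
  let ?I = "(\<lambda>k. prod_encode (n, k)) ` {..<H n}"
  have "(\<Sum>j\<in>?I. c (snd (prod_decode j)) * indicator {x \<in> \<Omega>. pos (fst (prod_decode j)) x = snd (prod_decode j)} x) = c (pos n x)" if x: "x \<in> \<Omega>" for x
  proof -
    have inj: "inj_on (\<lambda>k. prod_encode (n, k)) {..<H n}" by (simp add: inj_on_def prod_encode_eq)
    have "(\<Sum>j\<in>?I. c (snd (prod_decode j)) * indicator {x \<in> \<Omega>. pos (fst (prod_decode j)) x = snd (prod_decode j)} x)
       = (\<Sum>k<H n. if k = pos n x then c k else 0)"
      unfolding sum.reindex[OF inj] comp_def by (intro sum.cong) (auto simp: indicator_def x)
    then show ?thesis using pos_less[OF x, of n] by simp
  qed
  then have "L2_seminorm P (\<lambda>x. h x - (\<Sum>j\<in>?I. c (snd (prod_decode j)) * indicator {x \<in> \<Omega>. pos (fst (prod_decode j)) x = snd (prod_decode j)} x)) < e"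
    using c L2_seminorm_cong[of P "\<lambda>x. h x - (\<Sum>j\<in>?I. c (snd (prod_decode j)) * indicator {x \<in> \<Omega>. pos (fst (prod_decode j)) x = snd (prod_decode j)} x)" "\<lambda>x. h x - c (pos n x)"]
    by simp
  then show "\<exists>I c. finite I \<and> L2_seminorm P (\<lambda>x. h x - (\<Sum>j\<in>I. c j * indicator {x \<in> \<Omega>. pos (fst (prod_decode j)) x = snd (prod_decode j)} x)) < e"
    by (intro exI[of _ ?I] exI[of _ "\<lambda>j. c (snd (prod_decode j))"]) simp
qed (use base_L2 base_approx in auto)

text \<open>In 2 L_n steps the orbit advances by exactly two blocks. The sign of block b + 2 equals
  that of block b, so the sheet is restored together with the height.\<close>

lemma pos_return:
  assumes x: "x \<in> \<Omega>" and gd: "good n (x (Suc n))"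
  shows "pos (Suc n) ((S ^^ (2 * L n)) x) = pos (Suc n) x"
proof -
  have "s n ((S ^^ (2 * L n)) x) = s n x" using s_power[OF x, of n "2 * L n"] s_less[OF x, of n] by simp
  moreover have "(s n x + 2 * L n) div L n = 2" "(s n x + 2 * L n) mod L n = s n x"
    using s_less[OF x, of n] by simp_all
  then have "g ((S ^^ (2 * L n)) x) = g x"
    using g_tower[OF x gd, of "2 * L n"] s_less[OF x, of n] gd by (auto simp: good_def)
  ultimately show ?thesis using pos_sg[OF S_power_\<Omega>[OF x], of n "2 * L n"] pos_sg[OF x, of n] by simp
qed

text \<open>A function of finitely many digits is unchanged by these powers off the bad set. Such
  functions are dense and the operators are isometries, which extends the convergence to all of
  L2.\<close>

lemma S_rigid:
  assumes h: "h \<in> L2_funs P"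
  shows "(\<lambda>n. L2_seminorm P (\<lambda>x. S.U (int (2 * L n)) h x - h x)) \<longlonglongrightarrow> 0"
proof (rule LIMSEQ_I)
  fix e :: real assume e: "e > 0"
  obtain i c where c: "L2_seminorm P (\<lambda>x. h x - c (pos i x)) < e / 4" using level_dense[OF h, of "e/4"] e by auto
  define f where "f x = c (pos i x)" for x
  have f: "f \<in> L2_funs P" unfolding f_def by (rule level_L2)
  define B where "B = (\<Sum>k<H i. cmod (c k))"
  have B: "B \<ge> 0" by (simp add: B_def sum_nonneg)
  obtain J where J: "\<And>n. n \<ge> J \<Longrightarrow> (2 * B) * sqrt (measure P (bad n)) < e / 2"
    using bad_eventually_small[of "e/2" "2 * B"] e by auto
  have "L2_seminorm P (\<lambda>x. S.U (int (2 * L n)) h x - h x) < e" if n: "n \<ge> max i J" for n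
  proof -
    let ?U = "S.U (int (2 * L n))"
    have "i \<le> Suc n" using n by simp
    then obtain c' where c': "\<And>x. x \<in> \<Omega> \<Longrightarrow> c (pos i x) = c' (pos (Suc n) x)" "\<And>k. cmod (c' k) \<le> B"
      using level_lower[of i "Suc n" c] unfolding B_def by blast
    have "L2_seminorm P (\<lambda>x. ?U f x - f x) \<le> (2 * B) * sqrt (measure P (bad n))"
    proof (rule P.L2_seminorm_le_off_small_set[OF L2_diff[OF S.U_L2[OF f] f] bad_sets])
      fix x assume "x \<in> space P"
      then have x: "x \<in> \<Omega>" by simp
      have Uf: "?U f x = c' (pos (Suc n) ((S ^^ (2 * L n)) x))"
        unfolding f_def S.U_apply S.pw_nat using c'(1)[OF S_power_\<Omega>[OF x]] by simp
      have fx: "f x = c' (pos (Suc n) x)" unfolding f_def by (rule c'(1)[OF x])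
      show "cmod (?U f x - f x) \<le> 2 * B * indicator (bad n) x"
      proof (cases "good n (x (Suc n))")
        case True
        then show ?thesis unfolding Uf fx using x B pos_return[OF x True] by (simp add: bad_def)
      next
        case False
        have "cmod (?U f x - f x) \<le> B + B"
          unfolding Uf fx by (intro order_trans[OF norm_triangle_ineq4] add_mono c')
        then show ?thesis using False x by (simp add: bad_def)
      qed
    qed (use B in simp)
    then have 1: "L2_seminorm P (\<lambda>x. ?U f x - f x) < e / 2" using J[of n] n by simp
    have "L2_seminorm P (\<lambda>x. ?U h x - ?U f x) = L2_seminorm P (?U (\<lambda>x. h x - f x))"
      by (rule L2_seminorm_cong) simp
    also have "\<dots> < e / 4" using c S.N_U[OF L2_diff[OF h f]] by (simp add: f_def)
    finally have 2: "L2_seminorm P (\<lambda>x. ?U h x - ?U f x) < e / 4" .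
    have 3: "L2_seminorm P (\<lambda>x. f x - h x) < e / 4"
      using c L2_seminorm_minus_commute[of P f h] by (simp add: f_def)
    show ?thesis
      using L2_triangle_diff[OF S.U_L2[OF h, of "int (2 * L n)"] S.U_L2[OF f, of "int (2 * L n)"] h]
        L2_triangle_diff[OF S.U_L2[OF f, of "int (2 * L n)"] f h] 1 2 3 by linarith
  qed
  then show "\<exists>J. \<forall>n\<ge>J. norm (L2_seminorm P (\<lambda>x. S.U (int (2 * L n)) h x - h x) - 0) < e"
    by (intro exI[of _ "max i J"] allI impI) (simp only: diff_zero real_norm_def abs_of_nonneg L2_seminorm_nonneg)
qed

lemma S_singular_spectrum: "singular_spectrum P S"
proof (rule S.singular_spectrumI[OF S_simple_spectrum _ S_rigid])
  have L2: "2 ^ n \<le> L n" for n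
  proof (induction n)
    case (Suc n)
    have "2 ^ n * 2 \<le> L n * m (Suc n)" using Suc m_ge_2 by (intro mult_mono) auto
    then show ?case by (simp add: L_Suc mult.commute)
  qed simp
  have "n \<le> 2 * L n" for n using less_exp[of n] L2[of n] by linarith
  then have "int n \<le> int (2 * L n)" for n by (simp only: of_nat_le_iff)
  then show "filterlim (\<lambda>n. int (2 * L n)) at_top sequentially"
    by (intro filterlim_at_top_mono[OF filterlim_int_sequentially] always_eventually allI)
qed

end
end

section \<open>Translates of the fibre and the conjugating maps\<close>

context skew_odometer begin

definition fibre :: "(nat \<Rightarrow> nat) set" where "fibre = {x \<in> \<Omega>. \<not> g x}"

lemma fibre_sets: "fibre \<in> sets P"
  using s_set_in_sets[of "\<lambda>_ b. \<not> b" 0] by (simp add: fibre_def)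

lemma S_pw_\<Omega>: "x \<in> \<Omega> \<Longrightarrow> S.pw k x \<in> \<Omega>" using S.pw_space[of x k] by simp

text \<open>As long as the way back by \<open>p\<close> steps stays inside the tower, the
  accumulated cocycle is the difference of the signs at the two positions.\<close>

lemma power_image_iff:
  assumes x: "x \<in> \<Omega>" and p: "p \<le> s n x"
  shows "x \<in> S.pw (int p) ` fibre \<longleftrightarrow> g x = (u n (s n x) \<noteq> u n (s n x - p))"
proof -
  define z where "z = S.pw (- int p) x"
  have z: "z \<in> \<Omega>" unfolding z_def by (rule S_pw_\<Omega>[OF x])
  have xz: "(S ^^ p) z = x" using S.pw_add[of x "int p" "- int p"] x by (simp add: z_def S.pw_nat[symmetric])
  \<comment> \<open>A wrap-around modulo \<open>L n\<close> on the way from \<open>z\<close> to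
    \<open>x\<close> would leave \<open>x\<close> at a height below \<open>p\<close>.\<close>
  have sz: "s n z = s n x - p"
  proof -
    have e: "s n x = (s n z + p) mod L n" using s_power[OF z, of n p] xz by simp
    have l: "s n z < L n" "s n x < L n" using s_less z x by auto
    show ?thesis
    proof (cases "s n z + p < L n")
      case False
      moreover have "p < L n" using l(2) p by linarith
      ultimately have "s n z + p - L n < L n" using l(1) by linarith
      then have "s n x = s n z + p - L n" using e le_mod_geq[of "L n" "s n z + p"] False by simp
      then show ?thesis using l p False by linarith
    qed (use e in simp)
  qed
  have "s n z + p < L n" using sz p s_less[OF x] by simp
  from g_power[OF z this] have gx: "g x = (g z \<noteq> (u n (s n x - p) \<noteq> u n (s n x)))" using xz sz p by simp
  have "x \<in> S.pw (int p) ` fibre \<longleftrightarrow> z \<in> fibre"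
  proof
    assume "x \<in> S.pw (int p) ` fibre"
    then obtain y where y: "y \<in> fibre" "x = S.pw (int p) y" by blast
    then have "z = y" using S.pw_add[of y "- int p" "int p"] by (simp add: z_def fibre_def)
    then show "z \<in> fibre" using y by simp
  next
    assume "z \<in> fibre"
    then show "x \<in> S.pw (int p) ` fibre" using xz S.pw_nat[of p z] by (metis image_eqI)
  qed
  then show ?thesis using gx z by (auto simp: fibre_def)
qed

lemma power_image_sets:
  assumes A: "A \<in> sets P"
  shows "S.pw k ` A \<in> sets P"
proof -
  have A\<Omega>: "A \<subseteq> \<Omega>" using sets.sets_into_space[OF A] by simp
  have "S.pw k ` A = S.pw (- k) -` A \<inter> space P"
  proof (intro set_eqI iffI)
    fix x assume "x \<in> S.pw k ` A"
    then obtain y where y: "y \<in> A" "x = S.pw k y" by blast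
    then have "y \<in> space P" using A\<Omega> by auto
    then show "x \<in> S.pw (- k) -` A \<inter> space P" using y S.pw_add[of y "- k" k] S.pw_space[of y k] by simp
  next
    fix x assume x: "x \<in> S.pw (- k) -` A \<inter> space P"
    then have "S.pw k (S.pw (- k) x) = x" using S.pw_add[of x k "- k"] by simp
    then show "x \<in> S.pw k ` A" using x by (metis IntD1 image_eqI vimage_eq)
  qed
  then show ?thesis using measurable_sets[OF S.pw_measurable A, of "- k"] by simp
qed

text \<open>Permutations of the odometer positions are extended to full addresses 2 s + g by keeping
  the parity, that is, the group coordinate. Address length 0 has a single value.\<close>

definition base_family :: "(nat \<Rightarrow> nat \<Rightarrow> nat) \<Rightarrow> nat \<Rightarrow> nat \<Rightarrow> nat" where
  "base_family \<sigma> n k = (case n of 0 \<Rightarrow> 0 | Suc n' \<Rightarrow> 2 * \<sigma> n' (k div 2) + k mod 2)"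

lemma compatible_base_family:
  assumes bij: "\<And>n. bij_betw (\<sigma> n) {..<L n} {..<L n}"
    and comp: "\<And>n k. k < L (Suc n) \<Longrightarrow> \<sigma> (Suc n) k mod L n = \<sigma> n (k mod L n)"
  shows "compatible (base_family \<sigma>)"
  unfolding compatible_def
proof (intro conjI allI impI)
  fix n
  show "bij_betw (base_family \<sigma> n) {..<H n} {..<H n}"
  proof (cases n)
    case 0
    then show ?thesis by (auto simp: base_family_def bij_betw_def inj_on_def)
  next
    case (Suc n')
    have "inj_on (base_family \<sigma> n) {..<H n}"
    proof (rule inj_onI)
      fix a b assume ab: "a \<in> {..<H n}" "b \<in> {..<H n}" "base_family \<sigma> n a = base_family \<sigma> n b"
      then have e: "2 * \<sigma> n' (a div 2) + a mod 2 = 2 * \<sigma> n' (b div 2) + b mod 2" by (simp add: base_family_def Suc)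
      then have m: "a mod 2 = b mod 2" by presburger
      then have "\<sigma> n' (a div 2) = \<sigma> n' (b div 2)" using e by simp
      moreover have "a div 2 \<in> {..<L n'}" "b div 2 \<in> {..<L n'}" using ab by (auto simp: Suc H_L)
      ultimately have "a div 2 = b div 2" using bij_betw_imp_inj_on[OF bij[of n']] by (meson inj_onD)
      then show "a = b" using m by (metis div_mult_mod_eq)
    qed
    moreover have "base_family \<sigma> n ` {..<H n} \<subseteq> {..<H n}"
    proof
      fix y assume "y \<in> base_family \<sigma> n ` {..<H n}"
      then obtain k where k: "k < H n" "y = 2 * \<sigma> n' (k div 2) + k mod 2" by (auto simp: base_family_def Suc)
      have "k div 2 \<in> {..<L n'}" using k(1) by (auto simp: Suc H_L)
      then have "\<sigma> n' (k div 2) < L n'" using bij_betwE[OF bij[of n']] by blast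
      moreover have "k mod 2 < 2" by simp
      ultimately have "y < 2 * L n'" unfolding k(2) by linarith
      then show "y \<in> {..<H n}" by (simp add: Suc H_L)
    qed
    ultimately show ?thesis unfolding bij_betw_def by (intro conjI endo_inj_surj) auto
  qed
  fix k assume k: "k < H (Suc n)"
  show "base_family \<sigma> (Suc n) k mod H n = base_family \<sigma> n (k mod H n)"
  proof (cases n)
    case (Suc n')
    have kl: "k div 2 < L (Suc n')" using k by (simp add: Suc H_L)
    have "base_family \<sigma> (Suc n) k mod H n = (k mod 2 + 2 * \<sigma> (Suc n') (k div 2)) mod (2 * L n')"
      by (simp add: base_family_def Suc H_L add.commute)
    also have "\<dots> = 2 * (\<sigma> (Suc n') (k div 2) mod L n') + k mod 2"
      by (simp add: mod_mult2_eq)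
    also have "\<dots> = 2 * \<sigma> n' (k div 2 mod L n') + k mod 2" using comp[OF kl] by simp
    also have "\<dots> = base_family \<sigma> n (k mod H n)"
      by (simp add: base_family_def Suc H_L mod_mult2_eq)
    finally show ?thesis .
  qed (simp add: base_family_def)
qed

end

locale conjugate_skew_odometers = skew_odometer +
  fixes \<sigma> :: "nat \<Rightarrow> nat \<Rightarrow> nat"
  assumes bij: "\<And>n. bij_betw (\<sigma> n) {..<L n} {..<L n}"
    and comp: "\<And>n k. k < L (Suc n) \<Longrightarrow> \<sigma> (Suc n) k mod L n = \<sigma> n (k mod L n)"
begin

text \<open>The inverse family is lifted so that \<open>Ri\<close> acts on positions by \<sigma>
  itself: whether x lies in T^q C is decided at the position \<sigma> k, where k is the position of
  x.\<close>

definition R :: "(nat \<Rightarrow> nat) \<Rightarrow> nat \<Rightarrow> nat" where "R = lift (inv_family (base_family \<sigma>))"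
definition Ri :: "(nat \<Rightarrow> nat) \<Rightarrow> nat \<Rightarrow> nat" where "Ri = lift (base_family \<sigma>)"
definition T :: "(nat \<Rightarrow> nat) \<Rightarrow> nat \<Rightarrow> nat" where "T x = R (S (inv_into \<Omega> R x))"

lemma Ri: "x \<in> \<Omega> \<Longrightarrow> Ri x \<in> \<Omega>" "x \<in> \<Omega> \<Longrightarrow> R (Ri x) = x" "x \<in> \<Omega> \<Longrightarrow> Ri (R x) = x" "x \<in> \<Omega> \<Longrightarrow> R x \<in> \<Omega>"
  unfolding R_def Ri_def
  using compatible_base_family[OF bij comp] compatible_inv_family lift_inv_family lift_\<Omega> by simp_all

lemma Ri_coordinates:
  assumes x: "x \<in> \<Omega>"
  shows "s n (Ri x) = \<sigma> n (s n x)" "g (Ri x) = g x"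
proof -
  have p: "pos (Suc n) (Ri x) = 2 * \<sigma> n (s n x) + pos (Suc n) x mod 2" for n
    using pos_lift[OF compatible_base_family[OF bij comp] x, of "Suc n"]
    by (simp add: Ri_def base_family_def pos_div2[OF x])
  show "s n (Ri x) = \<sigma> n (s n x)" using pos_div2[OF Ri(1)[OF x], of n] by (simp add: p)
  show "g (Ri x) = g x" using odd_pos[of 0 "Ri x"] odd_pos[of 0 x] dvd_mod_iff[of 2 2 "pos (Suc 0) x"] unfolding p by simp
qed

sublocale R: measure_isomorphism P S P R
proof unfold_locales
  note c = compatible_inv_family[OF compatible_base_family[OF bij comp]]
  have "automorphism P R" unfolding R_def by (rule lift_automorphism(1)[OF c])
  then show "bij_betw R (space P) (space P)" "R \<in> measurable P P" "inv_into (space P) R \<in> measurable P P" "distr P P R = P"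
    by (auto simp: automorphism_def)
qed

lemma T_eq: "R.T = T" by (simp add: fun_eq_iff R.T_def T_def)

text \<open>The conjugating map keeps the group coordinate and hence maps the fibre onto itself, so
  only the powers of \<open>S\<close> have to be transported.\<close>

lemma T_image:
  "x \<in> aut_power P T k ` fibre \<longleftrightarrow> x \<in> \<Omega> \<and> Ri x \<in> S.pw k ` fibre"
proof -
  have R: "R ` fibre = fibre"
  proof (intro set_eqI iffI)
    fix x assume "x \<in> R ` fibre"
    then obtain y where y: "y \<in> \<Omega>" "\<not> g y" "x = R y" by (auto simp: fibre_def)
    then show "x \<in> fibre" using Ri_coordinates(2)[OF Ri(4)[OF y(1)]] Ri(3,4)[OF y(1)] by (simp add: fibre_def)
  next
    fix x assume "x \<in> fibre"
    then have "x = R (Ri x)" "Ri x \<in> fibre" using Ri(1,2) Ri_coordinates(2) by (auto simp: fibre_def)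
    then show "x \<in> R ` fibre" by blast
  qed
  have fib: "fibre \<subseteq> space P" by (auto simp: fibre_def)
  have "aut_power P T k ` fibre = R ` (S.pw k ` fibre)"
    using R.T_power_image[OF fib, of k] by (simp add: T_eq R)
  moreover have Z: "S.pw k ` fibre \<subseteq> \<Omega>" using S_pw_\<Omega> by (auto simp: fibre_def)
  moreover have "x \<in> R ` Z \<longleftrightarrow> x \<in> \<Omega> \<and> Ri x \<in> Z" if Z: "Z \<subseteq> \<Omega>" for Z
  proof
    assume "x \<in> R ` Z"
    then obtain y where y: "y \<in> Z" "x = R y" by blast
    then have "y \<in> \<Omega>" using Z by blast
    then show "x \<in> \<Omega> \<and> Ri x \<in> Z" using y Ri(3,4) by simp
  next
    assume x: "x \<in> \<Omega> \<and> Ri x \<in> Z"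
    show "x \<in> R ` Z" by (rule image_eqI[of _ _ "Ri x"]) (use x Ri(2) in simp_all)
  qed
  ultimately show ?thesis by metis
qed

lemma T_image_sets: "aut_power P T k ` fibre \<in> sets P"
proof -
  have "aut_power P T k ` fibre = Ri -` (S.pw k ` fibre) \<inter> space P"
    by (rule set_eqI) (simp only: T_image Int_iff vimage_eq space_P conj_commute)
  moreover have "Ri \<in> measurable P P"
    unfolding Ri_def by (rule lift_measurable[OF compatible_base_family[OF bij comp]])
  ultimately show ?thesis using measurable_sets power_image_sets[OF fibre_sets] by metis
qed

text \<open>On the level \<open>n\<close> position \<open>k\<close> the two translated copies of the fibre are either equal or complementary.\<close>

lemma correlation_bounds:
  fixes p q n :: nat and c :: bool
  defines "E \<equiv> {k \<in> {..<L n}. p \<le> k \<and> q \<le> \<sigma> n k \<and>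
     (((u n k \<noteq> u n (k - p)) = (u n (\<sigma> n k) \<noteq> u n (\<sigma> n k - q))) = c)}"
  shows "c \<Longrightarrow> real (card E) / (2 * real (L n)) \<le> measure P (S.pw (int p) ` fibre \<inter> aut_power P T (int q) ` fibre)"
    and "\<not> c \<Longrightarrow> measure P (S.pw (int p) ` fibre \<inter> aut_power P T (int q) ` fibre) \<le> 1 - real (card E) / real (L n)"
proof -
  let ?A = "S.pw (int p) ` fibre \<inter> aut_power P T (int q) ` fibre"
  have fin: "finite E" "E \<subseteq> {..<L n}" by (auto simp: E_def)
  have A: "?A \<in> sets P" using power_image_sets[OF fibre_sets] T_image_sets by auto
  have iff: "x \<in> ?A \<longleftrightarrow> g x = (u n (s n x) \<noteq> u n (s n x - p)) \<and> g x = (u n (\<sigma> n (s n x)) \<noteq> u n (\<sigma> n (s n x) - q))"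
    if x: "x \<in> \<Omega>" and k: "s n x \<in> E" for x
  proof -
    have "p \<le> s n x" "q \<le> s n (Ri x)" using k Ri_coordinates[OF x] by (auto simp: E_def)
    then show ?thesis
      using power_image_iff[OF x, of p n] power_image_iff[OF Ri(1)[OF x], of q n] Ri_coordinates[OF x] T_image x by auto
  qed
  {
    assume c: c
    \<comment> \<open>When the sign differences agree, exactly one of the two addresses over
      position k belongs to the intersection; this is the origin of the factor 1/2.\<close>
    let ?K = "(\<lambda>k. 2 * k + of_bool (u n k \<noteq> u n (k - p))) ` E"
    have K: "?K \<subseteq> {..<H (Suc n)}" using fin(2) by (auto simp: H_L)
    have inj: "inj_on (\<lambda>k. 2 * k + of_bool (u n k \<noteq> u n (k - p))) E"
      by (rule inj_onI) (auto simp: of_bool_def split: if_splits; presburger)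
    have "{x \<in> \<Omega>. pos (Suc n) x \<in> ?K} \<subseteq> ?A"
    proof
      fix x assume "x \<in> {x \<in> \<Omega>. pos (Suc n) x \<in> ?K}"
      then obtain k where x: "x \<in> \<Omega>" and k: "k \<in> E" "2 * s n x + of_bool (g x) = 2 * k + of_bool (u n k \<noteq> u n (k - p))"
        by (auto simp: pos_sg)
      then have "s n x = k" "g x = (u n k \<noteq> u n (k - p))" by (auto simp: of_bool_def split: if_splits; presburger)+
      then show "x \<in> ?A" using iff[OF x] k(1) c by (auto simp: E_def)
    qed
    then have "measure P {x \<in> \<Omega>. pos (Suc n) x \<in> ?K} \<le> measure P ?A"
      by (intro P.finite_measure_mono A)
    then show "real (card E) / (2 * real (L n)) \<le> measure P ?A"
      unfolding measure_pos_set using K card_image[OF inj] by (simp add: Int_absorb2 H_L)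
  }
  {
    assume c: "\<not> c"
    \<comment> \<open>When they disagree, both addresses over position k are outside the
      intersection, so the full proportion of such positions is lost.\<close>
    let ?K = "{k. k div 2 \<in> E}"
    have kc: "card (?K \<inter> {..<H (Suc n)}) = 2 * card E"
    proof -
      have "?K \<inter> {..<H (Suc n)} = (\<lambda>(k, b). 2 * k + b) ` (E \<times> {..<2})"
      proof (intro set_eqI iffI)
        fix j assume "j \<in> ?K \<inter> {..<H (Suc n)}"
        then show "j \<in> (\<lambda>(k, b). 2 * k + b) ` (E \<times> {..<2})"
          by (intro image_eqI[of _ _ "(j div 2, j mod 2)"]) auto
      next
        fix j assume "j \<in> (\<lambda>(k, b). 2 * k + b) ` (E \<times> {..<2})"
        then obtain k b where kb: "k \<in> E" "b < 2" "j = 2 * k + b" by auto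
        then have "j div 2 = k" "k < L n" using fin(2) by auto
        then show "j \<in> ?K \<inter> {..<H (Suc n)}" using kb by (auto simp: H_L)
      qed
      moreover have "inj_on (\<lambda>(k, b). 2 * k + b) (E \<times> {..<2::nat})"
        by (rule inj_onI) (auto; presburger)
      ultimately show ?thesis by (simp add: card_image card_cartesian_product)
    qed
    have "?A \<subseteq> \<Omega> - {x \<in> \<Omega>. pos (Suc n) x \<in> ?K}"
    proof
      fix x assume xA: "x \<in> ?A"
      then have x: "x \<in> \<Omega>" using T_image by auto
      have "s n x \<notin> E" using iff[OF x] xA c by (auto simp: E_def)
      then show "x \<in> \<Omega> - {x \<in> \<Omega>. pos (Suc n) x \<in> ?K}" using x pos_div2[OF x] by simp
    qed
    then have "measure P ?A \<le> measure P (space P - {x \<in> \<Omega>. pos (Suc n) x \<in> ?K})"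
      by (intro P.finite_measure_mono sets.compl_sets pos_set_in_sets) simp
    also have "\<dots> = 1 - real (card E) / real (L n)"
      unfolding P.prob_compl[OF pos_set_in_sets] measure_pos_set kc by (simp add: H_L)
    finally show "measure P ?A \<le> 1 - real (card E) / real (L n)" .
  }
qed

end

section \<open>One stage of the construction\<close>

lemma card_mod_div:
  fixes Q W :: nat
  assumes D: "D \<subseteq> {..<Q}" "B \<subseteq> {..<W}" and Q: "Q > 0"
  shows "card {k \<in> {..<Q * W}. k mod Q \<in> D \<and> k div Q \<in> B} = card D * card B"
proof -
  have "{k \<in> {..<Q * W}. k mod Q \<in> D \<and> k div Q \<in> B} = (\<lambda>(a, w). a + Q * w) ` (D \<times> B)"
  proof (intro set_eqI iffI)
    fix k assume k: "k \<in> {k \<in> {..<Q * W}. k mod Q \<in> D \<and> k div Q \<in> B}"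
    then show "k \<in> (\<lambda>(a, w). a + Q * w) ` (D \<times> B)"
      by (intro image_eqI[of _ _ "(k mod Q, k div Q)"]) auto
  next
    fix k assume "k \<in> (\<lambda>(a, w). a + Q * w) ` (D \<times> B)"
    then obtain a w where aw: "a \<in> D" "w \<in> B" "k = a + Q * w" by auto
    have a: "a < Q" "w < W" using aw D by auto
    have "Q * (w + 1) \<le> Q * W" using a by (intro mult_le_mono2) simp
    then have "k < Q * W" using a unfolding aw(3) by (simp add: algebra_simps)
    then show "k \<in> {k \<in> {..<Q * W}. k mod Q \<in> D \<and> k div Q \<in> B}" using aw a by simp
  qed
  moreover have "inj_on (\<lambda>(a, w). a + Q * w) (D \<times> B)"
  proof (rule inj_onI)
    fix y z assume yz: "y \<in> D \<times> B" "z \<in> D \<times> B" "(\<lambda>(a, w). a + Q * w) y = (\<lambda>(a, w). a + Q * w) z"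
    obtain a w b v where e: "y = (a, w)" "z = (b, v)" by (cases y, cases z) auto
    have ab: "a < Q" "b < Q" "a + Q * w = b + Q * v" using yz D unfolding e by auto
    have "(a + Q * w) mod Q = a" "(b + Q * v) mod Q = b" "(a + Q * w) div Q = w" "(b + Q * v) div Q = v"
      using ab(1,2) by simp_all
    then show "y = z" unfolding e using ab(3) by metis
  qed
  ultimately show ?thesis by (simp add: card_image card_cartesian_product)
qed

lemma card_mod:
  fixes Q W :: nat
  assumes "D \<subseteq> {..<Q}" "Q > 0"
  shows "card {k \<in> {..<Q * W}. k mod Q \<in> D} = card D * W"
proof -
  have "{k \<in> {..<Q * W}. k mod Q \<in> D} = {k \<in> {..<Q * W}. k mod Q \<in> D \<and> k div Q \<in> {..<W}}"
    by (auto simp: less_mult_imp_div_less mult.commute)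
  then show ?thesis using card_mod_div[OF assms(1) order_refl assms(2), of W] by simp
qed

text \<open>In a finite set the complements of \<open>A\<close> and of its image have the same size,
  and any bijection between them completes \<open>f\<close>.\<close>

lemma extend_partial_bijection:
  fixes X :: "'a set"
  assumes X: "finite X" and A: "A \<subseteq> X" and f: "inj_on f A" "f ` A \<subseteq> X"
  shows "\<exists>\<pi>. bij_betw \<pi> X X \<and> (\<forall>a\<in>A. \<pi> a = f a)"
proof -
  have "card (X - A) = card (X - f ` A)"
    using X A f by (simp add: card_Diff_subset finite_subset card_image)
  then obtain h where h: "bij_betw h (X - A) (X - f ` A)"
    using finite_same_card_bij X by (metis finite_Diff)
  define \<pi> where "\<pi> a = (if a \<in> A then f a else h a)" for a
  have "bij_betw \<pi> A (f ` A)"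
    using f by (auto simp: bij_betw_def inj_on_def \<pi>_def)
  moreover have "bij_betw \<pi> (X - A) (X - f ` A)"
    using h by (subst bij_betw_cong[where g=h]) (auto simp: \<pi>_def)
  ultimately have "bij_betw \<pi> (A \<union> (X - A)) (f ` A \<union> (X - f ` A))"
    by (intro bij_betw_combine) auto
  moreover have "A \<union> (X - A) = X" "f ` A \<union> (X - f ` A) = X" using A f by auto
  ultimately show ?thesis by (intro exI[of _ \<pi>]) (auto simp: \<pi>_def)
qed

lemma set_decode_less: "w < 2 ^ M \<Longrightarrow> set_decode w \<subseteq> {..<M}"
proof
  fix i assume w: "w < 2 ^ M" and i: "i \<in> set_decode w"
  show "i \<in> {..<M}"
  proof (rule ccontr)
    assume "i \<notin> {..<M}"
    then have "(2::nat) ^ M \<le> 2 ^ i" by (intro power_increasing) auto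
    then have "w < 2 ^ i" using w by linarith
    then have "w div 2 ^ i = 0" by (rule div_less)
    then show False using i by (simp add: set_decode_def)
  qed
qed

lemma set_encode_less:
  assumes "A \<subseteq> {..<M}"
  shows "set_encode A < 2 ^ M"
proof -
  have "set_encode A \<le> (\<Sum>i<M. 2 ^ i)"
    unfolding set_encode_def using assms by (intro sum_mono2) auto
  moreover have "(\<Sum>i<M. (2::nat) ^ i) < 2 ^ M" by (induction M) auto
  ultimately show ?thesis by linarith
qed

text \<open>A word of length \<open>M\<close> is coded by \<open>w < 2 ^ M\<close>, its letters being the truth values of \<open>j \<in> set_decode w\<close>.\<close>

lemma word_rearrangement:
  assumes \<pi>: "bij_betw \<pi> {..<M} {..<M}"
  shows "\<exists>\<theta>. bij_betw \<theta> {..<2 ^ M} {..<2 ^ M} \<and>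
    (\<forall>w<2 ^ M. \<forall>j<M. (j \<in> set_decode (\<theta> w)) = ((\<pi> j \<in> set_decode w) \<noteq> fl j))"
proof -
  define F where "F w = {j. j < M \<and> ((\<pi> j \<in> set_decode w) \<noteq> fl j)}" for w
  define \<theta> where "\<theta> w = set_encode (F w)" for w
  have finF: "finite (F w)" for w by (simp add: F_def)
  have dec: "set_decode (\<theta> w) = F w" for w unfolding \<theta>_def by (rule set_encode_inverse[OF finF])
  have less: "\<theta> w < 2 ^ M" for w unfolding \<theta>_def by (rule set_encode_less) (auto simp: F_def)
  have "inj_on \<theta> {..<2 ^ M}"
  proof (rule inj_onI)
    fix v w assume vw: "v \<in> {..<2 ^ M}" "w \<in> {..<2 ^ M}" "\<theta> v = \<theta> w"
    then have FF: "F v = F w" using dec by metis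
    have "(i \<in> set_decode v) = (i \<in> set_decode w)" for i
    proof (cases "i < M")
      case True
      then obtain j where j: "j < M" "\<pi> j = i" using \<pi> by (metis bij_betw_imp_surj_on imageE lessThan_iff)
      have "j \<in> F v \<longleftrightarrow> j \<in> F w" using FF by simp
      then show ?thesis using j by (auto simp: F_def)
    next
      case False
      then show ?thesis using vw set_decode_less[of v M] set_decode_less[of w M] by auto
    qed
    then have "set_decode v = set_decode w" by blast
    then show "v = w" by (metis set_decode_inverse)
  qed
  moreover have "\<theta> ` {..<2 ^ M} \<subseteq> {..<2 ^ M}" using less by auto
  ultimately have "bij_betw \<theta> {..<2 ^ M} {..<2 ^ M}"
    unfolding bij_betw_def by (intro conjI endo_inj_surj) auto
  then show ?thesis using dec by (intro exI[of _ \<theta>]) (auto simp: F_def)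
qed

text \<open>Once consecutive gaps are at least \<open>Suc h\<close>, the sequence grows at least
  linearly. This bounds from below the distance between arbitrary later terms and finally the terms
  themselves.\<close>

lemma separated_times:
  fixes p :: "nat \<Rightarrow> int"
  assumes "filterlim (\<lambda>n. p (Suc n) - p n) at_top sequentially"
  shows "\<exists>l. \<forall>n\<ge>l. p n \<ge> int h \<and> (\<forall>n'>n. p n' \<ge> p n + int h)"
proof -
  have "\<forall>\<^sub>F n in sequentially. p (Suc n) - p n \<ge> int (Suc h)"
    using assms by (simp add: filterlim_at_top)
  then obtain l0 where l0: "\<And>n. n \<ge> l0 \<Longrightarrow> p (Suc n) \<ge> p n + int (Suc h)" by (force simp: eventually_sequentially)
  have step: "p (n + k) \<ge> p n + int k * int (Suc h)" if "n \<ge> l0" for n k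
  proof (induction k)
    case (Suc k)
    then show ?case using l0[of "n + k"] that by (simp add: algebra_simps)
  qed simp
  have gap: "p n' \<ge> p n + int h" if "n \<ge> l0" "n' > n" for n n'
  proof -
    have "p n + int (n' - n) * int (Suc h) \<le> p n'" using step[OF that(1), of "n' - n"] that by simp
    moreover have "1 * int h \<le> int (n' - n) * int (Suc h)" using that by (intro mult_mono) auto
    ultimately show ?thesis by linarith
  qed
  \<comment> \<open>Every step beyond \<open>l0\<close> raises the sequence by at least 1, so this
    many steps compensate for a negative start and still reach \<open>h\<close>.\<close>
  define l where "l = l0 + nat (\<bar>p l0\<bar> + int h)"
  have "p n \<ge> int h" if "n \<ge> l" for n
  proof -
    have n: "n = l0 + (n - l0)" using that by (simp add: l_def)
    have "p n \<ge> p l0 + int (n - l0) * int (Suc h)" using step[of l0 "n - l0"] n by simp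
    moreover have "int (n - l0) * 1 \<le> int (n - l0) * int (Suc h)" by (intro mult_left_mono) auto
    moreover have "int (n - l0) \<ge> \<bar>p l0\<bar> + int h" using that by (simp add: l_def)
    ultimately show ?thesis by linarith
  qed
  moreover have "n \<ge> l0" if "n \<ge> l" for n using that by (simp add: l_def)
  ultimately show ?thesis using gap by blast
qed

text \<open>Block \<open>b\<close> carries the sign of the parity of \<open>t\<close> plus letter \<open>i\<close> of the word \<open>w\<close>, where
  \<open>b = t + A (i + M w)\<close>. The alternation in \<open>t\<close> gives rank one, the words give independence: at times
  separated by more than a block, distinct letters are read, so rearranging the letters can impose
  any correlation.\<close>

lemma stage:
  fixes p q :: "nat \<Rightarrow> int" and u :: "nat \<Rightarrow> bool" and \<sigma> :: "nat \<Rightarrow> nat" and c :: bool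
  assumes p: "filterlim (\<lambda>n. p (Suc n) - p n) at_top sequentially"
    and q: "filterlim (\<lambda>n. q (Suc n) - q n) at_top sequentially"
    and h: "h > 0" and \<sigma>: "bij_betw \<sigma> {..<h} {..<h}" and K: "K > 0"
  shows "\<exists>m (e :: nat \<Rightarrow> bool) \<sigma>'. m \<ge> 2 \<and> bij_betw \<sigma>' {..<h * m} {..<h * m} \<and>
    (\<forall>k<h * m. \<sigma>' k mod h = \<sigma> (k mod h)) \<and>
    card {b \<in> {..<m}. \<not> (b + 2 < m \<and> e (b + 1) \<noteq> e b \<and> e (b + 2) = e b)} * K \<le> m \<and>
    (\<exists>l\<ge>K. \<forall>n\<in>{l<..8 * l}. p n \<ge> 0 \<and> q n \<ge> 0 \<and>
      7 * (h * m) \<le> 8 * card {k \<in> {..<h * m}. nat (p n) \<le> k \<and> nat (q n) \<le> \<sigma>' k \<and>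
        ((((u (k mod h) \<noteq> e (k div h)) \<noteq> (u ((k - nat (p n)) mod h) \<noteq> e ((k - nat (p n)) div h))) =
         ((u (\<sigma>' k mod h) \<noteq> e (\<sigma>' k div h)) \<noteq> (u ((\<sigma>' k - nat (q n)) mod h) \<noteq> e ((\<sigma>' k - nat (q n)) div h)))) = c)})"
proof -
  \<comment> \<open>The length of an alternating run. Only the last two blocks of a run can fail to
    have two alternating successors, a proportion of at most 2/A, which is below 1/K.\<close>
  define A where "A = 2 * K + 2"
  define h' where "h' = h * A"
  have A: "A \<ge> 4" "A > 0" using K by (auto simp: A_def)
  have h': "h' > 0" using h A by (simp add: h'_def)
  obtain lp where lp: "\<And>n. n \<ge> lp \<Longrightarrow> p n \<ge> int h'" "\<And>n n'. n \<ge> lp \<Longrightarrow> n' > n \<Longrightarrow> p n' \<ge> p n + int h'"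
    using separated_times[OF p, of h'] by blast
  obtain lq where lq: "\<And>n. n \<ge> lq \<Longrightarrow> q n \<ge> int h'" "\<And>n n'. n \<ge> lq \<Longrightarrow> n' > n \<Longrightarrow> q n' \<ge> q n + int h'"
    using separated_times[OF q, of h'] by blast
  \<comment> \<open>The range of times is fixed here, before the length of the words, because that
    length has to exceed all values of \<open>p\<close> and \<open>q\<close> on the range.\<close>
  define l where "l = max (max lp lq) K"
  define J where "J = {l<..8 * l}"
  define pn where "pn n = nat (p n)" for n
  define qn where "qn n = nat (q n)" for n
  have pq: "pn n \<ge> h'" "qn n \<ge> h'" "p n \<ge> 0" "q n \<ge> 0" if "n \<in> J" for n
    using lp(1)[of n] lq(1)[of n] that by (auto simp: J_def l_def pn_def qn_def)
  have gap: "pn n' \<ge> pn n + h'" "qn n' \<ge> qn n + h'" if "n \<in> J" "n' \<in> J" "n < n'" for n n'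
    using lp(2)[of n n'] lq(2)[of n n'] pq[OF that(1)] pq[OF that(2)] that
    by (auto simp: J_def l_def pn_def qn_def)
  define c0 where "c0 = Max (insert 1 (pn ` J \<union> qn ` J))"
  have finJ: "finite J" by (simp add: J_def)
  have c0: "c0 \<ge> 1" "\<And>n. n \<in> J \<Longrightarrow> pn n \<le> c0" "\<And>n. n \<in> J \<Longrightarrow> qn n \<le> c0"
    using finJ by (auto simp: c0_def intro!: Max_ge)
  \<comment> \<open>From positions whose letter index is below \<open>c0\<close> the way back might
    leave the word. With 8 c0 letters these are one eighth of all positions.\<close>
  define M where "M = 8 * c0"
  define Q where "Q = h' * M"
  have M: "M > 0" using c0 by (simp add: M_def)
  have Q: "Q > 0" using M h' by (simp add: Q_def)
  define m where "m = A * M * 2 ^ M"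
  have hm: "h * m = Q * 2 ^ M" by (simp add: m_def Q_def h'_def algebra_simps)
  define e where "e b = (odd (b mod A) \<noteq> (b div A mod M \<in> set_decode (b div A div M)))" for b
  \<comment> \<open>The part of the sign that is the same for all words: the old pattern together
    with the alternation inside a run of length \<open>h'\<close>.\<close>
  define v where "v x = (u (x mod h) \<noteq> odd (x div h))" for x
  \<comment> \<open>position \<open>r\<close> inside the part before the word, whose letter \<open>r div h'\<close> is the current one\<close>
  have label: "(u ((r + Q * w) mod h) \<noteq> e ((r + Q * w) div h)) = (v (r mod h') \<noteq> (r div h' \<in> set_decode w))"
    if r: "r < Q" for r w
  proof -
    have h'h: "h dvd h'" and Qh: "h dvd Q" by (simp_all add: h'_def Q_def)
    have 1: "(r + Q * w) mod h = r mod h' mod h"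
    proof -
      have "(r + Q * w) mod h = r mod h" using Qh by (metis dvd_mult2 mod_add_right_eq dvd_imp_mod_0 add.right_neutral)
      then show ?thesis using h'h by (simp add: mod_mod_cancel)
    qed
    have d: "(r + Q * w) div h' = r div h' + M * w"
    proof -
      have *: "r + Q * w = r + h' * (M * w)" by (simp add: Q_def)
      show ?thesis unfolding * using h' by (subst div_mult_self2) simp_all
    qed
    have i: "r div h' < M" using r by (simp add: Q_def less_mult_imp_div_less mult.commute)
    have dA: "(r + Q * w) div h div A = r div h' + M * w" using d by (simp add: h'_def div_mult2_eq)
    then have 2: "(r + Q * w) div h div A mod M = r div h'" "(r + Q * w) div h div A div M = w" using i by simp_all
    have 3: "(r + Q * w) div h mod A = r mod h' div h"
    proof -
      have "(r + Q * w) mod h' = r mod h'" by (simp add: Q_def mult.assoc)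
      moreover have "(r + Q * w) mod h' = h * ((r + Q * w) div h mod A) + (r + Q * w) mod h"
        unfolding h'_def by (rule mod_mult2_eq)
      ultimately have "r mod h' div h = (h * ((r + Q * w) div h mod A) + (r + Q * w) mod h) div h" by simp
      then show ?thesis using h by simp
    qed
    show ?thesis unfolding e_def v_def 1 2 3 by auto
  qed
  \<comment> \<open>The old permutation \<sigma> acts inside each block of length \<open>h\<close>.
    Blocks stay in place, and so does the letter they carry.\<close>
  define rr where "rr r = \<sigma> (r mod h) + h * (r div h)" for r
  have \<sigma>h: "\<sigma> (r mod h) < h" for r using \<sigma> h bij_betwE by (metis lessThan_iff mod_less_divisor)
  have rr_div: "rr r div h = r div h" "rr r mod h = \<sigma> (r mod h)" for r
    using \<sigma>h[of r] by (simp_all add: rr_def)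
  have rr_h': "rr r div h' = r div h'" for r
    unfolding h'_def div_mult2_eq rr_div ..
  have rrQ: "rr r < Q" if "r < Q" for r
  proof -
    have "r div h' < M" using that by (simp add: Q_def less_mult_imp_div_less mult.commute)
    then have "rr r div h' < M" by (simp add: rr_h')
    then show ?thesis using h' by (simp add: Q_def div_less_iff_less_mult mult.commute)
  qed
  \<comment> \<open>\<open>\<kappa>\<close> and \<open>\<kappa>'\<close> are the word-independent
    parts of the two sign differences, while \<open>a\<close> and \<open>a'\<close> are the indices
    of the letters met after going back. What remains of the signs depends on the word
    alone.\<close>
  define \<kappa> where "\<kappa> r n = (v (r mod h') \<noteq> v ((r - pn n) mod h'))" for r n
  define \<kappa>' where "\<kappa>' r n = (v (rr r mod h') \<noteq> v ((rr r - qn n) mod h'))" for r n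
  define a where "a r n = (r - pn n) div h'" for r n
  define a' where "a' r n = (rr r - qn n) div h'" for r n
  \<comment> \<open>Times at distance at least \<open>h'\<close> lead to different letters. Since
    the times themselves are at least \<open>h'\<close>, none of these is the current letter; the
    bound \<open>c0\<close> keeps truncated subtraction exact.\<close>
  have letters: "inj_on f J \<and> (\<forall>n\<in>J. f n < r div h')"
    if f: "\<And>n. n \<in> J \<Longrightarrow> f n = (x - t n) div h'" and x: "x div h' = r div h'" "r div h' \<ge> c0"
      and t: "\<And>n. n \<in> J \<Longrightarrow> t n \<ge> h'" "\<And>n n'. n \<in> J \<Longrightarrow> n' \<in> J \<Longrightarrow> n < n' \<Longrightarrow> t n' \<ge> t n + h'" "\<And>n. n \<in> J \<Longrightarrow> t n \<le> c0"
    for f x r t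
  proof -
    have xc: "c0 \<le> x"
    proof -
      have "c0 \<le> x div h'" using x by simp
      also have "\<dots> \<le> x" by simp
      finally show ?thesis .
    qed
    have less: "(x - t') div h' < (x - t0) div h'" if "t' \<ge> t0 + h'" "t' \<le> c0" for t' t0
    proof -
      have "(x - t') + h' \<le> x - t0" using that xc by linarith
      then have "((x - t') + h') div h' \<le> (x - t0) div h'" by (rule div_le_mono)
      then show ?thesis using h' by simp
    qed
    have strict: "f n' < f n" if "n \<in> J" "n' \<in> J" "n < n'" for n n'
      unfolding f[OF that(1)] f[OF that(2)] using t(2)[OF that] t(3)[OF that(2)] by (rule less)
    have "inj_on f J"
    proof (rule inj_onI)
      fix n n' assume "n \<in> J" "n' \<in> J" "f n = f n'"
      then show "n = n'" using strict[of n n'] strict[of n' n] by (cases n n' rule: linorder_cases) auto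
    qed
    moreover have "f n < r div h'" if "n \<in> J" for n
      using less[of 0 "t n"] t(1,3)[OF that] x f[OF that] by simp
    ultimately show ?thesis by blast
  qed
  \<comment> \<open>A rearrangement of words that suits one offset \<open>r\<close> inside the word.
    It may vary with \<open>r\<close>, and offsets too close to the beginning carry no condition
    beyond bijectivity.\<close>
  define ok where "ok r \<theta> \<longleftrightarrow> bij_betw \<theta> {..<2 ^ M} {..<2 ^ M} \<and> (r div h' \<ge> c0 \<longrightarrow> (\<forall>w<2 ^ M. \<forall>n\<in>J.
      ((\<kappa> r n \<noteq> ((r div h' \<in> set_decode w) \<noteq> (a r n \<in> set_decode w))) =
       (\<kappa>' r n \<noteq> ((r div h' \<in> set_decode (\<theta> w)) \<noteq> (a' r n \<in> set_decode (\<theta> w))))) = c))" for r \<theta>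
  have ex: "\<exists>\<theta>. ok r \<theta>"
    if r: "r < Q" for r
  proof (cases "r div h' \<ge> c0")
    case True
    define i where "i = r div h'"
    have iM: "i < M" using r by (simp add: i_def Q_def less_mult_imp_div_less mult.commute)
    have la: "inj_on (a r) J" "\<And>n. n \<in> J \<Longrightarrow> a r n < i"
      using letters[of "a r" r pn r] True pq gap c0 by (auto simp: a_def i_def)
    have la': "inj_on (a' r) J" "\<And>n. n \<in> J \<Longrightarrow> a' r n < i"
      using letters[of "a' r" "rr r" qn r] True pq gap c0 rr_h'[of r] by (auto simp: a'_def i_def)
    \<comment> \<open>The letter met by the second orbit at time n is matched with the letter met by
      the first orbit at the same time; the current letter \<open>i\<close> is kept.\<close>
    define f where "f j = (if j = i then i else a r (inv_into J (a' r) j))" for j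
    have fa: "f (a' r n) = a r n" if "n \<in> J" for n
      using la'(2)[OF that] inv_into_f_f[OF la'(1) that] by (auto simp: f_def)
    have finj: "inj_on f (insert i (a' r ` J))"
    proof (rule inj_onI)
      fix x y assume xy: "x \<in> insert i (a' r ` J)" "y \<in> insert i (a' r ` J)" "f x = f y"
      have fi: "f i = i" by (simp add: f_def)
      have ne: "f (a' r n) \<noteq> i" if "n \<in> J" for n using fa[OF that] la(2)[OF that] by simp
      consider "x = i" "y = i" | n where "x = i" "y = a' r n" "n \<in> J" | n where "x = a' r n" "y = i" "n \<in> J"
        | n n' where "x = a' r n" "y = a' r n'" "n \<in> J" "n' \<in> J" using xy by blast
      then show "x = y"
      proof cases
        case 4
        then have "a r n = a r n'" using xy(3) fa by simp
        then show ?thesis using la(1) 4 by (metis inj_onD)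
      qed (use xy(3) fi ne in auto)
    qed
    have fim: "f ` insert i (a' r ` J) \<subseteq> {..<M}"
      using fa la(2) iM by (force simp: f_def)
    have sub: "insert i (a' r ` J) \<subseteq> {..<M}" using la'(2) iM by force
    obtain \<pi> where \<pi>: "bij_betw \<pi> {..<M} {..<M}" "\<And>j. j \<in> insert i (a' r ` J) \<Longrightarrow> \<pi> j = f j"
      using extend_partial_bijection[OF finite_lessThan sub finj fim] by blast
    \<comment> \<open>The sign change compensates for the difference of \<open>\<kappa>\<close> and
      \<open>\<kappa>'\<close> and is inverted once more if disagreement is wanted.\<close>
    define fl where "fl j = (j \<noteq> i \<and> (let n = inv_into J (a' r) j in (\<kappa> r n \<noteq> \<kappa>' r n) = c))" for j
    obtain \<theta> where \<theta>: "bij_betw \<theta> {..<2 ^ M} {..<2 ^ M}"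
      "\<And>w j. w < 2 ^ M \<Longrightarrow> j < M \<Longrightarrow> (j \<in> set_decode (\<theta> w)) = ((\<pi> j \<in> set_decode w) \<noteq> fl j)"
      using word_rearrangement[OF \<pi>(1), of fl] by blast
    have "((\<kappa> r n \<noteq> ((i \<in> set_decode w) \<noteq> (a r n \<in> set_decode w))) =
       (\<kappa>' r n \<noteq> ((i \<in> set_decode (\<theta> w)) \<noteq> (a' r n \<in> set_decode (\<theta> w))))) = c"
      if w: "w < 2 ^ M" and n: "n \<in> J" for w n
    proof -
      have 1: "(i \<in> set_decode (\<theta> w)) = (i \<in> set_decode w)"
        using \<theta>(2)[OF w iM] \<pi>(2)[of i] by (simp add: fl_def f_def)
      have "a' r n < M" using la'(2)[OF n] iM by simp
      then have 2: "(a' r n \<in> set_decode (\<theta> w)) = ((a r n \<in> set_decode w) \<noteq> ((\<kappa> r n \<noteq> \<kappa>' r n) = c))"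
        using \<theta>(2)[OF w, of "a' r n"] \<pi>(2)[of "a' r n"] fa[OF n] n la'(2)[OF n] inv_into_f_f[OF la'(1) n]
        by (simp add: fl_def Let_def)
      show ?thesis unfolding 1 2 by (cases "\<kappa> r n"; cases "\<kappa>' r n"; cases c; simp)
    qed
    then show ?thesis using \<theta>(1) by (intro exI[of _ \<theta>]) (simp add: ok_def i_def)
  next
    case False
    then show ?thesis by (intro exI[of _ id]) (auto simp: ok_def)
  qed
  then have "\<forall>r. \<exists>\<theta>. r < Q \<longrightarrow> ok r \<theta>" by blast
  then obtain \<theta> where ok: "\<forall>r. r < Q \<longrightarrow> ok r (\<theta> r)" by (rule choice[THEN exE])
  have \<theta>: "\<And>r. r < Q \<Longrightarrow> bij_betw (\<theta> r) {..<2 ^ M} {..<2 ^ M}"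
    "\<And>r w n. r < Q \<Longrightarrow> r div h' \<ge> c0 \<Longrightarrow> w < 2 ^ M \<Longrightarrow> n \<in> J \<Longrightarrow>
      ((\<kappa> r n \<noteq> ((r div h' \<in> set_decode w) \<noteq> (a r n \<in> set_decode w))) =
       (\<kappa>' r n \<noteq> ((r div h' \<in> set_decode (\<theta> r w)) \<noteq> (a' r n \<in> set_decode (\<theta> r w))))) = c"
    using ok unfolding ok_def by blast+
  \<comment> \<open>The offset inside the word moves by \<open>rr\<close>, and the number of the
    word by the rearrangement that belongs to this offset. Both can be read off from the image,
    which gives injectivity.\<close>
  define \<sigma>' where "\<sigma>' k = rr (k mod Q) + Q * \<theta> (k mod Q) (k div Q)" for k
  have \<sigma>'_mod: "\<sigma>' k mod Q = rr (k mod Q)" "\<sigma>' k div Q = \<theta> (k mod Q) (k div Q)" for k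
    using rrQ[of "k mod Q"] Q by (simp_all add: \<sigma>'_def)
  have divQ: "k div Q < 2 ^ M" if "k < Q * 2 ^ M" for k
    using that by (simp add: less_mult_imp_div_less mult.commute)
  have bij: "bij_betw \<sigma>' {..<h * m} {..<h * m}"
  proof -
    have "inj_on \<sigma>' {..<Q * 2 ^ M}"
    proof (rule inj_onI)
      fix x y assume xy: "x \<in> {..<Q * 2 ^ M}" "y \<in> {..<Q * 2 ^ M}" "\<sigma>' x = \<sigma>' y"
      have "rr (x mod Q) = rr (y mod Q)" using \<sigma>'_mod xy(3) by metis
      then have "(x mod Q) div h = (y mod Q) div h" "\<sigma> (x mod Q mod h) = \<sigma> (y mod Q mod h)" using rr_div by metis+
      moreover from this have "x mod Q mod h = y mod Q mod h"
        using bij_betw_imp_inj_on[OF \<sigma>] h by (simp add: inj_on_def)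
      ultimately have e1: "x mod Q = y mod Q" by (metis div_mult_mod_eq)
      have "\<theta> (x mod Q) (x div Q) = \<theta> (x mod Q) (y div Q)" using \<sigma>'_mod xy(3) e1 by metis
      then have "x div Q = y div Q"
        using bij_betw_imp_inj_on[OF \<theta>(1), of "x mod Q"] divQ[of x] divQ[of y] xy Q by (simp add: inj_on_def)
      then show "x = y" using e1 by (metis div_mult_mod_eq)
    qed
    moreover have "\<sigma>' ` {..<Q * 2 ^ M} \<subseteq> {..<Q * 2 ^ M}"
    proof
      fix y assume "y \<in> \<sigma>' ` {..<Q * 2 ^ M}"
      then obtain k where k: "k < Q * 2 ^ M" "y = \<sigma>' k" by auto
      have "\<theta> (k mod Q) (k div Q) < 2 ^ M" using bij_betwE[OF \<theta>(1), of "k mod Q"] divQ[OF k(1)] Q by auto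
      then have "y div Q < 2 ^ M" using \<sigma>'_mod(2)[of k] k(2) by simp
      then show "y \<in> {..<Q * 2 ^ M}" using Q by (simp add: div_less_iff_less_mult mult.commute)
    qed
    ultimately show ?thesis unfolding hm bij_betw_def by (intro conjI endo_inj_surj) auto
  qed
  have comp: "\<sigma>' k mod h = \<sigma> (k mod h)" for k
  proof -
    have Qh: "h dvd Q" by (simp add: h'_def Q_def)
    have "\<sigma>' k mod h = rr (k mod Q) mod h" using mod_mod_cancel[OF Qh, of "\<sigma>' k"] \<sigma>'_mod(1)[of k] by simp
    then show ?thesis by (simp add: rr_div mod_mod_cancel[OF Qh])
  qed
  have badcard: "card {b \<in> {..<m}. \<not> (b + 2 < m \<and> e (b + 1) \<noteq> e b \<and> e (b + 2) = e b)} * K \<le> m"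
  proof -
    \<comment> \<open>Two steps from a block that is not among the last two of its run stay in the
      run. There letter and word are constant, and only the parity of the place in the run
      changes.\<close>
    have "{b \<in> {..<m}. \<not> (b + 2 < m \<and> e (b + 1) \<noteq> e b \<and> e (b + 2) = e b)} \<subseteq> {b \<in> {..<A * (M * 2 ^ M)}. b mod A \<in> {A - 2, A - 1}}"
    proof
      fix b assume b: "b \<in> {b \<in> {..<m}. \<not> (b + 2 < m \<and> e (b + 1) \<noteq> e b \<and> e (b + 2) = e b)}"
      have "b mod A \<in> {A - 2, A - 1}"
      proof (rule ccontr)
        assume "b mod A \<notin> {A - 2, A - 1}"
        moreover have "b mod A < A" using A by simp
        ultimately have t: "b mod A + 2 < A" by auto
        have e1: "(b + j) mod A = b mod A + j" "(b + j) div A = b div A" if "j \<le> 2" for j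
        proof -
          have bj: "b + j = (b mod A + j) + A * (b div A)" by simp
          have l: "b mod A + j < A" using t that by linarith
          show "(b + j) mod A = b mod A + j" by (subst bj, subst mod_mult_self2) (rule mod_less[OF l])
          show "(b + j) div A = b div A" by (subst bj, subst div_mult_self2) (use l A in simp_all)
        qed
        have "b div A < M * 2 ^ M" using b by (simp add: m_def less_mult_imp_div_less mult.assoc mult.commute)
        then have "(b + 2) div A < M * 2 ^ M" using e1(2)[of 2] by simp
        then have "b + 2 < m" using A by (simp add: m_def div_less_iff_less_mult mult.assoc mult.commute)
        moreover have "e (b + 1) \<noteq> e b" "e (b + 2) = e b"
          unfolding e_def e1[of 1, OF one_le_numeral] e1[of 2, OF order_refl] by auto
        ultimately show False using b by blast
      qed
      then show "b \<in> {b \<in> {..<A * (M * 2 ^ M)}. b mod A \<in> {A - 2, A - 1}}" using b by (simp add: m_def mult.assoc)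
    qed
    then have "card {b \<in> {..<m}. \<not> (b + 2 < m \<and> e (b + 1) \<noteq> e b \<and> e (b + 2) = e b)} \<le> card {b \<in> {..<A * (M * 2 ^ M)}. b mod A \<in> {A - 2, A - 1}}"
      by (intro card_mono) auto
    also have "\<dots> = card {A - 2, A - 1} * (M * 2 ^ M)" using A by (intro card_mod) auto
    also have "card {A - 2, A - 1} \<le> 2" by (simp add: card_insert_if)
    finally have "card {b \<in> {..<m}. \<not> (b + 2 < m \<and> e (b + 1) \<noteq> e b \<and> e (b + 2) = e b)} \<le> 2 * (M * 2 ^ M)" by simp
    then have "card {b \<in> {..<m}. \<not> (b + 2 < m \<and> e (b + 1) \<noteq> e b \<and> e (b + 2) = e b)} * K \<le> 2 * (M * 2 ^ M) * K" by (rule mult_le_mono1)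
    also have "\<dots> = 2 * K * (M * 2 ^ M)" by simp
    also have "\<dots> \<le> A * (M * 2 ^ M)" by (intro mult_le_mono1) (simp add: A_def)
    finally show ?thesis by (simp add: m_def mult.assoc)
  qed
  have main: "p n \<ge> 0 \<and> q n \<ge> 0 \<and>
      7 * (h * m) \<le> 8 * card {k \<in> {..<h * m}. nat (p n) \<le> k \<and> nat (q n) \<le> \<sigma>' k \<and>
        ((((u (k mod h) \<noteq> e (k div h)) \<noteq> (u ((k - nat (p n)) mod h) \<noteq> e ((k - nat (p n)) div h))) =
         ((u (\<sigma>' k mod h) \<noteq> e (\<sigma>' k div h)) \<noteq> (u ((\<sigma>' k - nat (q n)) mod h) \<noteq> e ((\<sigma>' k - nat (q n)) div h)))) = c)}"
    (is "_ \<and> _ \<and> _ \<le> 8 * card ?E") if n: "n \<in> J" for n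
  proof (intro conjI)
    show "p n \<ge> 0" "q n \<ge> 0" using pq[OF n] by auto
    \<comment> \<open>For offsets with letter index at least \<open>c0\<close> both ways back stay
      inside the same word, as \<open>c0\<close> bounds all times. Hence offset and word number can
      be treated separately.\<close>
    have "{k \<in> {..<Q * 2 ^ M}. k mod Q \<in> {h' * c0..<Q}} \<subseteq> ?E"
    proof
      fix k assume k: "k \<in> {k \<in> {..<Q * 2 ^ M}. k mod Q \<in> {h' * c0..<Q}}"
      define r where "r = k mod Q"
      define w where "w = k div Q"
      have r: "r < Q" "h' * c0 \<le> r" and kw: "k = r + Q * w" and w: "w < 2 ^ M"
        using k divQ[of k] by (auto simp: r_def w_def)
      have rc: "r div h' \<ge> c0" using r(2) h' by (simp add: less_eq_div_iff_mult_less_eq mult.commute)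
      have big: "c0 \<le> x" if "x div h' = r div h'" for x
        using rc that div_le_dividend[of x h'] by linarith
      have pr: "pn n \<le> r" "qn n \<le> rr r"
        using big[of r] big[of "rr r"] rr_h'[of r] c0(2,3)[OF n] by linarith+
      have \<sigma>k: "\<sigma>' k = rr r + Q * \<theta> r w" by (simp add: \<sigma>'_def r_def w_def)
      have sub: "k - pn n = (r - pn n) + Q * w" "\<sigma>' k - qn n = (rr r - qn n) + Q * \<theta> r w"
        using pr kw \<sigma>k by linarith+
      have lt: "r - pn n < Q" "rr r - qn n < Q" using r(1) rrQ[OF r(1)] by linarith+
      have E1: "((u (k mod h) \<noteq> e (k div h)) \<noteq> (u ((k - pn n) mod h) \<noteq> e ((k - pn n) div h))) =
          (\<kappa> r n \<noteq> ((r div h' \<in> set_decode w) \<noteq> (a r n \<in> set_decode w)))"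
        unfolding sub(1) label[OF lt(1)] unfolding kw label[OF r(1)] \<kappa>_def a_def by blast
      have E2: "((u (\<sigma>' k mod h) \<noteq> e (\<sigma>' k div h)) \<noteq> (u ((\<sigma>' k - qn n) mod h) \<noteq> e ((\<sigma>' k - qn n) div h))) =
          (\<kappa>' r n \<noteq> ((r div h' \<in> set_decode (\<theta> r w)) \<noteq> (a' r n \<in> set_decode (\<theta> r w))))"
        unfolding sub(2) label[OF lt(2)] unfolding \<sigma>k label[OF rrQ[OF r(1)]] \<kappa>'_def a'_def rr_h' by blast
      have "pn n \<le> k" "qn n \<le> \<sigma>' k" using pr kw \<sigma>k by linarith+
      then show "k \<in> ?E"
        using E1 E2 \<theta>(2)[OF r(1) rc w n] k unfolding pn_def[symmetric] qn_def[symmetric] hm by simp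
    qed
    then have "card {k \<in> {..<Q * 2 ^ M}. k mod Q \<in> {h' * c0..<Q}} \<le> card ?E"
      by (intro card_mono) auto
    moreover have "card {k \<in> {..<Q * 2 ^ M}. k mod Q \<in> {h' * c0..<Q}} = card {h' * c0..<Q} * 2 ^ M"
      using Q by (intro card_mod) auto
    moreover have "8 * card {h' * c0..<Q} = 7 * Q" by (simp add: Q_def M_def)
    ultimately show "7 * (h * m) \<le> 8 * card ?E" unfolding hm
      by (metis (no_types, lifting) mult.assoc mult_le_mono2)
  qed
  have "m \<ge> 2"
  proof -
    have "4 * 1 * 1 \<le> A * M * 2 ^ M" using A M by (intro mult_le_mono) auto
    then show ?thesis by (simp add: m_def)
  qed
  moreover have "l \<ge> K" by (simp add: l_def)
  ultimately show ?thesis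
    using bij comp badcard main unfolding J_def
    by (intro exI[of _ m] exI[of _ e] exI[of _ \<sigma>'] conjI allI impI exI[of _ l]) auto
qed

text \<open>The number of the block of level n that contains a point is one of its digits, so it is
  uniformly distributed.\<close>

lemma (in skew_odometer) measure_bad:
  "measure P (bad n) = real (card {b \<in> {..<m (Suc n)}. \<not> good n b}) / real (m (Suc n))"
proof -
  let ?B = "{b \<in> {..<m (Suc n)}. \<not> good n b}"
  let ?K = "{k. \<not> good n (k div H (Suc n))}"
  have "bad n = {x \<in> \<Omega>. pos (Suc (Suc n)) x \<in> ?K}"
    using pos_Suc_div[of _ "Suc n"] by (auto simp: bad_def)
  then have 1: "measure P (bad n) = real (card (?K \<inter> {..<H (Suc (Suc n))})) / real (H (Suc (Suc n)))"
    by (simp only: measure_pos_set)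
  have "?K \<inter> {..<H (Suc (Suc n))} = {k \<in> {..<H (Suc n) * m (Suc n)}. k mod H (Suc n) \<in> {..<H (Suc n)} \<and> k div H (Suc n) \<in> ?B}"
    by (auto simp: H_Suc[of "Suc n"] less_mult_imp_div_less mult.commute)
  then have "card (?K \<inter> {..<H (Suc (Suc n))}) = card {..<H (Suc n)} * card ?B"
    using card_mod_div[of "{..<H (Suc n)}" "H (Suc n)" ?B "m (Suc n)"] by auto
  then have 2: "real (card (?K \<inter> {..<H (Suc (Suc n))})) = real (H (Suc n)) * real (card ?B)" by simp
  have 3: "real (H (Suc (Suc n))) = real (H (Suc n)) * real (m (Suc n))" by (simp add: H_Suc[of "Suc n"])
  have "real (H (Suc n)) \<noteq> 0" using H_pos[of "Suc n"] by simp
  then show ?thesis unfolding 1 2 3 by (rule mult_divide_mult_cancel_left)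
qed

text \<open>The range from l to 8 l holds 7/8 of the times up to 8 l. The average at 8 l is at least
  7/8 times 7/16, that is 49/128, in an even stage, and at most 1/8 + 7/8 times 1/8, that is 15/64,
  in an odd one. The two values differ by more than 1/10, the tolerance left by a limit approached
  up to 1/20.\<close>

lemma oscillating_averages:
  fixes a :: "nat \<Rightarrow> real"
  assumes a: "\<And>n. 0 \<le> a n" "\<And>n. a n \<le> 1"
    and osc: "\<And>j. \<exists>l\<ge>Suc j. \<forall>n\<in>{l<..8 * l}. if even j then 7 / 16 \<le> a n else a n \<le> 1 / 8"
  shows "\<not> convergent (\<lambda>N. (1 / real N) * (\<Sum>n = 1..N. a n))"
proof
  assume "convergent (\<lambda>N. (1 / real N) * (\<Sum>n = 1..N. a n))"
  then obtain x where "(\<lambda>N. (1 / real N) * (\<Sum>n = 1..N. a n)) \<longlonglongrightarrow> x" by (auto simp: convergent_def)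
  from LIMSEQ_D[OF this, of "1/20"] obtain N0 where N0: "\<And>N. N \<ge> N0 \<Longrightarrow> \<bar>(1 / real N) * (\<Sum>n = 1..N. a n) - x\<bar> < 1 / 20"
    by auto
  have split: "(\<Sum>n = 1..8 * l. a n) = (\<Sum>n = 1..l. a n) + (\<Sum>n\<in>{l<..8 * l}. a n)" for l
  proof -
    have "{1..8 * l} = {1..l} \<union> {l<..8 * l}" by auto
    moreover have "{1..l} \<inter> {l<..8 * l} = {}" by auto
    ultimately show ?thesis by (simp add: sum.union_disjoint)
  qed
  \<comment> \<open>The stage numbers 2 N0 and, further down, 2 N0 + 1 have the two parities, and
    both ranges end beyond \<open>N0\<close>.\<close>
  obtain l where l: "l \<ge> Suc (2 * N0)" "\<forall>n\<in>{l<..8 * l}. 7 / 16 \<le> a n"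
    using osc[of "2 * N0"] by auto
  have "7 * real l * (7 / 16) = (\<Sum>n\<in>{l<..8 * l}. 7 / 16)" by simp
  also have "\<dots> \<le> (\<Sum>n\<in>{l<..8 * l}. a n)" using l(2) by (intro sum_mono) auto
  also have "\<dots> \<le> (\<Sum>n = 1..8 * l. a n)" unfolding split using a(1) by (simp add: sum_nonneg)
  finally have "(1 / real (8 * l)) * (7 * real l * (7 / 16)) \<le> (1 / real (8 * l)) * (\<Sum>n = 1..8 * l. a n)"
    by (intro mult_left_mono) auto
  moreover have "(1 / real (8 * l)) * (7 * real l * (7 / 16)) = 49 / 128" using l(1) by simp
  moreover have "\<bar>(1 / real (8 * l)) * (\<Sum>n = 1..8 * l. a n) - x\<bar> < 1 / 20" using l(1) by (intro N0) simp
  ultimately have big: "x > 49 / 128 - 1 / 20" by linarith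
  obtain l' where l': "l' \<ge> Suc (2 * N0 + 1)" "\<forall>n\<in>{l'<..8 * l'}. a n \<le> 1 / 8"
    using osc[of "2 * N0 + 1"] by auto
  have "(\<Sum>n = 1..8 * l'. a n) \<le> (\<Sum>n = 1..l'. 1) + (\<Sum>n\<in>{l'<..8 * l'}. 1 / 8)"
    unfolding split using a(2) l'(2) by (intro add_mono sum_mono) auto
  also have "\<dots> = real l' + 7 * real l' / 8" by simp
  finally have "(1 / real (8 * l')) * (\<Sum>n = 1..8 * l'. a n) \<le> (1 / real (8 * l')) * (real l' + 7 * real l' / 8)"
    by (intro mult_left_mono) auto
  moreover have "(1 / real (8 * l')) * (real l' + 7 * real l' / 8) = 15 / 64" using l'(1) by (simp add: field_simps)
  moreover have "\<bar>(1 / real (8 * l')) * (\<Sum>n = 1..8 * l'. a n) - x\<bar> < 1 / 20" using l'(1) by (intro N0) simp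
  ultimately show False using big by linarith
qed

section \<open>The two automorphisms\<close>

text \<open>The parity of \<open>j\<close> alternates between forced agreement and forced
  disagreement, and the bound \<open>Suc j\<close> sends the ranges of times to infinity.\<close>

definition stage_condition ::
    "(nat \<Rightarrow> int) \<Rightarrow> (nat \<Rightarrow> int) \<Rightarrow> nat \<Rightarrow> nat \<Rightarrow> (nat \<Rightarrow> bool) \<Rightarrow> (nat \<Rightarrow> nat) \<Rightarrow> bool" where
  "stage_condition p q j h u \<sigma> \<longleftrightarrow> (\<exists>l\<ge>Suc j. \<forall>n\<in>{l<..8 * l}. p n \<ge> 0 \<and> q n \<ge> 0 \<and>
      7 * h \<le> 8 * card {k \<in> {..<h}. nat (p n) \<le> k \<and> nat (q n) \<le> \<sigma> k \<and>
        (((u k \<noteq> u (k - nat (p n))) = (u (\<sigma> k) \<noteq> u (\<sigma> k - nat (q n)))) = even j)})"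

lemma ex_stages:
  assumes p: "filterlim (\<lambda>n. p (Suc n) - p n) at_top sequentially"
    and q: "filterlim (\<lambda>n. q (Suc n) - q n) at_top sequentially"
  obtains h :: "nat \<Rightarrow> nat" and u :: "nat \<Rightarrow> nat \<Rightarrow> bool" and \<sigma> :: "nat \<Rightarrow> nat \<Rightarrow> nat"
    and m :: "nat \<Rightarrow> nat" and e :: "nat \<Rightarrow> nat \<Rightarrow> bool"
  where "h 0 = 1" "\<And>k. u 0 k = False" "\<And>n. bij_betw (\<sigma> n) {..<h n} {..<h n}" "\<And>n. m n \<ge> 2"
    "\<And>n. h (Suc n) = h n * m n" "\<And>n k. u (Suc n) k = (u n (k mod h n) \<noteq> e n (k div h n))"
    "\<And>n k. k < h (Suc n) \<Longrightarrow> \<sigma> (Suc n) k mod h n = \<sigma> n (k mod h n)"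
    "\<And>n. card {b \<in> {..<m n}. \<not> (b + 2 < m n \<and> e n (b + 1) \<noteq> e n b \<and> e n (b + 2) = e n b)} * Suc n \<le> m n"
    "\<And>n. stage_condition p q n (h (Suc n)) (u (Suc n)) (\<sigma> (Suc n))"
proof -
  \<comment> \<open>A state consists of height, sign pattern and permutation. The number of blocks
    and their signs belong to the passage between two states and are extracted after the
    choice.\<close>
  define Q where "Q n = (\<lambda>(h, u, \<sigma>) (h' :: nat, u' :: nat \<Rightarrow> bool, \<sigma>' :: nat \<Rightarrow> nat). \<exists>m (e :: nat \<Rightarrow> bool).
     m \<ge> 2 \<and> h' = h * m \<and> u' = (\<lambda>k. u (k mod h) \<noteq> e (k div h)) \<and> (\<forall>k<h'. \<sigma>' k mod h = \<sigma> (k mod h)) \<and>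
     card {b \<in> {..<m}. \<not> (b + 2 < m \<and> e (b + 1) \<noteq> e b \<and> e (b + 2) = e b)} * Suc n \<le> m \<and>
     stage_condition p q n h' u' \<sigma>')" for n :: nat
  define G where "G = (\<lambda>(h :: nat, u :: nat \<Rightarrow> bool, \<sigma> :: nat \<Rightarrow> nat). h > 0 \<and> bij_betw \<sigma> {..<h} {..<h})"
  have step: "\<exists>st'. G st' \<and> Q n st st'" if G: "G st" for st n
  proof -
    obtain h u \<sigma> where st: "st = (h, u, \<sigma>)" "h > 0" "bij_betw \<sigma> {..<h} {..<h}"
      using G by (cases st) (auto simp: G_def)
    obtain m e \<sigma>' where s: "m \<ge> 2" "bij_betw \<sigma>' {..<h * m} {..<h * m}"
      "\<forall>k<h * m. \<sigma>' k mod h = \<sigma> (k mod h)"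
      "card {b \<in> {..<m}. \<not> (b + 2 < m \<and> e (b + 1) \<noteq> e b \<and> e (b + 2) = e b)} * Suc n \<le> m"
      "\<exists>l\<ge>Suc n. \<forall>i\<in>{l<..8 * l}. p i \<ge> 0 \<and> q i \<ge> 0 \<and>
      7 * (h * m) \<le> 8 * card {k \<in> {..<h * m}. nat (p i) \<le> k \<and> nat (q i) \<le> \<sigma>' k \<and>
        ((((u (k mod h) \<noteq> e (k div h)) \<noteq> (u ((k - nat (p i)) mod h) \<noteq> e ((k - nat (p i)) div h))) =
         ((u (\<sigma>' k mod h) \<noteq> e (\<sigma>' k div h)) \<noteq> (u ((\<sigma>' k - nat (q i)) mod h) \<noteq> e ((\<sigma>' k - nat (q i)) div h)))) = even n)}"
      using stage[OF p q st(2,3), of "Suc n" u "even n"] by blast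
    have "G (h * m, \<lambda>k. u (k mod h) \<noteq> e (k div h), \<sigma>')" using st(2) s(1,2) by (simp add: G_def)
    moreover have "Q n st (h * m, \<lambda>k. u (k mod h) \<noteq> e (k div h), \<sigma>')"
      unfolding Q_def st(1) prod.case stage_condition_def
      by (intro exI[of _ m] exI[of _ e] conjI refl s)
    ultimately show ?thesis by blast
  qed
  \<comment> \<open>The clause for n = 0 anchors the initial state inside the invariant, so that the
    choice starts from the trivial tower of height 1.\<close>
  have "\<exists>st. \<forall>n. (G (st n) \<and> (n = 0 \<longrightarrow> st n = (1, \<lambda>k. False, \<lambda>k. k))) \<and> Q n (st n) (st (Suc n))"
  proof (rule dependent_nat_choice)
    show "\<exists>st. G st \<and> (0 = (0::nat) \<longrightarrow> st = (1, \<lambda>k. False, \<lambda>k. k))"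
      by (intro exI[of _ "(1, \<lambda>k. False, \<lambda>k. k)"]) (simp add: G_def bij_betw_def inj_on_def)
    show "\<exists>st'. (G st' \<and> (Suc n = 0 \<longrightarrow> st' = (1, \<lambda>k. False, \<lambda>k. k))) \<and> Q n st st'"
      if "G st \<and> (n = 0 \<longrightarrow> st = (1, \<lambda>k. False, \<lambda>k. k))" for st n
      using step[of st n] that by simp
  qed
  then obtain st where st': "\<forall>n. (G (st n) \<and> (n = 0 \<longrightarrow> st n = (1, \<lambda>k. False, \<lambda>k. k))) \<and> Q n (st n) (st (Suc n))"
    by (rule exE)
  define h u \<sigma> where "h n = fst (st n)" and "u n = fst (snd (st n))" and "\<sigma> n = snd (snd (st n))" for n
  have st: "st n = (h n, u n, \<sigma> n)" for n by (simp add: h_def u_def \<sigma>_def)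
  have G: "bij_betw (\<sigma> n) {..<h n} {..<h n}" for n
    using st'[rule_format, of n] unfolding st by (simp add: G_def)
  have st0: "h 0 = 1" "\<And>k. u 0 k = False"
    using st'[rule_format, of 0] unfolding h_def u_def by simp_all
  define rel where "rel n m e \<longleftrightarrow> m \<ge> 2 \<and> h (Suc n) = h n * m \<and> u (Suc n) = (\<lambda>k. u n (k mod h n) \<noteq> e (k div h n)) \<and>
      (\<forall>k<h (Suc n). \<sigma> (Suc n) k mod h n = \<sigma> n (k mod h n)) \<and>
     card {b \<in> {..<m}. \<not> (b + 2 < m \<and> e (b + 1) \<noteq> e b \<and> e (b + 2) = e b)} * Suc n \<le> m \<and>
     stage_condition p q n (h (Suc n)) (u (Suc n)) (\<sigma> (Suc n))" for n m and e :: "nat \<Rightarrow> bool"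
  have "\<forall>n. \<exists>m e. rel n m e"
  proof
    fix n
    have "Q n (st n) (st (Suc n))" using st' by blast
    then show "\<exists>m e. rel n m e"
      unfolding st Q_def prod.case rel_def .
  qed
  then obtain m where "\<forall>n. \<exists>e. rel n (m n) e" by (rule choice[THEN exE])
  then obtain e where rel: "\<forall>n. rel n (m n) (e n)" by (rule choice[THEN exE])
  note me = rel[unfolded rel_def]
  show ?thesis
  proof (rule that[of h u \<sigma> m e])
    show "u (Suc n) k = (u n (k mod h n) \<noteq> e n (k div h n))" for n k
      using me[rule_format, of n, THEN conjunct2, THEN conjunct2, THEN conjunct1] by simp
  qed (use st0 G me in \<open>blast+\<close>)
qed

theorem theorem1:
  fixes p q :: "nat \<Rightarrow> int"
  assumes "filterlim (\<lambda>n. p (Suc n) - p n) at_top sequentially"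
    and "filterlim (\<lambda>n. q (Suc n) - q n) at_top sequentially"
  shows "\<exists>(M :: real measure) S T C.
    standard_prob_space M \<and>
    automorphism M S \<and> simple_spectrum M S \<and> singular_spectrum M S \<and>
    automorphism M T \<and> simple_spectrum M T \<and> singular_spectrum M T \<and>
    C \<in> sets M \<and>
    \<not> convergent (\<lambda>N. (1 / real N) *
        (\<Sum>n = 1..N. measure M (aut_power M S (p n) ` C \<inter> aut_power M T (q n) ` C)))"
proof (rule ex_stages[OF assms], goal_cases)
  case st: (1 h u' \<sigma> m e)
  \<comment> \<open>The prefixed radix 2 is the group coordinate; the block number of stage n
    becomes the digit with index n + 1.\<close>
  interpret skew_odometer "case_nat 2 m" e
    by unfold_locales (auto simp: st(4) split: nat.split)
  have L: "L n = h n" for n by (induction n) (simp_all add: st L_Suc)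
  have u: "u n k = u' n k" for n k by (induction n arbitrary: k) (simp_all add: st L)
  interpret conjugate_skew_odometers "case_nat 2 m" e \<sigma>
    by unfold_locales (auto simp: L st)
  have bad: "measure P (bad n) \<le> inverse (real (Suc n))" for n
  proof -
    have "{b \<in> {..<m n}. \<not> good n b} = {b \<in> {..<m n}. \<not> (b + 2 < m n \<and> e n (b + 1) \<noteq> e n b \<and> e n (b + 2) = e n b)}"
      by (simp add: good_def)
    then have "card {b \<in> {..<m n}. \<not> good n b} * Suc n \<le> m n" using st(8)[of n] by simp
    then have "real (card {b \<in> {..<m n}. \<not> good n b}) * real (Suc n) \<le> real (m n)"
      by (simp only: of_nat_mult[symmetric] of_nat_le_iff)
    moreover have "real (m n) > 0" using st(4)[of n] by simp
    ultimately have "real (card {b \<in> {..<m n}. \<not> good n b}) / real (m n) \<le> 1 / real (Suc n)"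
      by (simp only: divide_le_eq pos_le_divide_eq of_nat_0_less_iff zero_less_Suc if_True mult.commute times_divide_eq_left mult_1_left divide_le_eq)
        (simp add: field_simps)
    then show ?thesis unfolding measure_bad by (simp add: divide_inverse)
  qed
  have bad_0: "(\<lambda>n. measure P (bad n)) \<longlonglongrightarrow> 0"
    by (rule tendsto_sandwich[OF _ _ tendsto_const LIMSEQ_inverse_real_of_nat]) (use bad in auto)
  note S_spec = S_simple_spectrum[OF bad_0] S_singular_spectrum[OF bad_0]
  note T_spec = R.T_simple_spectrum[OF S_spec(1), unfolded T_eq] R.T_singular_spectrum[OF S_spec(2), unfolded T_eq]
  define a where "a n = measure P (S.pw (p n) ` fibre \<inter> aut_power P T (q n) ` fibre)" for n
  have osc: "\<not> convergent (\<lambda>N. (1 / real N) * (\<Sum>n = 1..N. a n))"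
  proof (rule oscillating_averages)
    show "0 \<le> a n" "a n \<le> 1" for n by (simp_all add: a_def)
    fix j
    obtain l where l: "l \<ge> Suc j" and c: "\<And>n. n \<in> {l<..8 * l} \<Longrightarrow> p n \<ge> 0 \<and> q n \<ge> 0 \<and>
        7 * L (Suc j) \<le> 8 * card {k \<in> {..<L (Suc j)}. nat (p n) \<le> k \<and> nat (q n) \<le> \<sigma> (Suc j) k \<and>
        (((u (Suc j) k \<noteq> u (Suc j) (k - nat (p n))) = (u (Suc j) (\<sigma> (Suc j) k) \<noteq> u (Suc j) (\<sigma> (Suc j) k - nat (q n)))) = even j)}"
      using st(9)[of j] unfolding stage_condition_def L[symmetric] u[symmetric] by blast
    have "if even j then 7 / 16 \<le> a n else a n \<le> 1 / 8" if n: "n \<in> {l<..8 * l}" for n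
    proof -
      define E where "E = {k \<in> {..<L (Suc j)}. nat (p n) \<le> k \<and> nat (q n) \<le> \<sigma> (Suc j) k \<and>
        (((u (Suc j) k \<noteq> u (Suc j) (k - nat (p n))) = (u (Suc j) (\<sigma> (Suc j) k) \<noteq> u (Suc j) (\<sigma> (Suc j) k - nat (q n)))) = even j)}"
      have E: "7 * L (Suc j) \<le> 8 * card E" and pq: "int (nat (p n)) = p n" "int (nat (q n)) = q n"
        using c[OF n] by (auto simp: E_def)
      have Lp: "real (L (Suc j)) > 0" using L_pos[of "Suc j"] by simp
      have "7 * real (L (Suc j)) \<le> 8 * real (card E)" using E by linarith
      then have r: "7 / 8 \<le> real (card E) / real (L (Suc j))" using Lp by (simp add: pos_le_divide_eq)
      show ?thesis
      proof (cases "even j")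
        case True
        then have "real (card E) / (2 * real (L (Suc j))) \<le> a n"
          using correlation_bounds(1)[where c="even j" and n="Suc j" and p="nat (p n)" and q="nat (q n)"]
          unfolding a_def E_def pq by (simp del: u.simps)
        moreover have "real (card E) / (2 * real (L (Suc j))) = (real (card E) / real (L (Suc j))) / 2" by simp
        ultimately have "7 / 16 \<le> a n" using r by linarith
        then show ?thesis using True by simp
      next
        case False
        then have "a n \<le> 1 - real (card E) / real (L (Suc j))"
          using correlation_bounds(2)[where c="even j" and n="Suc j" and p="nat (p n)" and q="nat (q n)"]
          unfolding a_def E_def pq by (simp del: u.simps)
        then have "a n \<le> 1 / 8" using r by linarith
        then show ?thesis using False by simp
      qed
    qed
    then show "\<exists>l\<ge>Suc j. \<forall>n\<in>{l<..8 * l}. if even j then 7 / 16 \<le> a n else a n \<le> 1 / 8" using l by blast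
  qed
  \<comment> \<open>Up to here the space consists of digit sequences. It is transported to a measure
    on the reals together with both automorphisms.\<close>
  obtain c :: "(nat \<Rightarrow> nat) \<Rightarrow> real" where c: "inj c" using ex_inj_nat_seq_real by blast
  define N where "N = embed_measure P c"
  have spN: "space N = c ` space P" by (simp add: N_def space_embed_measure)
  have iso: "bij_betw c (space P) (space N)" "c \<in> measurable P N" "inv_into (space P) c \<in> measurable N P" "distr P N c = N"
  proof -
    show "bij_betw c (space P) (space N)" unfolding spN by (rule inj_on_imp_bij_betw[OF inj_on_subset[OF c subset_UNIV]])
    show "c \<in> measurable P N" unfolding N_def by (rule measurable_embed_measure2[OF c])
    show "distr P N c = N" unfolding N_def by (rule embed_measure_eq_distr[OF c, symmetric])
    have "(\<lambda>x. inv_into (space P) c (c x)) \<in> measurable P P"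
      by (subst measurable_cong[where g="\<lambda>x. x"]) (auto simp: inv_into_f_f[OF inj_on_subset[OF c subset_UNIV]])
    then show "inv_into (space P) c \<in> measurable N P" unfolding N_def by (rule measurable_embed_measure1)
  qed
  \<comment> \<open>One injection serves both automorphisms, so the image of \<open>fibre\<close> is
    a common set \<open>C\<close> and the correlations are unchanged.\<close>
  interpret A: measure_isomorphism P S N c by unfold_locales (use iso in auto)
  interpret B: measure_isomorphism P T N c
    using R.automorphism_space_T iso unfolding T_eq measure_isomorphism_def measure_isomorphism_axioms_def by blast
  have fib: "fibre \<subseteq> space P" using sets.sets_into_space[OF fibre_sets] .
  have "measure N (aut_power N A.T (p n) ` (c ` fibre) \<inter> aut_power N B.T (q n) ` (c ` fibre)) = a n" for n
  proof -
    have "aut_power N A.T (p n) ` (c ` fibre) \<inter> aut_power N B.T (q n) ` (c ` fibre) = c ` (S.pw (p n) ` fibre \<inter> aut_power P T (q n) ` fibre)"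
      unfolding A.T_power_image[OF fib] B.T_power_image[OF fib] by (rule image_Int[OF c, symmetric])
    then show ?thesis
      unfolding a_def using A.measure_image(1) power_image_sets[OF fibre_sets] T_image_sets by (simp add: sets.Int)
  qed
  then have "\<not> convergent (\<lambda>K. (1 / real K) * (\<Sum>n = 1..K. measure N (aut_power N A.T (p n) ` (c ` fibre) \<inter> aut_power N B.T (q n) ` (c ` fibre))))"
    using osc by simp
  moreover have "standard_prob_space N" unfolding N_def by (rule standard_embed[OF c])
  ultimately show ?case
    using A.T_automorphism A.T_simple_spectrum[OF S_spec(1)] A.T_singular_spectrum[OF S_spec(2)]
      B.T_automorphism B.T_simple_spectrum[OF T_spec(1)] B.T_singular_spectrum[OF T_spec(2)]
      A.measure_image(2)[OF fibre_sets]
    by blast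
qed

end
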